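(* Let $(M,g)$ be a smooth compact Riemannian manifold of dimension $n$, let $b\in L^\infty(M)$ with $b\ge 0$ a.e., and let $\gamma>0$. Assume that there exist an integer $1\le n''\le n-1$, $\varepsilon_0>0$ and $C_1>0$ such that, with $n'=n-n''$, the following hold: (i) $\left(B_{\mathbb{R}^{n'}}(0,\varepsilon_0)\times\mathbb{T}^{n''},\ |dx_1'|^2+\cdots+|dx_{n'}'|^2+|dx_1''|^2+\cdots+|dx_{n''}''|^2\right)\subset (M,g)$ (that is, this flat product is isometrically identified with an open subset of $(M,g)$); (ii) $\nabla_{x''}b=0$ in $\mathcal{N}=B_{\mathbb{R}^{n'}}(0,\varepsilon_0)\times\mathbb{T}^{n''}$ (so that $b=b(x')$ on $\mathcal{N}$); (iii) $0\le b(x')\le C_1|x'|^{2\gamma}$ in $\mathcal{N}$. Then there exist $C_0>0$ and a sequence $(u_k)_{k\in\mathbb{N}}\in H^2(M)^{\mathbb{N}}$ with $\|u_k\|_{L^2(M)}=1$ such that $$\|P_k u_k\|_{L^2(M)}\le C_0\,k^{\frac{1}{\gamma+1}}\qquad\text{for all } k\in\mathbb{N}^*,$$ where $P_k$ denotes the operator $P_\lambda$ with $\lambda=k$.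
   Context: $\Delta_g$ is the (negative) Laplace–Beltrami operator on $(M,g)$. For $\lambda\in\mathbb{R}\setminus\{0\}$, $P_\lambda=-\Delta_g-\lambda^2+i\lambda b$ with domain $D(P_\lambda)=H^2(M)$. $\mathbb{T}^{n''}=(\mathbb{R}/2\pi\mathbb{Z})^{n''}$; $B_{\mathbb{R}^{n'}}(0,\varepsilon_0)$ is the Euclidean ball of radius $\varepsilon_0$ centred at $0$ in $\mathbb{R}^{n'}$; coordinates on $\mathcal{N}$ are $(x',x'')$ with $x'\in B_{\mathbb{R}^{n'}}(0,\varepsilon_0)$ and $x''\in\mathbb{T}^{n''}$. $\mathbb{N}^*$ is the set of positive integers. *)

theory Defs
  imports "HOL-Analysis.Analysis"
begin

primrec Ck_on :: "nat \<Rightarrow> 'a::euclidean_space set \<Rightarrow> ('a \<Rightarrow> 'b::real_normed_vector) \<Rightarrow> bool" where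
  "Ck_on 0 S f \<longleftrightarrow> continuous_on S f"
| "Ck_on (Suc k) S f \<longleftrightarrow>
     (\<exists>f'. (\<forall>x\<in>S. (f has_derivative f' x) (at x)) \<and> (\<forall>v. Ck_on k S (\<lambda>x. f' x v)))"

text \<open>Only used for open \<open>S\<close>, where the derivative \<open>f'\<close> above is unique.\<close>

definition smooth_on :: "'a::euclidean_space set \<Rightarrow> ('a \<Rightarrow> 'b::real_normed_vector) \<Rightarrow> bool" where
  "smooth_on S f \<longleftrightarrow> (\<forall>k. Ck_on k S f)"

definition diffeo_between ::
    "'a::euclidean_space set \<Rightarrow> 'b::euclidean_space set \<Rightarrow> ('a \<Rightarrow> 'b) \<Rightarrow> bool" where
  "diffeo_between V W f \<longleftrightarrow>
     open V \<and> open W \<and> bij_betw f V W \<and> smooth_on V f \<and> smooth_on W (inv_into V f)"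

definition test_function :: "'a::euclidean_space set \<Rightarrow> ('a \<Rightarrow> real) \<Rightarrow> bool" where
  "test_function V \<psi> \<longleftrightarrow>
     smooth_on UNIV \<psi> \<and> compact (closure {x. \<psi> x \<noteq> 0}) \<and> closure {x. \<psi> x \<noteq> 0} \<subseteq> V"

definition partial_deriv ::
    "'n::finite \<Rightarrow> (real^'n \<Rightarrow> 'b::real_normed_vector) \<Rightarrow> real^'n \<Rightarrow> 'b" where
  "partial_deriv i f x = frechet_derivative f (at x) (axis i 1)"

definition loc_integrable ::
    "'a::euclidean_space set \<Rightarrow> ('a \<Rightarrow> 'b::euclidean_space) \<Rightarrow> bool" where
  "loc_integrable V u \<longleftrightarrow> (\<forall>K. compact K \<and> K \<subseteq> V \<longrightarrow> set_integrable lborel K u)"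

definition loc_square_integrable ::
    "'a::euclidean_space set \<Rightarrow> ('a \<Rightarrow> 'b::euclidean_space) \<Rightarrow> bool" where
  "loc_square_integrable V u \<longleftrightarrow>
     set_borel_measurable lborel V u \<and>
     (\<forall>K. compact K \<and> K \<subseteq> V \<longrightarrow> set_integrable lborel K (\<lambda>x. (norm (u x))\<^sup>2))"

text \<open>\<open>weak_partial V i u v\<close>: \<open>v\<close> represents the distributional derivative \<open>\<partial>\<^sub>i u\<close> on the open
  set \<open>V\<close>. Real-valued test functions suffice, also for complex-valued \<open>u\<close>.\<close>

definition weak_partial ::
    "(real^'n) set \<Rightarrow> 'n::finite \<Rightarrow> (real^'n \<Rightarrow> 'b::euclidean_space) \<Rightarrow> (real^'n \<Rightarrow> 'b) \<Rightarrow> bool"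
  where
  "weak_partial V i u v \<longleftrightarrow>
     loc_integrable V u \<and> loc_integrable V v \<and>
     (\<forall>\<psi>. test_function V \<psi> \<longrightarrow>
        (LINT x:V|lborel. partial_deriv i \<psi> x *\<^sub>R u x) = - (LINT x:V|lborel. \<psi> x *\<^sub>R v x))"

text \<open>The local Sobolev spaces \<open>H\<^sup>k\<close> of an open set \<open>V\<close>.\<close>

primrec sobolev_loc ::
    "nat \<Rightarrow> (real^'n::finite) set \<Rightarrow> (real^'n \<Rightarrow> 'b::euclidean_space) \<Rightarrow> bool" where
  "sobolev_loc 0 V u \<longleftrightarrow> loc_square_integrable V u"
| "sobolev_loc (Suc k) V u \<longleftrightarrow>
     loc_square_integrable V u \<and> (\<forall>i. \<exists>v. weak_partial V i u v \<and> sobolev_loc k V v)"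

type_synonym ('m, 'n) chart = "'m set \<times> ('m \<Rightarrow> (real, 'n) vec)"

text \<open>The manifold is the whole type \<open>'m\<close>; its dimension is \<open>CARD('n)\<close>. Hausdorffness and second
  countability are the sort of \<open>'m\<close>. The inverse of a chart \<open>(U, \<phi>)\<close> is \<open>inv_into U \<phi>\<close>.\<close>

definition smooth_atlas ::
    "('m::{t2_space,second_countable_topology}, 'n::finite) chart set \<Rightarrow> bool" where
  "smooth_atlas A \<longleftrightarrow>
     (\<Union>c\<in>A. fst c) = UNIV \<and>
     (\<forall>(U, \<phi>)\<in>A. open U \<and> open (\<phi> ` U) \<and> homeomorphism U (\<phi> ` U) \<phi> (inv_into U \<phi>)) \<and>
     (\<forall>(U, \<phi>)\<in>A. \<forall>(U', \<phi>')\<in>A. smooth_on (\<phi> ` (U \<inter> U')) (\<phi>' \<circ> inv_into U \<phi>))"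

definition jacobian :: "(real^'n \<Rightarrow> real^'n) \<Rightarrow> real^'n::finite \<Rightarrow> real^'n^'n" where
  "jacobian f x = matrix (frechet_derivative f (at x))"

text \<open>\<open>g (U, \<phi>) x\<close> is the matrix \<open>(g\<^sub>i\<^sub>j(x))\<close> of the metric in the chart \<open>(U, \<phi>)\<close>, at the coordinate
  point \<open>x \<in> \<phi> ` U\<close>; the last clause is the transformation law of a covariant 2-tensor.\<close>

definition riemannian_manifold ::
    "('m::{t2_space,second_countable_topology}, 'n::finite) chart set
      \<Rightarrow> (('m, 'n) chart \<Rightarrow> real^'n \<Rightarrow> real^'n^'n) \<Rightarrow> bool" where
  "riemannian_manifold A g \<longleftrightarrow>
     smooth_atlas A \<and>
     (\<forall>(U, \<phi>)\<in>A. smooth_on (\<phi> ` U) (g (U, \<phi>)) \<and>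
        (\<forall>x\<in>\<phi> ` U. transpose (g (U, \<phi>) x) = g (U, \<phi>) x \<and>
           (\<forall>v. v \<noteq> 0 \<longrightarrow> v \<bullet> (g (U, \<phi>) x *v v) > 0))) \<and>
     (\<forall>(U, \<phi>)\<in>A. \<forall>(U', \<phi>')\<in>A. \<forall>p\<in>U \<inter> U'.
        g (U, \<phi>) (\<phi> p) =
          transpose (jacobian (\<phi>' \<circ> inv_into U \<phi>) (\<phi> p)) ** g (U', \<phi>') (\<phi>' p)
            ** jacobian (\<phi>' \<circ> inv_into U \<phi>) (\<phi> p))"

definition riemannian_volume ::
    "('m::{t2_space,second_countable_topology}, 'n::finite) chart set
      \<Rightarrow> (('m, 'n) chart \<Rightarrow> real^'n \<Rightarrow> real^'n^'n) \<Rightarrow> 'm measure" where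
  "riemannian_volume A g = (THE \<mu>. sets \<mu> = sets borel \<and>
     (\<forall>(U, \<phi>)\<in>A. \<forall>E\<in>sets borel. E \<subseteq> U \<longrightarrow>
        emeasure \<mu> E = (\<integral>\<^sup>+x\<in>\<phi> ` E. ennreal (sqrt (det (g (U, \<phi>) x))) \<partial>lborel)))"

text \<open>Elements of \<open>L\<^sup>2\<close>, \<open>H\<^sup>k\<close> and \<open>L\<^sup>\<infinity>\<close> are treated through Borel measurable representatives.\<close>

definition L2_space :: "'m::topological_space measure \<Rightarrow> ('m \<Rightarrow> complex) set" where
  "L2_space \<mu> = {f \<in> borel_measurable borel. integrable \<mu> (\<lambda>p. (norm (f p))\<^sup>2)}"

definition L2_norm :: "'m measure \<Rightarrow> ('m \<Rightarrow> complex) \<Rightarrow> real" where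
  "L2_norm \<mu> f = sqrt (LINT p|\<mu>. (norm (f p))\<^sup>2)"

definition Linfty_space :: "'m::topological_space measure \<Rightarrow> ('m \<Rightarrow> real) set" where
  "Linfty_space \<mu> = {f \<in> borel_measurable borel. \<exists>C. AE p in \<mu>. \<bar>f p\<bar> \<le> C}"

text \<open>On a compact manifold, \<open>H\<^sup>k(M)\<close> consists of the functions which are locally \<open>H\<^sup>k\<close> in charts.\<close>

definition sobolev_space ::
    "nat \<Rightarrow> ('m::{t2_space,second_countable_topology}, 'n::finite) chart set
      \<Rightarrow> (('m, 'n) chart \<Rightarrow> real^'n \<Rightarrow> real^'n^'n) \<Rightarrow> ('m \<Rightarrow> complex) set" where
  "sobolev_space k A g = {u \<in> L2_space (riemannian_volume A g).
     \<forall>(U, \<phi>)\<in>A. sobolev_loc k (\<phi> ` U) (u \<circ> inv_into U \<phi>)}"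

text \<open>\<open>f\<close> represents \<open>\<Delta>\<^sub>g u\<close>, that is, almost everywhere in every chart,
  \<open>f = |g|\<^sup>-\<^sup>1\<^sup>/\<^sup>2 \<Sum>\<^sub>i \<partial>\<^sub>i (\<Sum>\<^sub>j |g|\<^sup>1\<^sup>/\<^sup>2 g\<^sup>i\<^sup>j \<partial>\<^sub>j u)\<close> with weak derivatives: \<open>Du j = \<partial>\<^sub>j u\<close>, and \<open>w i\<close> is
  the \<open>i\<close>-th term of the outer sum. A relation rather than a function of \<open>u\<close>, since \<open>f\<close> is
  determined only up to null sets.\<close>

definition has_laplacian ::
    "('m::{t2_space,second_countable_topology}, 'n::finite) chart set
      \<Rightarrow> (('m, 'n) chart \<Rightarrow> real^'n \<Rightarrow> real^'n^'n) \<Rightarrow> ('m \<Rightarrow> complex) \<Rightarrow> ('m \<Rightarrow> complex) \<Rightarrow> bool"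
  where
  "has_laplacian A g u f \<longleftrightarrow>
     f \<in> borel_measurable borel \<and>
     (\<forall>(U, \<phi>)\<in>A. \<exists>Du w.
        (\<forall>j. weak_partial (\<phi> ` U) j (u \<circ> inv_into U \<phi>) (Du j)) \<and>
        (\<forall>i. weak_partial (\<phi> ` U) i
           (\<lambda>x. \<Sum>j\<in>UNIV. (sqrt (det (g (U, \<phi>) x)) * matrix_inv (g (U, \<phi>) x) $ i $ j) *\<^sub>R Du j x)
           (w i)) \<and>
        (AE x in lborel. x \<in> \<phi> ` U \<longrightarrow>
           sqrt (det (g (U, \<phi>) x)) *\<^sub>R f (inv_into U \<phi> x) = (\<Sum>i\<in>UNIV. w i x)))"

text \<open>\<open>h\<close> represents \<open>P\<^sub>\<lambda> u\<close>, where \<open>P\<^sub>\<lambda> = - \<Delta>\<^sub>g - \<lambda>\<^sup>2 + i \<lambda> b\<close> has domain \<open>H\<^sup>2(M)\<close>.\<close>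

definition has_damped_op ::
    "('m::{t2_space,second_countable_topology}, 'n::finite) chart set
      \<Rightarrow> (('m, 'n) chart \<Rightarrow> real^'n \<Rightarrow> real^'n^'n) \<Rightarrow> ('m \<Rightarrow> real)
      \<Rightarrow> real \<Rightarrow> ('m \<Rightarrow> complex) \<Rightarrow> ('m \<Rightarrow> complex) \<Rightarrow> bool" where
  "has_damped_op A g b lam u h \<longleftrightarrow>
     u \<in> sobolev_space 2 A g \<and>
     (\<exists>f. has_laplacian A g u f \<and>
        h = (\<lambda>p. - f p - of_real (lam\<^sup>2) * u p + \<i> * of_real lam * of_real (b p) * u p))"

text \<open>Points of \<open>\<real>\<^sup>n\<close> are split as \<open>x = (x', x'')\<close>: \<open>x''\<close> consists of the coordinates with index in
  \<open>J\<close>, and \<open>x'\<close> of the others. The product \<open>B(0, \<epsilon>) \<times> \<bbbT>\<^sup>n''\<close> is the quotient of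
  \<open>flat_tube J \<epsilon> = B(0, \<epsilon>) \<times> \<real>\<^sup>n''\<close> by \<open>torus_cong J\<close>.\<close>

definition norm' :: "'n::finite set \<Rightarrow> real^'n \<Rightarrow> real" where
  "norm' J x = sqrt (\<Sum>i\<in>- J. (x $ i)\<^sup>2)"

definition flat_tube :: "'n::finite set \<Rightarrow> real \<Rightarrow> (real^'n) set" where
  "flat_tube J \<epsilon> = {x. norm' J x < \<epsilon>}"

definition torus_cong :: "'n::finite set \<Rightarrow> real^'n \<Rightarrow> real^'n \<Rightarrow> bool" where
  "torus_cong J x y \<longleftrightarrow>
     (\<forall>i\<in>- J. x $ i = y $ i) \<and> (\<forall>i\<in>J. \<exists>m::int. x $ i - y $ i = 2 * pi * of_int m)"

text \<open>\<open>F\<close> induces an isometry (a diffeomorphism pulling the metric back to the flat one) of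
  \<open>flat_tube J \<epsilon> / torus_cong J\<close> onto the open subset \<open>F ` flat_tube J \<epsilon>\<close> of the manifold:
  it is injective modulo \<open>torus_cong J\<close>, and a local diffeomorphism with Jacobian \<open>D\<close> in charts
  satisfying \<open>D\<^sup>T g D = 1\<close>.\<close>

definition flat_product_embedding ::
    "('m::{t2_space,second_countable_topology}, 'n::finite) chart set
      \<Rightarrow> (('m, 'n) chart \<Rightarrow> real^'n \<Rightarrow> real^'n^'n) \<Rightarrow> 'n set \<Rightarrow> real \<Rightarrow> (real^'n \<Rightarrow> 'm) \<Rightarrow> bool"
  where
  "flat_product_embedding A g J \<epsilon> F \<longleftrightarrow>
     (\<forall>x\<in>flat_tube J \<epsilon>. \<forall>y\<in>flat_tube J \<epsilon>. F x = F y \<longleftrightarrow> torus_cong J x y) \<and>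
     (\<forall>(U, \<phi>)\<in>A. \<forall>x\<in>flat_tube J \<epsilon>. F x \<in> U \<longrightarrow>
        (\<exists>W. x \<in> W \<and> W \<subseteq> flat_tube J \<epsilon> \<and> F ` W \<subseteq> U \<and>
           diffeo_between W ((\<phi> \<circ> F) ` W) (\<phi> \<circ> F)) \<and>
        transpose (jacobian (\<phi> \<circ> F) x) ** g (U, \<phi>) (\<phi> (F x)) ** jacobian (\<phi> \<circ> F) x = mat 1)"

end

theory Submission
  imports Defs
begin

text \<open>
  A plane wave \<open>exp (\<i> k x''\<^sub>i)\<close> along one torus direction \<open>i\<close> is an exact eigenfunction: its
  Laplacian is \<open>-k\<^sup>2\<close> times itself. Cutting it off to \<open>\<bar>x'\<^sub>j\<bar> \<le> r\<close> in the remaining directions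
  costs \<open>r\<^sup>-\<^sup>2\<close> in the Laplacian, while the damping term contributes at most
  \<open>k sup b = O(k r\<^bsup>2\<gamma>\<^esup>)\<close> on the support, because \<open>b\<close> vanishes to order \<open>2\<gamma>\<close> at \<open>x' = 0\<close>. The two
  errors balance for \<open>r\<close> of size \<open>k\<^bsup>-1/(2\<gamma>+2)\<^esup>\<close>, and both are then of size \<open>k\<^bsup>1/(\<gamma>+1)\<^esup>\<close>. The
  cut-off is the product of the one-dimensional profiles \<open>(1 - (x'\<^sub>j / r)\<^sup>2)\<^sub>+\<^sup>3\<close>: it is \<open>C\<^sup>2\<close>, and as
  the regions where it is supported and where it is bounded below are boxes, the comparison of
  the \<open>L\<^sup>2\<close> norms of the error and of the function reduces to the volumes of two boxes that
  differ by a factor of at most \<open>2\<^sup>n\<close> (\<open>quasimode_exists\<close>).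

  The rest of the work is to make this computation on the flat tube valid on the manifold. Three
  facts carry it.

  The Riemannian volume, which is defined by a description, exists and is unique: chart volumes
  agree on overlaps by change of variables and are glued along a countable disjoint cover
  (\<open>volume_exists\<close>, \<open>riemannian_volume_is_volume\<close>). On the image of the tube it is the image of
  Lebesgue measure on a fundamental cell of the torus (\<open>embedding_nn_integral\<close>).

  A periodic function on the tube that is supported in a smaller slab, extended by zero, is as
  regular on the whole manifold as it is on the tube (\<open>push_Ck\<close>); here compactness of the slab
  modulo periods and the Hausdorff property make the image of the support closed. So \<open>C\<^sup>2\<close>
  functions on the tube give elements of \<open>H\<^sup>2\<close>.

  The Laplacian of the extension is the extension of the flat Laplacian (\<open>push_has_laplacian\<close>).
  Rather than differentiating the transformation law of the metric, one compares both sides in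
  weak form: the Dirichlet forms agree by the chain rule and a change of variables, and the
  fundamental lemma of the calculus of variations gives the pointwise identity
  (\<open>laplace_beltrami_in_flat_coordinates\<close>).
\<close>

section \<open>Change of variables over a finite index type\<close>

text \<open>A copy of a finite type, well-ordered by an enumeration. Neither Lebesgue measure nor
  determinants depend on an order of the coordinates, so change of variables passes from
  well-ordered index types to all finite ones along \<open>reindex\<close> and
  \<open>unreindex\<close>.\<close>
typedef 'n ordered_index = "UNIV :: 'n set" by simp

instantiation ordered_index :: (finite) "{finite,wellorder}"
begin
definition less_eq_ordered_index :: "'a ordered_index \<Rightarrow> 'a ordered_index \<Rightarrow> bool" where
  "less_eq_ordered_index x y \<longleftrightarrow>
     to_nat_on UNIV (Rep_ordered_index x) \<le> to_nat_on UNIV (Rep_ordered_index y)"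
definition less_ordered_index :: "'a ordered_index \<Rightarrow> 'a ordered_index \<Rightarrow> bool" where
  "less_ordered_index x y \<longleftrightarrow>
     to_nat_on UNIV (Rep_ordered_index x) < to_nat_on UNIV (Rep_ordered_index y)"
instance
proof
  have "range (Abs_ordered_index :: 'a \<Rightarrow> _) = UNIV"
    by (metis UNIV_I Rep_ordered_index_inverse surjI)
  then show "finite (UNIV :: 'a ordered_index set)" by (metis finite finite_imageI)
  have inj: "inj_on (to_nat_on (UNIV :: 'a set)) UNIV" by (simp add: inj_on_to_nat_on uncountable_infinite)
  fix x y z :: "'a ordered_index"
  show "(x < y) = (x \<le> y \<and> \<not> y \<le> x)"
    by (auto simp: less_eq_ordered_index_def less_ordered_index_def)
  show "x \<le> x" by (simp add: less_eq_ordered_index_def)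
  show "x \<le> y \<Longrightarrow> y \<le> z \<Longrightarrow> x \<le> z" by (simp add: less_eq_ordered_index_def)
  show "x \<le> y \<Longrightarrow> y \<le> x \<Longrightarrow> x = y"
    using inj by (auto simp: less_eq_ordered_index_def inj_on_def Rep_ordered_index_inject[symmetric])
  show "x \<le> y \<or> y \<le> x" by (auto simp: less_eq_ordered_index_def)
next
  fix P :: "'a ordered_index \<Rightarrow> bool" and a
  assume *: "\<And>x. (\<And>y. y < x \<Longrightarrow> P y) \<Longrightarrow> P x"
  show "P a"
    by (induction a rule: measure_induct_rule[of "\<lambda>x. to_nat_on UNIV (Rep_ordered_index x)"])
      (rule *, simp add: less_ordered_index_def)
qed
end

lemma bij_Rep_ordered_index: "bij Rep_ordered_index"
  by (metis Abs_ordered_index_inverse Rep_ordered_index_inverse UNIV_I o_bij comp_def eq_id_iff)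

definition reindex :: "real^'n \<Rightarrow> real^('n ordered_index)" where
  "reindex x = (\<chi> i. x $ Rep_ordered_index i)"

definition unreindex :: "real^('n ordered_index) \<Rightarrow> real^'n" where
  "unreindex x = (\<chi> i. x $ Abs_ordered_index i)"

lemma unreindex_reindex [simp]: "unreindex (reindex x) = x"
  and reindex_unreindex [simp]: "reindex (unreindex y) = y"
  by (simp_all add: reindex_def unreindex_def vec_eq_iff Abs_ordered_index_inverse Rep_ordered_index_inverse)

lemma linear_reindex: "linear (reindex :: real^'n::finite \<Rightarrow> _)"
  and linear_unreindex: "linear (unreindex :: _ \<Rightarrow> real^'n::finite)"
  by (auto intro!: linearI simp: reindex_def unreindex_def vec_eq_iff)

text \<open>Conjugation by the bijection of the index types permutes the terms of the Leibniz
  formula and preserves the signs.\<close>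
lemma det_reindex:
  fixes M :: "real^'n::finite^'n"
  shows "det (\<chi> i j. M $ Rep_ordered_index i $ Rep_ordered_index j) = det M"
proof -
  let ?R = "Rep_ordered_index :: 'n ordered_index \<Rightarrow> 'n"
  have bR: "bij_betw ?R UNIV UNIV" by (rule bij_Rep_ordered_index)
  have inv: "inv_into UNIV ?R = Abs_ordered_index"
    by (rule ext) (metis Abs_ordered_index_inverse Rep_ordered_index_inverse UNIV_I inv_f_f inj_def)
  have bb: "bij_betw (map_permutation UNIV ?R) {p. p permutes UNIV} {p. p permutes UNIV}"
    using bij_betw_permutations[OF bR]
    by (rule bij_betw_cong[THEN iffD1, rotated])
      (auto simp: map_permutation_def restrict_id_def fun_eq_iff bij_is_surj[OF bij_Rep_ordered_index])
  have "det M = (\<Sum>p | p permutes UNIV. of_int (sign (map_permutation UNIV ?R p)) *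
      (\<Prod>i\<in>UNIV. M $ i $ (map_permutation UNIV ?R p) i))"
    unfolding det_def by (rule sum.reindex_bij_betw[OF bb, symmetric])
  also have "\<dots> = (\<Sum>p | p permutes UNIV. of_int (sign p) * (\<Prod>i\<in>UNIV. M $ ?R i $ ?R (p i)))"
  proof (rule sum.cong, simp)
    fix p :: "'n ordered_index \<Rightarrow> _" assume "p \<in> {p. p permutes UNIV}"
    then have p: "p permutes UNIV" by simp
    have "(\<Prod>i\<in>UNIV. M $ i $ (map_permutation UNIV ?R p) i) =
       (\<Prod>i\<in>UNIV. M $ ?R i $ (map_permutation UNIV ?R p) (?R i))"
      by (rule prod.reindex_bij_betw[OF bR, symmetric])
    also have "\<dots> = (\<Prod>i\<in>UNIV. M $ ?R i $ ?R (p i))"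
      using bij_Rep_ordered_index
      by (intro prod.cong refl)
        (simp add: map_permutation_def restrict_id_def bij_is_inj[OF bij_Rep_ordered_index] bij_is_surj)
    finally show "of_int (sign (map_permutation UNIV ?R p)) *
      (\<Prod>i\<in>UNIV. M $ i $ (map_permutation UNIV ?R p) i) =
      of_int (sign p) * (\<Prod>i\<in>UNIV. M $ ?R i $ ?R (p i))"
      using sign_map_permutation[of ?R UNIV p] p bij_Rep_ordered_index bij_is_inj by auto
  qed
  finally show ?thesis by (simp add: det_def)
qed

lemma prod_Basis_vec: "(\<Prod>b\<in>Basis. x \<bullet> b) = (\<Prod>i\<in>UNIV. (x :: real^'k::finite) $ i)"
proof -
  have "(Basis :: (real^'k) set) = (\<lambda>i. axis i 1) ` (UNIV :: 'k set)" by (auto simp: Basis_vec_def Basis_real_def)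
  then have "(\<Prod>b\<in>Basis. x \<bullet> b) = (\<Prod>b\<in>(\<lambda>i. axis i 1) ` UNIV. x \<bullet> b)" by metis
  also have "\<dots> = (\<Prod>i\<in>UNIV. x $ i)"
    by (subst prod.reindex) (auto simp: inj_on_def axis_eq_axis inner_axis)
  finally show ?thesis .
qed

lemma distr_lborel_unreindex: "distr lborel borel (unreindex :: _ \<Rightarrow> real^'n::finite) = lborel"
proof (rule lborel_eqI[symmetric])
  fix l u :: "real^'n" assume le: "\<And>b. b \<in> Basis \<Longrightarrow> l \<bullet> b \<le> u \<bullet> b"
  have [measurable]: "(unreindex :: _ \<Rightarrow> real^'n) \<in> borel_measurable borel"
    by (intro borel_measurable_continuous_onI linear_continuous_on linear_conv_bounded_linear[THEN iffD1] linear_unreindex)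
  have le': "l $ i \<le> u $ i" for i using le[of "axis i 1"] by (simp add: inner_axis axis_in_Basis_iff)
  have eq: "unreindex -` box l u = box (reindex l) (reindex u)"
    unfolding reindex_def unreindex_def
    by (auto simp: mem_box_cart) (metis Rep_ordered_index_inverse, metis Rep_ordered_index_inverse, metis Abs_ordered_index_inverse UNIV_I, metis Abs_ordered_index_inverse UNIV_I)
  have "emeasure (distr lborel borel unreindex) (box l u) = emeasure lborel (box (reindex l) (reindex u))"
    by (simp add: emeasure_distr eq)
  also have "\<dots> = (\<Prod>b\<in>Basis. (reindex u - reindex l) \<bullet> b)"
    by (rule emeasure_lborel_box)
      (auto simp: Basis_vec_def inner_axis reindex_def le')
  also have "(\<Prod>b\<in>Basis. (reindex u - reindex l) \<bullet> b) = (\<Prod>i\<in>UNIV. (u - l) $ Rep_ordered_index i)"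
    by (simp add: prod_Basis_vec reindex_def)
  also have "\<dots> = (\<Prod>b\<in>Basis. (u - l) \<bullet> b)"
    unfolding prod_Basis_vec by (rule prod.reindex_bij_betw[OF bij_Rep_ordered_index])
  finally show "emeasure (distr lborel borel unreindex) (box l u) = (\<Prod>b\<in>Basis. (u - l) \<bullet> b)" .
qed simp


lemma emeasure_unreindex_image:
  fixes X :: "(real^('n::finite ordered_index)) set"
  assumes "X \<in> sets borel"
  shows "unreindex ` X \<in> sets borel" "emeasure lborel (unreindex ` X) = emeasure lborel X"
proof -
  have eq: "unreindex ` X = reindex -` X" for X :: "(real^('n ordered_index)) set"
    by (auto simp: image_iff) (metis unreindex_reindex)
  have m: "(reindex :: real^'n \<Rightarrow> _) \<in> borel_measurable borel"
     "(unreindex :: _ \<Rightarrow> real^'n) \<in> borel_measurable borel"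
    by (intro borel_measurable_continuous_onI linear_continuous_on
        linear_conv_bounded_linear[THEN iffD1] linear_unreindex linear_reindex)+
  show *: "unreindex ` X \<in> sets borel"
    unfolding eq using measurable_sets_borel[OF m(1) assms] .
  note [measurable] = m
  have "emeasure lborel (unreindex ` X) = emeasure (distr lborel borel unreindex) (unreindex ` X)"
    by (simp add: distr_lborel_unreindex)
  also have "\<dots> = emeasure lborel (unreindex -` (unreindex ` X))"
    using * by (simp add: emeasure_distr)
  also have "unreindex -` (unreindex ` X) = X"
    by (auto simp: image_iff) (metis reindex_unreindex)
  finally show "emeasure lborel (unreindex ` X) = emeasure lborel X" .
qed

text \<open>The change of variables theorem for finite measures says that both sides take the same
  finite values; so they are infinite together, and no integrability assumption is left.\<close>
lemma ordered_emeasure_image: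
  fixes f :: "real^'k::{finite,wellorder} \<Rightarrow> real^'k::_"
  assumes E: "E \<in> sets borel" "f ` E \<in> sets borel"
    and der: "\<And>x. x \<in> E \<Longrightarrow> (f has_derivative f' x) (at x)"
    and inj: "inj_on f E"
    and meas: "(\<lambda>x. indicator E x * \<bar>det (matrix (f' x))\<bar>) \<in> borel_measurable borel"
  shows "emeasure lborel (f ` E) = (\<integral>\<^sup>+x. ennreal (indicator E x * \<bar>det (matrix (f' x))\<bar>) \<partial>lborel)"
    (is "?L = ?R")
proof -
  have lE: "E \<in> sets lebesgue" using E(1) by simp
  have "\<And>x. x \<in> E \<Longrightarrow> (f has_derivative f' x) (at x within E)"
    using der has_derivative_at_withinI by blast
  note main = has_measure_differentiable_image[OF lE this inj]
  have R: "((\<lambda>x. \<bar>det (matrix (f' x))\<bar>) has_integral m) E \<longleftrightarrow> ?R = ennreal m \<and> 0 \<le> m" for m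
  proof -
    have "((\<lambda>x. \<bar>det (matrix (f' x))\<bar>) has_integral m) E \<longleftrightarrow>
      ((\<lambda>x. indicator E x * \<bar>det (matrix (f' x))\<bar>) has_integral m) UNIV"
      by (subst has_integral_restrict_UNIV[symmetric])
        (rule arg_cong[of _ _ "\<lambda>f. (f has_integral m) UNIV"], auto simp: indicator_def)
    also have "\<dots> \<longleftrightarrow> (\<integral>\<^sup>+x. ennreal (indicator E x * \<bar>det (matrix (f' x))\<bar>) \<partial>lebesgue) = ennreal m \<and> 0 \<le> m"
      using meas by (subst has_integral_iff_nn_integral_lebesgue) (auto simp: measurable_completion)
    finally show ?thesis using meas by (simp add: nn_integral_completion)
  qed
  have L: "f ` E \<in> lmeasurable \<and> measure lebesgue (f ` E) = m \<longleftrightarrow> ?L = ennreal m \<and> 0 \<le> m" for m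
  proof
    assume "f ` E \<in> lmeasurable \<and> measure lebesgue (f ` E) = m"
    then show "?L = ennreal m \<and> 0 \<le> m"
      using emeasure_eq_measure2[of "f ` E" lebesgue] E(2) measure_nonneg[of lebesgue "f ` E"] by auto
  next
    assume a: "?L = ennreal m \<and> 0 \<le> m"
    then have "emeasure lebesgue (f ` E) = ennreal m" using E(2) by simp
    then show "f ` E \<in> lmeasurable \<and> measure lebesgue (f ` E) = m"
      using a E(2) by (auto simp: fmeasurable_def measure_def)
  qed
  have *: "?L = ennreal m \<longleftrightarrow> ?R = ennreal m" if "m \<ge> 0" for m
    using main[of m] R[of m] L[of m] that by simp
  show ?thesis
  proof (cases "?L")
    case (real m) then show ?thesis using * by simp
  next
    case top
    then show ?thesis using * by (cases "?R") auto
  qed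
qed

lemma emeasure_diffeo_image:
  fixes f :: "real^'n::finite \<Rightarrow> real^'n"
  assumes E: "E \<in> sets borel" "f ` E \<in> sets borel"
    and der: "\<And>x. x \<in> E \<Longrightarrow> (f has_derivative f' x) (at x)"
    and inj: "inj_on f E"
    and meas: "(\<lambda>x. indicator E x * \<bar>det (matrix (f' x))\<bar>) \<in> borel_measurable borel"
  shows "emeasure lborel (f ` E) = (\<integral>\<^sup>+x. ennreal (indicator E x * \<bar>det (matrix (f' x))\<bar>) \<partial>lborel)"
proof -
  let ?F = "\<lambda>x. reindex (f (unreindex x))" and ?F' = "\<lambda>x v. reindex (f' (unreindex x) (unreindex v))"
  let ?E = "reindex ` E"
  have m[measurable]: "(reindex :: real^'n \<Rightarrow> _) \<in> borel_measurable borel"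
     "(unreindex :: _ \<Rightarrow> real^'n) \<in> borel_measurable borel"
    by (intro borel_measurable_continuous_onI linear_continuous_on
        linear_conv_bounded_linear[THEN iffD1] linear_unreindex linear_reindex)+
  have eq: "reindex ` X = unreindex -` X" for X :: "(real^'n) set"
    by (auto simp: image_iff) (metis reindex_unreindex)
  have rb: "reindex ` X \<in> sets borel" if "X \<in> sets borel" for X :: "(real^'n) set"
    unfolding eq using measurable_sets_borel[OF m(2) that] .
  have FE: "?F ` ?E = reindex ` (f ` E)" by (auto simp: image_iff)
  have det: "det (matrix (?F' x)) = det (matrix (f' (unreindex x)))" if "x \<in> ?E" for x
  proof -
    have "matrix (?F' x) = (\<chi> i j. matrix (f' (unreindex x)) $ Rep_ordered_index i $ Rep_ordered_index j)"
    proof -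
      have "unreindex (axis j 1) = axis (Rep_ordered_index j) 1" for j :: "'n ordered_index"
        by (auto simp: unreindex_def axis_def vec_eq_iff Abs_ordered_index_inverse Rep_ordered_index_inverse)
      then show ?thesis by (simp add: matrix_def reindex_def)
    qed
    then show ?thesis using det_reindex by metis
  qed
  have mem: "x \<in> ?E \<longleftrightarrow> unreindex x \<in> E" for x
    by (auto simp: eq)
  have "emeasure lborel (f ` E) = emeasure lborel (?F ` ?E)"
    unfolding FE using emeasure_unreindex_image(2)[OF rb[OF E(2)]] by (simp add: image_image)
  also have "\<dots> = (\<integral>\<^sup>+x. ennreal (indicator ?E x * \<bar>det (matrix (?F' x))\<bar>) \<partial>lborel)"
  proof (rule ordered_emeasure_image)
    show "?E \<in> sets borel" using E rb by simp
    show "?F ` ?E \<in> sets borel" unfolding FE using E rb by simp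
    show "inj_on ?F ?E" using inj by (auto simp: inj_on_def) (metis unreindex_reindex)
    show "(?F has_derivative ?F' x) (at x)" if "x \<in> ?E" for x
    proof -
      have "unreindex x \<in> E" using that by auto
      from der[OF this] show ?thesis
        by (intro has_derivative_compose[of unreindex unreindex _ _ "\<lambda>x. reindex (f x)", unfolded o_def]
          bounded_linear.has_derivative[of reindex] linear_conv_bounded_linear[THEN iffD1]
          linear_unreindex linear_reindex bounded_linear_imp_has_derivative) auto
    qed
    have "(\<lambda>x. indicator ?E x * \<bar>det (matrix (?F' x))\<bar>) =
      (\<lambda>x. indicator E (unreindex x) * \<bar>det (matrix (f' (unreindex x)))\<bar>)"
      by (rule ext) (use det in \<open>auto simp: mem indicator_def\<close>)
    then show "(\<lambda>x. indicator ?E x * \<bar>det (matrix (?F' x))\<bar>) \<in> borel_measurable borel"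
      using measurable_compose[OF m(2) meas] by simp
  qed
  also have "\<dots> = (\<integral>\<^sup>+x. ennreal (indicator E (unreindex x) * \<bar>det (matrix (f' (unreindex x)))\<bar>) \<partial>lborel)"
    using det by (intro nn_integral_cong) (auto simp: mem indicator_def)
  also have "\<dots> = (\<integral>\<^sup>+x. ennreal (indicator E x * \<bar>det (matrix (f' x))\<bar>) \<partial>distr lborel borel unreindex)"
    using meas by (subst nn_integral_distr) auto
  finally show ?thesis by (simp add: distr_lborel_unreindex)
qed


section \<open>Functions of class \<open>C\<^sup>k\<close>\<close>

lemma Ck_on_cong:
  assumes "open S" "\<And>x. x \<in> S \<Longrightarrow> f x = g x" "Ck_on k S f"
  shows "Ck_on k S g"
proof (cases k)
  case 0
  then show ?thesis using assms by (simp cong: continuous_on_cong)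
next
  case (Suc n)
  then obtain f' where f': "\<And>x. x \<in> S \<Longrightarrow> (f has_derivative f' x) (at x)" "\<And>v. Ck_on n S (\<lambda>x. f' x v)"
    using assms(3) by auto
  have "(g has_derivative f' x) (at x)" if "x \<in> S" for x
    using has_derivative_transform_within_open[OF f'(1)[OF that] assms(1) that assms(2)] .
  then show ?thesis using f'(2) unfolding Suc Ck_on.simps(2) by blast
qed

text \<open>On an open set the derivative is unique, so the existential in \<open>Ck_on\<close>
  can be replaced by the Frechet derivative. In this form the property is visibly local.\<close>
lemma Ck_on_Suc_iff:
  assumes "open S"
  shows "Ck_on (Suc k) S f \<longleftrightarrow>
    (\<forall>x\<in>S. f differentiable (at x)) \<and> (\<forall>v. Ck_on k S (\<lambda>x. frechet_derivative f (at x) v))"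
proof
  assume "Ck_on (Suc k) S f"
  then obtain f' where f': "\<And>x. x \<in> S \<Longrightarrow> (f has_derivative f' x) (at x)" "\<And>v. Ck_on k S (\<lambda>x. f' x v)"
    by auto
  have eq: "f' x = frechet_derivative f (at x)" if "x \<in> S" for x
    using f'(1)[OF that] frechet_derivative_at by blast
  have "Ck_on k S (\<lambda>x. frechet_derivative f (at x) v)" for v
    by (rule Ck_on_cong[OF assms _ f'(2)[of v]]) (simp add: eq)
  then show "(\<forall>x\<in>S. f differentiable (at x)) \<and> (\<forall>v. Ck_on k S (\<lambda>x. frechet_derivative f (at x) v))"
    using f'(1) differentiable_def by blast
next
  assume a: "(\<forall>x\<in>S. f differentiable (at x)) \<and> (\<forall>v. Ck_on k S (\<lambda>x. frechet_derivative f (at x) v))"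
  then have "\<And>x. x \<in> S \<Longrightarrow> (f has_derivative frechet_derivative f (at x)) (at x)"
    using frechet_derivative_works by blast
  with a show "Ck_on (Suc k) S f"
    unfolding Ck_on.simps(2) by (intro exI[of _ "\<lambda>x. frechet_derivative f (at x)"]) simp
qed

lemma Ck_on_Suc_E:
  assumes "Ck_on (Suc k) S f"
  obtains f' where "\<And>x. x \<in> S \<Longrightarrow> (f has_derivative f' x) (at x)" "\<And>v. Ck_on k S (\<lambda>x. f' x v)"
  using assms by auto

lemma Ck_on_Suc_I:
  assumes "\<And>x. x \<in> S \<Longrightarrow> (f has_derivative f' x) (at x)" "\<And>v. Ck_on k S (\<lambda>x. f' x v)"
  shows "Ck_on (Suc k) S f"
  using assms by auto

lemma Ck_on_subset: "Ck_on k S f \<Longrightarrow> T \<subseteq> S \<Longrightarrow> Ck_on k T f"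
proof (induction k arbitrary: f)
  case 0
  then show ?case by (auto intro: continuous_on_subset)
next
  case (Suc k)
  obtain f' where
    f': "\<And>x. x \<in> S \<Longrightarrow> (f has_derivative f' x) (at x)" "\<And>v. Ck_on k S (\<lambda>x. f' x v)"
    using Suc.prems(1) by (rule Ck_on_Suc_E) blast
  then show ?case
    using Suc.prems(2) by (intro Ck_on_Suc_I[of T f f'] Suc.IH) auto
qed

lemma Ck_on_Suc_D: "Ck_on (Suc k) S f \<Longrightarrow> Ck_on k S f"
proof (induction k arbitrary: f)
  case 0
  then obtain f' where "\<And>x. x \<in> S \<Longrightarrow> (f has_derivative f' x) (at x)" by auto
  then have "continuous_on S f"
    using has_derivative_continuous_on has_derivative_at_withinI by metis
  then show ?case by simp
next
  case (Suc k)
  from Suc.prems obtain f' where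
    f': "\<And>x. x \<in> S \<Longrightarrow> (f has_derivative f' x) (at x)" "\<And>v. Ck_on (Suc k) S (\<lambda>x. f' x v)"
    unfolding Ck_on.simps(2)[of "Suc k"] by blast
  then show ?case using Suc.IH by (intro Ck_on_Suc_I[of S f f']) auto
qed

lemma Ck_on_mono: "Ck_on k S f \<Longrightarrow> j \<le> k \<Longrightarrow> Ck_on j S f"
proof (induction k)
  case (Suc k)
  then show ?case using Ck_on_Suc_D[of k S f] by (cases "j = Suc k") auto
qed simp

lemma Ck_on_imp_continuous_on: "Ck_on k S f \<Longrightarrow> continuous_on S f"
  using Ck_on_mono[of k S f 0] by simp

text \<open>Used to glue: extensions by zero are \<open>C\<^sup>k\<close> because every point has
  a neighbourhood on which the function is either the given one or zero.\<close>
lemma Ck_on_local: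
  assumes "\<And>x. x \<in> S \<Longrightarrow> \<exists>T. open T \<and> x \<in> T \<and> Ck_on k T f"
  shows "Ck_on k S f"
  using assms
proof (induction k arbitrary: f)
  case 0
  then show ?case
    by (metis Ck_on.simps(1) continuous_at_imp_continuous_on continuous_on_eq_continuous_at)
next
  case (Suc k)
  show ?case
  proof (rule Ck_on_Suc_I)
    show "(f has_derivative frechet_derivative f (at x)) (at x)" if "x \<in> S" for x
      using Suc.prems[OF that] Ck_on_Suc_iff frechet_derivative_works by blast
    show "Ck_on k S (\<lambda>x. frechet_derivative f (at x) v)" for v
    proof (rule Suc.IH)
      fix x assume "x \<in> S"
      from Suc.prems[OF this] obtain T where "open T" "x \<in> T" "Ck_on (Suc k) T f" by blast
      then show "\<exists>T. open T \<and> x \<in> T \<and> Ck_on k T (\<lambda>a. frechet_derivative f (at a) v)"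
        using Ck_on_Suc_iff by blast
    qed
  qed
qed

lemma Ck_on_const [simp]: "Ck_on k S (\<lambda>x. c)"
proof (induction k arbitrary: c)
  case (Suc k)
  show ?case by (rule Ck_on_Suc_I[of _ _ "\<lambda>x v. 0"]) (simp_all add: Suc)
qed simp

lemma Ck_on_bounded_linear_compose:
  assumes "bounded_linear L" "Ck_on k S f"
  shows "Ck_on k S (\<lambda>x. L (f x))"
  using assms(2)
proof (induction k arbitrary: f)
  case 0
  then show ?case using assms(1) by (simp add: bounded_linear.continuous_on)
next
  case (Suc k)
  then obtain f' where f': "\<And>x. x \<in> S \<Longrightarrow> (f has_derivative f' x) (at x)" "\<And>v. Ck_on k S (\<lambda>x. f' x v)"
    by auto
  then show ?case
    by (intro Ck_on_Suc_I[of S _ "\<lambda>x v. L (f' x v)"] Suc.IH bounded_linear.has_derivative[OF assms(1)]) auto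
qed

lemma Ck_on_bounded_linear:
  assumes "bounded_linear L" shows "Ck_on k S L"
proof (cases k)
  case 0 then show ?thesis using assms by (simp add: linear_continuous_on)
next
  case (Suc n)
  then show ?thesis
    using Ck_on_Suc_I[of S L "\<lambda>x. L" n] bounded_linear_imp_has_derivative[OF assms] by simp
qed

lemma Ck_on_ident: "Ck_on k S (\<lambda>x. x)"
  by (rule Ck_on_bounded_linear) (rule bounded_linear_ident)

lemma Ck_on_add:
  assumes "Ck_on k S f" "Ck_on k S g"
  shows "Ck_on k S (\<lambda>x. f x + g x)"
  using assms
proof (induction k arbitrary: f g)
  case 0
  then show ?case by (simp add: continuous_on_add)
next
  case (Suc k)
  obtain f' where
    f': "\<And>x. x \<in> S \<Longrightarrow> (f has_derivative f' x) (at x)" "\<And>v. Ck_on k S (\<lambda>x. f' x v)"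
    using Suc.prems(1) by (rule Ck_on_Suc_E) blast
  obtain g' where
    g': "\<And>x. x \<in> S \<Longrightarrow> (g has_derivative g' x) (at x)" "\<And>v. Ck_on k S (\<lambda>x. g' x v)"
    using Suc.prems(2) by (rule Ck_on_Suc_E) blast
  from f' g' show ?case
    by (intro Ck_on_Suc_I[of S _ "\<lambda>x v. f' x v + g' x v"] Suc.IH has_derivative_add) auto
qed

lemma Ck_on_sum:
  assumes "\<And>i. i \<in> I \<Longrightarrow> Ck_on k S (f i)"
  shows "Ck_on k S (\<lambda>x. \<Sum>i\<in>I. f i x)"
  using assms by (induction I rule: infinite_finite_induct) (auto intro!: Ck_on_add)

lemma Ck_on_bilinear:
  assumes B: "bounded_bilinear B" and "Ck_on k S f" "Ck_on k S g"
  shows "Ck_on k S (\<lambda>x. B (f x) (g x))"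
  using assms(2,3)
proof (induction k arbitrary: f g)
  case 0
  then show ?case using B by (simp add: bounded_bilinear.continuous_on)
next
  case (Suc k)
  obtain f' where
    f': "\<And>x. x \<in> S \<Longrightarrow> (f has_derivative f' x) (at x)" "\<And>v. Ck_on k S (\<lambda>x. f' x v)"
    using Suc.prems(1) by (rule Ck_on_Suc_E) blast
  obtain g' where
    g': "\<And>x. x \<in> S \<Longrightarrow> (g has_derivative g' x) (at x)" "\<And>v. Ck_on k S (\<lambda>x. g' x v)"
    using Suc.prems(2) by (rule Ck_on_Suc_E) blast
  have "Ck_on k S f" "Ck_on k S g" using Suc.prems Ck_on_Suc_D by auto
  with f' g' show ?case
    by (intro Ck_on_Suc_I[of S _ "\<lambda>x v. B (f x) (g' x v) + B (f' x v) (g x)"] Ck_on_add Suc.IH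
      bounded_bilinear.FDERIV[OF B]) auto
qed

lemmas Ck_on_mult = Ck_on_bilinear[OF bounded_bilinear_mult]
lemmas Ck_on_scaleR = Ck_on_bilinear[OF bounded_bilinear_scaleR]

lemma Ck_on_prod:
  fixes f :: "'i \<Rightarrow> 'a::euclidean_space \<Rightarrow> 'b::{real_normed_field}"
  assumes "\<And>i. i \<in> I \<Longrightarrow> Ck_on k S (f i)"
  shows "Ck_on k S (\<lambda>x. \<Prod>i\<in>I. f i x)"
  using assms by (induction I rule: infinite_finite_induct) (auto intro!: Ck_on_mult)

text \<open>The derivative of the outer function takes values in linear maps, whereas
  \<open>Ck_on\<close> speaks of directional derivatives. Expanding the direction in a basis
  separates the two dependencies on the point, and the induction hypothesis applies to each
  coefficient.\<close>
lemma Ck_on_compose: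
  fixes f :: "'a::euclidean_space \<Rightarrow> 'b::euclidean_space" and g :: "'b \<Rightarrow> 'c::real_normed_vector"
  assumes "Ck_on k T g" "Ck_on k S f" "f ` S \<subseteq> T"
  shows "Ck_on k S (\<lambda>x. g (f x))"
  using assms(1,2)
proof (induction k arbitrary: g)
  case 0
  then show ?case using assms(3) by (auto intro: continuous_on_compose2)
next
  case (Suc k)
  obtain f' where
    f': "\<And>x. x \<in> S \<Longrightarrow> (f has_derivative f' x) (at x)" "\<And>v. Ck_on k S (\<lambda>x. f' x v)"
    using Suc.prems(2) by (rule Ck_on_Suc_E) blast
  obtain g' where
    g': "\<And>x. x \<in> T \<Longrightarrow> (g has_derivative g' x) (at x)" "\<And>v. Ck_on k T (\<lambda>x. g' x v)"
    using Suc.prems(1) by (rule Ck_on_Suc_E) blast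
  have f: "Ck_on k S f" using Suc.prems Ck_on_Suc_D by auto
  have expand: "g' y w = (\<Sum>b\<in>Basis. (w \<bullet> b) *\<^sub>R g' y b)" if "y \<in> T" for y w
  proof -
    have "linear (g' y)" using g'(1)[OF that] has_derivative_linear by blast
    then have "g' y (\<Sum>b\<in>Basis. (w \<bullet> b) *\<^sub>R b) = (\<Sum>b\<in>Basis. (w \<bullet> b) *\<^sub>R g' y b)"
      by (simp add: linear_sum linear_scale)
    then show ?thesis by (simp add: euclidean_representation)
  qed
  show ?case
  proof (rule Ck_on_Suc_I[of S _ "\<lambda>x v. \<Sum>b\<in>Basis. (f' x v \<bullet> b) *\<^sub>R g' (f x) b"])
    fix x assume x: "x \<in> S"
    then have y: "f x \<in> T" using assms(3) by auto
    have "((\<lambda>x. g (f x)) has_derivative (\<lambda>v. g' (f x) (f' x v))) (at x)"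
      using has_derivative_compose[OF f'(1)[OF x] g'(1)[OF y]] .
    then show "((\<lambda>x. g (f x)) has_derivative (\<lambda>v. \<Sum>b\<in>Basis. (f' x v \<bullet> b) *\<^sub>R g' (f x) b)) (at x)"
      by (subst expand[OF y, symmetric])
  next
    fix v
    show "Ck_on k S (\<lambda>x. \<Sum>b\<in>Basis. (f' x v \<bullet> b) *\<^sub>R g' (f x) b)"
      by (intro Ck_on_sum Ck_on_scaleR Suc.IH[OF g'(2)] f
          Ck_on_bounded_linear_compose[OF bounded_linear_inner_left] f'(2))
  qed
qed

lemma Ck_on_Suc_real_I:
  fixes g :: "real \<Rightarrow> 'b::real_normed_vector"
  assumes "\<And>x. x \<in> T \<Longrightarrow> (g has_vector_derivative g' x) (at x)" "Ck_on k T g'"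
  shows "Ck_on (Suc k) T g"
  using assms
  by (intro Ck_on_Suc_I[of T g "\<lambda>x v. v *\<^sub>R g' x"] Ck_on_scaleR Ck_on_const)
     (auto simp: has_vector_derivative_def)

lemma C1_on_sqrt: "Ck_on 1 {0<..} sqrt"
  unfolding One_nat_def
proof (rule Ck_on_Suc_real_I[of _ _ "\<lambda>x. inverse (sqrt x) / 2"])
  show "(sqrt has_vector_derivative inverse (sqrt x) / 2) (at x)" if "x \<in> {0<..}" for x
    using that DERIV_real_sqrt[of x] by (simp add: has_real_derivative_iff_has_vector_derivative)
  show "Ck_on 0 {0<..} (\<lambda>x::real. inverse (sqrt x) / 2)"
    by (auto intro!: continuous_intros)
qed

lemma C1_on_inverse: "Ck_on 1 (- {0}) (inverse :: real \<Rightarrow> real)"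
  unfolding One_nat_def
proof (rule Ck_on_Suc_real_I[of _ _ "\<lambda>x. - (inverse x * inverse x)"])
  show "(inverse has_vector_derivative - (inverse x * inverse x)) (at x)" if "x \<in> - {0}" for x :: real
    using that DERIV_inverse'[of "\<lambda>x. x" 1 x UNIV] by (simp add: has_real_derivative_iff_has_vector_derivative)
  show "Ck_on 0 (- {0}) (\<lambda>x::real. - (inverse x * inverse x))"
    by (auto intro!: continuous_intros)
qed

lemma Ck_on_det:
  fixes M :: "'a::euclidean_space \<Rightarrow> real^'n::finite^'n"
  assumes "\<And>i j. Ck_on k S (\<lambda>x. M x $ i $ j)"
  shows "Ck_on k S (\<lambda>x. det (M x))"
  unfolding det_def by (intro Ck_on_sum Ck_on_mult Ck_on_prod Ck_on_const assms)

text \<open>Cramer's rule exhibits the entries of the inverse as rational functions of the entries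
  of the matrix, which gives the regularity of the inverse metric.\<close>
lemma matrix_inv_entry:
  fixes M :: "real^'n::finite^'n"
  assumes "det M \<noteq> 0"
  shows "matrix_inv M $ i $ j = det (\<chi> a c. if c = i then (axis j 1 :: real^'n) $ a else M $ a $ c) / det M"
proof -
  have "M *v (matrix_inv M *v axis j 1) = axis j 1"
  proof -
    have "\<exists>B. M ** B = mat 1 \<and> B ** M = mat 1"
      using assms by (simp add: invertible_det_nz[symmetric] invertible_def)
    then have "M ** matrix_inv M = mat 1"
      unfolding matrix_inv_def by (rule someI2_ex) simp
    then show ?thesis by (simp add: matrix_vector_mul_assoc)
  qed
  then have "matrix_inv M *v axis j 1 = (\<chi> k. det (\<chi> a c. if c = k then (axis j 1 :: real^'n) $ a else M $ a $ c) / det M)"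
    using cramer[OF assms] by blast
  then have "(matrix_inv M *v axis j 1) $ i = det (\<chi> a c. if c = i then (axis j 1 :: real^'n) $ a else M $ a $ c) / det M"
    by simp
  then show ?thesis by (simp add: matrix_vector_mult_basis column_def)
qed

lemma C1_on_matrix_inv:
  fixes M :: "'a::euclidean_space \<Rightarrow> real^'n::finite^'n"
  assumes "open S" "\<And>x. x \<in> S \<Longrightarrow> det (M x) \<noteq> 0" "\<And>i j. Ck_on 1 S (\<lambda>x. M x $ i $ j)"
  shows "Ck_on 1 S (\<lambda>x. matrix_inv (M x) $ i $ j)"
proof (rule Ck_on_cong[OF assms(1)])
  show "det (\<chi> a c. if c = i then (axis j 1 :: real^'n) $ a else M x $ a $ c) * inverse (det (M x)) =
      matrix_inv (M x) $ i $ j" if "x \<in> S" for x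
    using matrix_inv_entry[OF assms(2)[OF that]] by (simp add: field_simps)
  show "Ck_on 1 S (\<lambda>x. det (\<chi> a c. if c = i then (axis j 1 :: real^'n) $ a else M x $ a $ c) * inverse (det (M x)))"
  proof (intro Ck_on_mult Ck_on_det Ck_on_compose[OF C1_on_inverse] assms)
    show "Ck_on 1 S (\<lambda>x. (\<chi> a c. if c = i then (axis j 1 :: real^'n) $ a else M x $ a $ c) $ a $ c)" for a c
      using assms(3) by (cases "c = i") auto
  qed (use assms(2) in auto)
qed

text \<open>All matrices on the segment from the identity to \<open>M\<close> are positive
  definite, hence invertible, so the determinant keeps its sign along it.\<close>
lemma det_pos_if_pos_def:
  fixes M :: "real^'n::finite^'n"
  assumes pd: "\<And>v. v \<noteq> 0 \<Longrightarrow> v \<bullet> (M *v v) > 0"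
  shows "det M > 0"
proof (rule ccontr)
  assume neg: "\<not> det M > 0"
  let ?P = "\<lambda>t. t *\<^sub>R M + (1 - t) *\<^sub>R mat 1"
  have "Ck_on 0 UNIV (\<lambda>t::real. det (?P t))"
    by (rule Ck_on_det) (auto intro!: continuous_intros)
  then have cont: "continuous_on {0..1} (\<lambda>t. det (?P t))"
    by (auto intro: continuous_on_subset)
  have "\<exists>t\<ge>0. t \<le> 1 \<and> det (?P t) = 0"
    by (rule IVT2') (use neg cont in auto)
  then obtain t where t: "0 \<le> t" "t \<le> 1" "det (?P t) = 0" by blast
  then have "\<not> invertible (?P t)" by (simp add: invertible_det_nz)
  then obtain v where v: "v \<noteq> 0" "?P t *v v = 0"
    unfolding invertible_left_inverse matrix_left_invertible_ker by blast
  have "v \<bullet> (?P t *v v) = t * (v \<bullet> (M *v v)) + (1 - t) * (v \<bullet> v)"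
    by (simp add: matrix_vector_mult_add_rdistrib scaleR_matrix_vector_assoc[symmetric] inner_add_right)
  moreover have "v \<bullet> v > 0" "v \<bullet> (M *v v) > 0" using pd v by auto
  ultimately have "v \<bullet> (?P t *v v) > 0"
    using t by (cases "t = 0") (auto intro!: add_pos_nonneg)
  then show False using v by simp
qed

section \<open>Integration by parts and the fundamental lemma\<close>

lemma C1_on_has_derivative:
  "open S \<Longrightarrow> Ck_on 1 S f \<Longrightarrow> x \<in> S \<Longrightarrow> (f has_derivative frechet_derivative f (at x)) (at x)"
  using Ck_on_Suc_iff[of S 0 f] frechet_derivative_works by (metis One_nat_def)

lemma C1_on_continuous_derivative:
  "open S \<Longrightarrow> Ck_on 1 S f \<Longrightarrow> continuous_on S (\<lambda>x. frechet_derivative f (at x) v)"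
  using Ck_on_Suc_iff[of S 0 f] by (simp del: Ck_on.simps(2))

lemma integrable_continuous_compact_support:
  fixes f :: "'a::euclidean_space \<Rightarrow> 'b::euclidean_space"
  assumes "continuous_on UNIV f" "compact K" "\<And>x. x \<notin> K \<Longrightarrow> f x = 0"
  shows "integrable lborel f"
proof -
  have "integrable lborel (\<lambda>x. indicator K x *\<^sub>R f x)"
    using borel_integrable_compact[OF assms(2) continuous_on_subset[OF assms(1)]] by simp
  also have "(\<lambda>x. indicator K x *\<^sub>R f x) = f"
    using assms(3) by (auto simp: indicator_def fun_eq_iff)
  finally show ?thesis .
qed

lemma frechet_derivative_eq_0_outside:
  assumes "closed K" "\<And>x. x \<notin> K \<Longrightarrow> f x = 0" "x \<notin> K"
  shows "frechet_derivative f (at x) v = 0"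
proof -
  have "(f has_derivative (\<lambda>v. 0)) (at x)"
    by (rule has_derivative_transform_within_open[of "\<lambda>_. 0" _ _ _ "- K"]) (use assms in auto)
  from frechet_derivative_at[OF this, symmetric] show ?thesis by simp
qed

lemma norm_diff_le_directional_derivative:
  fixes f :: "'a::euclidean_space \<Rightarrow> 'b::euclidean_space"
  assumes "\<And>x. (f has_derivative f' x) (at x)" "\<And>x. norm (f' x v) \<le> B" "t > 0"
  shows "norm (f (x + t *\<^sub>R v) - f x) \<le> t * B"
proof -
  have d: "((\<lambda>s. f (x + s *\<^sub>R v)) has_derivative (\<lambda>h. f' (x + s *\<^sub>R v) (h *\<^sub>R v))) (at s)" for s
    by (rule has_derivative_compose[of "\<lambda>s. x + s *\<^sub>R v" "\<lambda>h. h *\<^sub>R v" _ _ f, OF _ assms(1)])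
      (auto intro!: derivative_eq_intros)
  have "\<exists>s\<in>{0<..<t}. norm (f (x + t *\<^sub>R v) - f (x + 0 *\<^sub>R v)) \<le> norm (f' (x + s *\<^sub>R v) ((t - 0) *\<^sub>R v))"
    by (rule mvt_general[OF assms(3)])
      (auto intro!: d has_derivative_continuous_on has_derivative_at_withinI[OF d])
  then obtain s where "norm (f (x + t *\<^sub>R v) - f x) \<le> norm (f' (x + s *\<^sub>R v) (t *\<^sub>R v))" by auto
  also have "f' (x + s *\<^sub>R v) (t *\<^sub>R v) = t *\<^sub>R f' (x + s *\<^sub>R v) v"
    using has_derivative_linear[OF assms(1)] by (rule linear_scale)
  also have "norm \<dots> \<le> t * B" using assms(2,3) by simp
  finally show ?thesis .
qed

lemma has_vector_derivative_imp_quotient: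
  fixes p :: "real \<Rightarrow> 'b::real_normed_vector"
  assumes "((\<lambda>s. p s) has_vector_derivative D) (at 0)"
  shows "((\<lambda>s. (p s - p 0) /\<^sub>R s) \<longlongrightarrow> D) (at 0)"
proof -
  have lim: "((\<lambda>h. norm (p h - p 0 - h *\<^sub>R D) / norm h) \<longlongrightarrow> 0) (at 0)"
    using assms unfolding has_vector_derivative_def has_derivative_at by simp
  have ev: "\<forall>\<^sub>F h in at 0. norm (p h - p 0 - h *\<^sub>R D) / norm h = norm ((p h - p 0) /\<^sub>R h - D)"
    unfolding eventually_at_filter
  proof (intro always_eventually allI impI)
    fix h :: real assume "h \<noteq> 0"
    then have "(p h - p 0) /\<^sub>R h - D = (p h - p 0 - h *\<^sub>R D) /\<^sub>R h"
      by (simp add: scaleR_diff_right)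
    then show "norm (p h - p 0 - h *\<^sub>R D) / norm h = norm ((p h - p 0) /\<^sub>R h - D)"
      by (simp add: divide_inverse mult.commute)
  qed
  have "((\<lambda>h. norm ((p h - p 0) /\<^sub>R h - D)) \<longlongrightarrow> 0) (at 0)"
    by (rule Lim_transform_eventually[OF lim ev])
  then have "((\<lambda>h. (p h - p 0) /\<^sub>R h - D) \<longlongrightarrow> 0) (at 0)" by (rule tendsto_norm_zero_cancel)
  then show ?thesis using Lim_null by (rule iffD2[rotated])
qed

text \<open>By translation invariance the difference quotients have integral zero. They are
  bounded by the maximum of the derivative and vanish outside a fixed ball, so dominated
  convergence gives the claim.\<close>
lemma integral_directional_derivative_eq_0:
  fixes f :: "'a::euclidean_space \<Rightarrow> 'b::euclidean_space"
  assumes f: "Ck_on 1 UNIV f" and K: "compact K" "\<And>x. x \<notin> K \<Longrightarrow> f x = 0"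
  shows "(LINT x|lborel. frechet_derivative f (at x) v) = 0"
proof -
  let ?D = "\<lambda>x. frechet_derivative f (at x) v"
  have der: "(f has_derivative frechet_derivative f (at x)) (at x)" for x
    using C1_on_has_derivative[OF open_UNIV f] by simp
  have cD: "continuous_on UNIV ?D"
    using C1_on_continuous_derivative[OF open_UNIV f] .
  have cf: "continuous_on UNIV f" using f Ck_on_imp_continuous_on by blast
  have D0: "?D x = 0" if "x \<notin> K" for x
    by (rule frechet_derivative_eq_0_outside[OF compact_imp_closed]) (use K that in auto)
  have "bounded (?D ` K)"
    using compact_imp_bounded[OF compact_continuous_image[OF continuous_on_subset[OF cD] K(1)]] by simp
  then obtain B where "\<And>x. x \<in> K \<Longrightarrow> norm (?D x) \<le> B" "0 < B"
    unfolding bounded_pos by auto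
  then have B: "norm (?D x) \<le> B" for x using D0[of x] by (cases "x \<in> K") auto
  obtain R where R: "\<And>x. x \<in> K \<Longrightarrow> norm x \<le> R"
    using compact_imp_bounded[OF K(1)] unfolding bounded_iff by auto
  let ?t = "\<lambda>n. inverse (real (Suc n))"
  \<comment> \<open>The difference quotients with step \<open>?t n\<close>, and a dominating function: all of them vanish outside the ball.\<close>
  let ?q = "\<lambda>n x. inverse (?t n) *\<^sub>R (f (x + ?t n *\<^sub>R v) - f x)"
  let ?w = "\<lambda>x::'a. indicator (cball 0 (R + norm v)) x * B"
  have fi: "integrable lborel f"
    by (rule integrable_continuous_compact_support[OF cf K])
  have shift: "integrable lborel (\<lambda>x. f (x + a))" "(LINT x|lborel. f (x + a)) = (LINT x|lborel. f x)" for a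
  proof -
    have eq: "distr lborel borel ((+) a) = (lborel :: 'a measure)" by (rule lborel_distr_plus)
    have "integrable (distr lborel borel ((+) a)) f" using fi eq by simp
    then show "integrable lborel (\<lambda>x. f (x + a))"
      by (subst (asm) integrable_distr_eq) (use cf in \<open>auto simp: add.commute intro: borel_measurable_continuous_onI\<close>)
    have "(LINT x|distr lborel borel ((+) a). f x) = (LINT x|lborel. f (x + a))"
      by (subst integral_distr) (use cf in \<open>auto simp: add.commute intro: borel_measurable_continuous_onI\<close>)
    then show "(LINT x|lborel. f (x + a)) = (LINT x|lborel. f x)" using eq by simp
  qed
  have q0: "(LINT x|lborel. ?q n x) = 0" for n
    using shift fi by simp
  have "(\<lambda>n. LINT x|lborel. ?q n x) \<longlonglongrightarrow> (LINT x|lborel. ?D x)"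
  proof (rule integral_dominated_convergence[where w="?w"])
    show "?D \<in> borel_measurable lborel" using cD by (simp add: borel_measurable_continuous_onI)
    show "?q n \<in> borel_measurable lborel" for n
      using shift(1) fi by (intro borel_measurable_integrable) auto
    show "integrable lborel ?w"
      by (intro integrable_mult_left integrable_real_indicator) (use emeasure_bounded_finite[of "cball 0 (R + norm v) :: 'a set"] in auto)
    show "AE x in lborel. (\<lambda>n. ?q n x) \<longlonglongrightarrow> ?D x"
    proof (rule AE_I2)
      fix x
      have "((\<lambda>s. f (x + s *\<^sub>R v)) has_vector_derivative ?D x) (at 0)"
      proof -
        have "((\<lambda>s. f (x + s *\<^sub>R v)) has_derivative (\<lambda>h. frechet_derivative f (at (x + 0 *\<^sub>R v)) (h *\<^sub>R v))) (at 0)"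
          by (rule has_derivative_compose[of "\<lambda>s. x + s *\<^sub>R v" "\<lambda>h. h *\<^sub>R v" _ _ f, OF _ der])
            (auto intro!: derivative_eq_intros)
        then show ?thesis
          using linear_scale[OF has_derivative_linear[OF der[of x]]] by (simp add: has_vector_derivative_def)
      qed
      then have "((\<lambda>s. (f (x + s *\<^sub>R v) - f (x + 0 *\<^sub>R v)) /\<^sub>R s) \<longlongrightarrow> ?D x) (at 0)"
        by (rule has_vector_derivative_imp_quotient)
      moreover have "filterlim ?t (at 0) sequentially"
        using LIMSEQ_inverse_real_of_nat by (auto simp: filterlim_at)
      ultimately show "(\<lambda>n. ?q n x) \<longlonglongrightarrow> ?D x"
        using filterlim_compose[of "\<lambda>s. (f (x + s *\<^sub>R v) - f (x + 0 *\<^sub>R v)) /\<^sub>R s" "nhds (?D x)" "at 0" ?t sequentially] by simp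
    qed
    show "AE x in lborel. norm (?q n x) \<le> ?w x" for n
    proof (rule AE_I2)
      fix x
      have t: "?t n > 0" "?t n \<le> 1" by (auto simp: inverse_le_1_iff)
      show "norm (?q n x) \<le> ?w x"
      proof (cases "norm x \<le> R + norm v")
        case True
        have scale: "norm (inverse s *\<^sub>R d) \<le> B" if "norm d \<le> s * B" "s > 0" for s and d :: 'b
          using that by (simp add: field_simps)
        have "norm (?q n x) \<le> B"
          by (rule scale[OF norm_diff_le_directional_derivative[OF der B t(1)] t(1)])
        then show ?thesis using True by (simp only: indicator_def mem_cball dist_0_norm) simp
      next
        case False
        have "norm x \<le> norm (x + ?t n *\<^sub>R v) + norm (?t n *\<^sub>R v)"
          using norm_triangle_ineq4[of "x + ?t n *\<^sub>R v" "?t n *\<^sub>R v"] by simp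
        moreover have "norm (?t n *\<^sub>R v) \<le> norm v" using t by (simp add: mult_left_le_one_le)
        ultimately have "R < norm x" "R < norm (x + ?t n *\<^sub>R v)" using False norm_ge_zero[of v] by linarith+
        then have "x \<notin> K" "x + ?t n *\<^sub>R v \<notin> K" using R not_less by blast+
        then show ?thesis using False K by simp
      qed
    qed
  qed
  then have "(\<lambda>n::nat. 0) \<longlonglongrightarrow> (LINT x|lborel. ?D x)" by (simp only: q0)
  then show ?thesis using LIMSEQ_unique tendsto_const by blast
qed

text \<open>The product of \<open>\<psi>\<close> and \<open>u\<close>, extended by zero, is
  \<open>C\<^sup>1\<close> with compact support on the whole space. Since \<open>\<psi>\<close> is
  only required to be \<open>C\<^sup>1\<close>, the formula serves the smooth test functions of
  weak derivatives as well as the less regular bumps and pullbacks that occur below.\<close>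
lemma integration_by_parts_C1:
  fixes u :: "'a::euclidean_space \<Rightarrow> 'b::euclidean_space"
  assumes "open V" and u: "Ck_on 1 V u" and \<psi>: "Ck_on 1 UNIV \<psi>"
    and K: "compact K" "K \<subseteq> V" "\<And>x. x \<notin> K \<Longrightarrow> \<psi> x = 0"
  shows "(LINT x:V|lborel. frechet_derivative \<psi> (at x) v *\<^sub>R u x) =
     - (LINT x:V|lborel. \<psi> x *\<^sub>R frechet_derivative u (at x) v)"
proof -
  let ?w = "\<lambda>x. if x \<in> V then \<psi> x *\<^sub>R u x else 0"
  let ?a = "\<lambda>x. indicator V x *\<^sub>R (frechet_derivative \<psi> (at x) v *\<^sub>R u x)"
  let ?b = "\<lambda>x. indicator V x *\<^sub>R (\<psi> x *\<^sub>R frechet_derivative u (at x) v)"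
  have cl: "closed K" using K compact_imp_closed by blast
  have Dpsi0: "frechet_derivative \<psi> (at x) v = 0" if "x \<notin> K" for x
    using frechet_derivative_eq_0_outside[OF cl] K that by blast
  have "Ck_on 1 UNIV ?w"
  proof (rule Ck_on_local)
    fix x
    show "\<exists>T. open T \<and> x \<in> T \<and> Ck_on 1 T ?w"
    proof (cases "x \<in> V")
      case True
      have "Ck_on 1 V ?w"
        by (rule Ck_on_cong[OF \<open>open V\<close> _ Ck_on_scaleR[OF Ck_on_subset[OF \<psi>] u]]) auto
      then show ?thesis using True \<open>open V\<close> by blast
    next
      case False
      have "Ck_on 1 (- K) ?w"
        by (rule Ck_on_cong[OF _ _ Ck_on_const[of _ _ 0]]) (use K cl in auto)
      then show ?thesis using False K cl by (intro exI[of _ "- K"]) auto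
    qed
  qed
  then have zero: "(LINT x|lborel. frechet_derivative ?w (at x) v) = 0"
    by (rule integral_directional_derivative_eq_0[OF _ K(1)]) (use K in auto)
  have dw: "frechet_derivative ?w (at x) v = ?a x + ?b x" for x
  proof (cases "x \<in> V")
    case True
    have "(\<psi> has_derivative frechet_derivative \<psi> (at x)) (at x)" "(u has_derivative frechet_derivative u (at x)) (at x)"
      using C1_on_has_derivative[OF open_UNIV \<psi>] C1_on_has_derivative[OF \<open>open V\<close> u True] by simp_all
    from has_derivative_scaleR[OF this]
    have "(?w has_derivative (\<lambda>h. \<psi> x *\<^sub>R frechet_derivative u (at x) h + frechet_derivative \<psi> (at x) h *\<^sub>R u x)) (at x)"
      by (rule has_derivative_transform_within_open[OF _ \<open>open V\<close> True]) auto
    from frechet_derivative_at[OF this, symmetric] show ?thesis using True by simp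
  next
    case False
    then have "x \<notin> K" using K by auto
    then have "frechet_derivative ?w (at x) v = 0"
      using K by (intro frechet_derivative_eq_0_outside[OF cl]) auto
    then show ?thesis using False by simp
  qed
  have int: "integrable lborel (\<lambda>x. indicator V x *\<^sub>R k x)"
    if "continuous_on V k" "\<And>x. x \<notin> K \<Longrightarrow> k x = 0" for k :: "'a \<Rightarrow> 'b"
  proof -
    have "integrable lborel (\<lambda>x. indicator K x *\<^sub>R k x)"
      using borel_integrable_compact[OF K(1) continuous_on_subset[OF that(1) K(2)]] by simp
    also have "(\<lambda>x. indicator K x *\<^sub>R k x) = (\<lambda>x. indicator V x *\<^sub>R k x)"
      using that(2) K(2) by (auto simp: indicator_def fun_eq_iff)
    finally show ?thesis .
  qed
  have c: "continuous_on V \<psi>" "continuous_on V (\<lambda>x. frechet_derivative \<psi> (at x) v)"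
    "continuous_on V u" "continuous_on V (\<lambda>x. frechet_derivative u (at x) v)"
    using C1_on_continuous_derivative[OF open_UNIV \<psi>] C1_on_continuous_derivative[OF \<open>open V\<close> u]
      Ck_on_imp_continuous_on[OF \<psi>] Ck_on_imp_continuous_on[OF u]
    by (auto intro: continuous_on_subset)
  have "integrable lborel ?a" "integrable lborel ?b"
    by (rule int; use K Dpsi0 c in \<open>auto intro!: continuous_intros\<close>)+
  then show ?thesis
    using zero by (simp add: dw set_lebesgue_integral_def add_eq_0_iff)
qed

lemma loc_integrable_continuous:
  assumes "continuous_on V u" shows "loc_integrable V u"
  unfolding loc_integrable_def set_integrable_def
  using borel_integrable_compact continuous_on_subset[OF assms] by blast

lemma loc_square_integrable_continuous:
  fixes u :: "'a::euclidean_space \<Rightarrow> 'b::euclidean_space"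
  assumes "open V" "continuous_on V u" shows "loc_square_integrable V u"
proof -
  have "continuous_on V (\<lambda>x. (norm (u x))\<^sup>2)" using assms by (auto intro!: continuous_intros)
  then show ?thesis
    unfolding loc_square_integrable_def set_integrable_def set_borel_measurable_def
    using borel_integrable_compact[of _ "\<lambda>x. (norm (u x))\<^sup>2"] continuous_on_subset
      borel_measurable_continuous_on_indicator[of V u] assms by (auto simp del: real_scaleR_def)
qed

lemma weak_partial_C1:
  fixes u :: "real^'n::finite \<Rightarrow> 'b::euclidean_space"
  assumes V: "open V" and u: "Ck_on 1 V u"
  shows "weak_partial V i u (partial_deriv i u)"
proof -
  have "continuous_on V u" "continuous_on V (partial_deriv i u)"
    using Ck_on_imp_continuous_on[OF u] C1_on_continuous_derivative[OF V u] by (simp_all add: partial_deriv_def[abs_def])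
  moreover have "(LINT x:V|lborel. partial_deriv i \<psi> x *\<^sub>R u x) = - (LINT x:V|lborel. \<psi> x *\<^sub>R partial_deriv i u x)"
    if "test_function V \<psi>" for \<psi>
    unfolding partial_deriv_def
  proof (rule integration_by_parts_C1[OF V u])
    show "Ck_on 1 UNIV \<psi>" using that by (auto simp: test_function_def smooth_on_def)
    show "compact (closure {x. \<psi> x \<noteq> 0})" "closure {x. \<psi> x \<noteq> 0} \<subseteq> V" using that by (auto simp: test_function_def)
    show "\<psi> x = 0" if "x \<notin> closure {x. \<psi> x \<noteq> 0}" for x
      using that closure_subset[of "{x. \<psi> x \<noteq> 0}"] by auto
  qed
  ultimately show ?thesis unfolding weak_partial_def by (intro conjI allI impI loc_integrable_continuous)
qed

lemma Ck_on_partial_deriv: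
  "open V \<Longrightarrow> Ck_on (Suc k) V u \<Longrightarrow> Ck_on k V (partial_deriv i u)"
  using Ck_on_Suc_iff unfolding partial_deriv_def[abs_def] by blast

lemma sobolev_loc_Ck:
  fixes u :: "real^'n::finite \<Rightarrow> 'b::euclidean_space"
  assumes "open V" "Ck_on k V u"
  shows "sobolev_loc k V u"
  using assms(2)
proof (induction k arbitrary: u)
  case 0
  then show ?case using assms(1) by (simp add: loc_square_integrable_continuous)
next
  case (Suc k)
  have "loc_square_integrable V u"
    using Ck_on_imp_continuous_on[OF Suc.prems] assms(1) by (simp add: loc_square_integrable_continuous)
  moreover have "Ck_on 1 V u" using Ck_on_mono[OF Suc.prems, of 1] by simp
  ultimately show ?case
    using weak_partial_C1[OF assms(1)] Suc.IH[OF Ck_on_partial_deriv[OF assms(1) Suc.prems]] by auto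
qed

text \<open>Powers of the positive part are elementary functions of finite smoothness that vanish
  on a half-line; all cut-off functions below are built from them.\<close>
lemma DERIV_pos_part_power:
  "((\<lambda>t::real. (max 0 t) ^ Suc (Suc n)) has_real_derivative real (Suc (Suc n)) * (max 0 t) ^ Suc n) (at t)"
proof -
  consider "t < 0" | "t = 0" | "t > 0" by linarith
  then show ?thesis
  proof cases
    case 1
    have "((\<lambda>t::real. 0) has_real_derivative 0) (at t)" by simp
    then have "((\<lambda>t::real. (max 0 t) ^ Suc (Suc n)) has_real_derivative 0) (at t)"
      by (rule has_field_derivative_transform_within_open[of _ _ _ "{..<0}"]) (use 1 in auto)
    then show ?thesis using 1 by simp
  next
    case 3
    have "((\<lambda>t::real. t ^ Suc (Suc n)) has_real_derivative real (Suc (Suc n)) * t ^ Suc n) (at t)"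
      using DERIV_pow[of "Suc (Suc n)" t UNIV] by simp
    then have "((\<lambda>t::real. (max 0 t) ^ Suc (Suc n)) has_real_derivative real (Suc (Suc n)) * t ^ Suc n) (at t)"
      by (rule has_field_derivative_transform_within_open[of _ _ _ "{0<..}"]) (use 3 in auto)
    then show ?thesis using 3 by simp
  next
    case 2
    have "isCont (\<lambda>h::real. (max 0 h) ^ Suc n) 0" by (intro continuous_intros)
    then have "((\<lambda>h::real. (max 0 h) ^ Suc n) \<longlongrightarrow> 0) (at 0)" by (simp add: isCont_def)
    moreover have "(max 0 h) ^ Suc n = ((max 0 (0 + h)) ^ Suc (Suc n) - (max 0 0) ^ Suc (Suc n)) / h" for h :: real
      by (cases "h > 0") (auto simp: max_def)
    ultimately show ?thesis using 2 by (simp add: DERIV_def)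
  qed
qed

lemma Ck_on_pos_part_power: "Ck_on k UNIV (\<lambda>t::real. (max 0 t) ^ Suc k)"
proof (induction k)
  case 0 show ?case by (auto intro!: continuous_intros)
next
  case (Suc k)
  show ?case
    by (rule Ck_on_Suc_real_I[OF _ Ck_on_mult[OF Ck_on_const Suc]])
      (use DERIV_pos_part_power in \<open>simp add: has_real_derivative_iff_has_vector_derivative del: power_Suc\<close>)
qed

text \<open>If \<open>G x0\<close> were nonzero, then \<open>G x \<bullet> G x0\<close> would be
  positive on a ball around \<open>x0\<close>, and so would be its integral against the
  \<open>C\<^sup>1\<close> bump \<open>(r\<^sup>2 - |x -
  x0|\<^sup>2)\<^sub>+\<^sup>2\<close>.\<close>
lemma fundamental_lemma_calculus_of_variations:
  fixes G :: "'a::euclidean_space \<Rightarrow> 'b::euclidean_space"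
  assumes V: "open V" and G: "continuous_on V G"
    and *: "\<And>\<eta> K. Ck_on 1 UNIV \<eta> \<Longrightarrow> compact K \<Longrightarrow> K \<subseteq> V \<Longrightarrow> (\<And>x. x \<notin> K \<Longrightarrow> \<eta> x = 0) \<Longrightarrow>
        (LINT x:V|lborel. \<eta> x *\<^sub>R G x) = 0"
    and x0: "x0 \<in> V"
  shows "G x0 = 0"
proof (rule ccontr)
  assume nz: "G x0 \<noteq> 0"
  let ?g = "\<lambda>x. G x \<bullet> G x0"
  have cg: "continuous_on V ?g" using G by (intro continuous_intros)
  have pos: "?g x0 > 0" using nz by simp
  have "open (V \<inter> ?g -` {0<..})" using continuous_open_preimage[OF cg V] by auto
  then obtain r where r: "r > 0" "cball x0 r \<subseteq> V \<inter> ?g -` {0<..}"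
    using x0 pos open_contains_cball by (metis IntI greaterThan_iff vimageI)
  define \<eta> where "\<eta> = (\<lambda>x. (max 0 (r\<^sup>2 - (x - x0) \<bullet> (x - x0)))\<^sup>2)"
  have e0: "\<eta> x = 0" if "x \<notin> cball x0 r" for x
  proof -
    have "r\<^sup>2 \<le> (x - x0) \<bullet> (x - x0)"
      using that r(1) by (simp add: dist_norm norm_minus_commute power2_norm_eq_inner[symmetric] power_mono)
    then show ?thesis by (simp add: \<eta>_def)
  qed
  have epos: "\<eta> x > 0" if "x \<in> ball x0 r" for x
  proof -
    have "(x - x0) \<bullet> (x - x0) < r\<^sup>2"
      using that r(1) by (simp add: dist_norm norm_minus_commute power2_norm_eq_inner[symmetric] power_strict_mono)
    then show ?thesis by (simp add: \<eta>_def)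
  qed
  have "Ck_on 1 UNIV (\<lambda>x. r\<^sup>2 + (- 1) * ((x + (- x0)) \<bullet> (x + (- x0))))"
    by (intro Ck_on_add Ck_on_mult Ck_on_const Ck_on_ident Ck_on_bilinear[OF bounded_bilinear_inner])
  then have e1: "Ck_on 1 UNIV \<eta>"
    unfolding \<eta>_def
    using Ck_on_compose[OF Ck_on_pos_part_power[of 1], of UNIV "\<lambda>x. r\<^sup>2 - (x - x0) \<bullet> (x - x0)"]
    by (simp add: numeral_2_eq_2)
  have "(LINT x:V|lborel. \<eta> x *\<^sub>R G x) = 0"
    using r by (intro *[OF e1, of "cball x0 r"] e0) auto
  moreover have ce: "continuous_on UNIV \<eta>" using Ck_on_imp_continuous_on[OF e1] .
  have "integrable lborel (\<lambda>x. indicator (cball x0 r) x *\<^sub>R (\<eta> x *\<^sub>R G x))"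
    by (rule borel_integrable_compact) (use r G ce in \<open>auto intro!: continuous_intros intro: continuous_on_subset\<close>)
  moreover have "(\<lambda>x. indicator (cball x0 r) x *\<^sub>R (\<eta> x *\<^sub>R G x)) = (\<lambda>x. indicator V x *\<^sub>R (\<eta> x *\<^sub>R G x))"
    using e0 r by (force simp: indicator_def fun_eq_iff)
  ultimately have int: "integrable lborel (\<lambda>x. indicator V x *\<^sub>R (\<eta> x *\<^sub>R G x))"
     and "(LINT x|lborel. indicator V x *\<^sub>R (\<eta> x *\<^sub>R G x)) = 0"
    by (simp_all add: set_lebesgue_integral_def)
  then have "(LINT x|lborel. (indicator V x *\<^sub>R (\<eta> x *\<^sub>R G x)) \<bullet> G x0) = 0"
    by (subst integral_inner_left) auto
  moreover have "integrable lborel (\<lambda>x. (indicator V x *\<^sub>R (\<eta> x *\<^sub>R G x)) \<bullet> G x0)"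
    by (rule integrable_inner_left) (rule int)
  moreover have nn: "0 \<le> (indicator V x *\<^sub>R (\<eta> x *\<^sub>R G x)) \<bullet> G x0" for x
  proof (cases "x \<in> cball x0 r")
    case True
    then have "0 < G x \<bullet> G x0" using r by auto
    then show ?thesis by (simp add: \<eta>_def indicator_def)
  qed (simp add: e0)
  ultimately have "AE x in lborel. (indicator V x *\<^sub>R (\<eta> x *\<^sub>R G x)) \<bullet> G x0 = 0"
    using integral_nonneg_eq_0_iff_AE[of lborel "\<lambda>x. (indicator V x *\<^sub>R (\<eta> x *\<^sub>R G x)) \<bullet> G x0"] by auto
  then have "AE x in lborel. x \<notin> ball x0 r"
  proof (eventually_elim)
    case (elim x)
    show ?case
    proof
      assume x: "x \<in> ball x0 r"
      then have "x \<in> V" "G x \<bullet> G x0 > 0" using r by (auto dest!: subsetD[of "cball x0 r" _ x])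
      then show False using elim epos[OF x] by simp
    qed
  qed
  then have "ball x0 r \<in> null_sets lborel" by (subst AE_iff_null_sets) auto
  then have "negligible (ball x0 r)" unfolding negligible_iff_null_sets by (rule null_sets_completionI)
  then show False using r(1) open_not_negligible[of "ball x0 r"] by simp
qed

(* The defining existential would otherwise be unfolded wherever a fixed order of
   differentiability occurs. *)
declare Ck_on.simps(2) [simp del]

section \<open>Integrals under \<open>C\<^sup>1\<close> diffeomorphisms\<close>

definition C1_diffeo ::
    "(real^'n::finite) set \<Rightarrow> (real^'n) set \<Rightarrow> (real^'n \<Rightarrow> real^'n) \<Rightarrow> (real^'n \<Rightarrow> real^'n) \<Rightarrow> bool"
  where "C1_diffeo V V' f h \<longleftrightarrow> open V \<and> open V' \<and> homeomorphism V V' f h \<and> Ck_on 1 V f"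

lemma continuous_on_det_jacobian:
  assumes "open V" "Ck_on 1 V f"
  shows "continuous_on V (\<lambda>x. det (jacobian f x))"
proof -
  have "Ck_on 0 V (\<lambda>x. det (jacobian f x))"
  proof (rule Ck_on_det)
    fix i j
    have "continuous_on V (\<lambda>x. frechet_derivative f (at x) (axis j 1) $ i)"
      by (intro continuous_intros C1_on_continuous_derivative assms)
    then show "Ck_on 0 V (\<lambda>x. jacobian f x $ i $ j)"
      by (simp add: jacobian_def matrix_def)
  qed
  then show ?thesis by simp
qed

text \<open>Change of variables as an identity of measures. The formulas for nonnegative and for
  vector-valued integrands follow from it without a separate discussion of integrability.\<close>
lemma distr_C1_diffeo:
  assumes "C1_diffeo V V' f h"
  shows "(\<lambda>x. if x \<in> V then f x else 0) \<in> borel_measurable borel"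
    and "(\<lambda>x. indicator V x * \<bar>det (jacobian f x)\<bar>) \<in> borel_measurable borel"
    and "distr (density lborel (\<lambda>x. ennreal (indicator V x * \<bar>det (jacobian f x)\<bar>))) borel
       (\<lambda>x. if x \<in> V then f x else 0) = density lborel (indicator V')" (is "distr ?M _ ?f = _")
proof -
  have V: "open V" "open V'" and hom: "homeomorphism V V' f h"
    and C1: "Ck_on 1 V f"
    using assms by (auto simp: C1_diffeo_def)
  note der = C1_on_has_derivative[OF V(1) C1] and cd = continuous_on_det_jacobian[OF V(1) C1]
  have [measurable]: "V \<in> sets borel" "V' \<in> sets borel" using V by auto
  have cf: "continuous_on V f" "continuous_on V' h" using hom by (auto simp: homeomorphism_def)
  show f[measurable]: "?f \<in> borel_measurable borel"
    by (rule borel_measurable_continuous_on_if) (auto intro: cf)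
  have d: "(\<lambda>x. if x \<in> V then \<bar>det (jacobian f x)\<bar> else 0) \<in> borel_measurable borel"
    by (rule borel_measurable_continuous_on_if) (auto intro!: continuous_intros cd)
  have d_eq: "(\<lambda>x. indicator V x * \<bar>det (jacobian f x)\<bar>) = (\<lambda>x. if x \<in> V then \<bar>det (jacobian f x)\<bar> else 0)"
    by (auto simp: indicator_def)
  show dm[measurable]: "(\<lambda>x. indicator V x * \<bar>det (jacobian f x)\<bar>) \<in> borel_measurable borel"
    unfolding d_eq by (rule d)
  show "distr ?M borel ?f = density lborel (indicator V')"
  proof (rule measure_eqI)
    fix B assume "B \<in> sets (distr ?M borel ?f)"
    then have B[measurable]: "B \<in> sets borel" by simp
    let ?E = "V \<inter> ?f -` B"
    have E[measurable]: "?E \<in> sets borel" using measurable_sets_borel[OF f B] by auto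
    have img: "f ` ?E = V' \<inter> B"
    proof -
      have "\<exists>x\<in>?E. y = f x" if "y \<in> V' \<inter> B" for y
        using that hom by (intro bexI[of _ "h y"]) (auto simp: homeomorphism_def)
      then show ?thesis using hom by (auto simp: homeomorphism_def)
    qed
    have inj: "inj_on f ?E" using hom by (auto simp: inj_on_def homeomorphism_def) metis
    have ind: "indicator ?E x * \<bar>det (jacobian f x)\<bar> =
        indicator (?f -` B) x * (indicator V x * \<bar>det (jacobian f x)\<bar>)" for x
      by (auto simp: indicator_def)
    have "emeasure (distr ?M borel ?f) B = emeasure ?M (?f -` B)"
      by (simp add: emeasure_distr)
    also have "\<dots> = (\<integral>\<^sup>+x. ennreal (indicator V x * \<bar>det (jacobian f x)\<bar>) * indicator (?f -` B) x \<partial>lborel)"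
      using measurable_sets_borel[OF f B] by (subst emeasure_density) auto
    also have "\<dots> = (\<integral>\<^sup>+x. ennreal (indicator ?E x * \<bar>det (jacobian f x)\<bar>) \<partial>lborel)"
      by (intro nn_integral_cong) (auto simp: indicator_def)
    also have "\<dots> = emeasure lborel (f ` ?E)"
      unfolding jacobian_def
    proof (rule emeasure_diffeo_image[symmetric, OF E _ _ inj])
      show "f ` ?E \<in> sets borel" unfolding img by simp
      have "(\<lambda>x. indicator ?E x * \<bar>det (jacobian f x)\<bar>) \<in> borel_measurable borel"
        unfolding ind using measurable_sets_borel[OF f B] by measurable
      then show "(\<lambda>x. indicator ?E x * \<bar>det (matrix (frechet_derivative f (at x)))\<bar>) \<in> borel_measurable borel"
        by (simp only: jacobian_def)
    qed (use der in auto)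
    also have "\<dots> = emeasure (density lborel (indicator V')) B"
      by (subst emeasure_density) (auto simp: img nn_integral_indicator indicator_inter_arith[symmetric])
    finally show "emeasure (distr ?M borel ?f) B = emeasure (density lborel (indicator V')) B" .
  qed simp
qed

lemma nn_integral_C1_diffeo:
  assumes d: "C1_diffeo V V' f h" and k[measurable]: "k \<in> borel_measurable borel"
  shows "(\<integral>\<^sup>+y. indicator V' y * k y \<partial>lborel) =
     (\<integral>\<^sup>+x. ennreal (indicator V x * \<bar>det (jacobian f x)\<bar>) * k (f x) \<partial>lborel)"
proof -
  note [measurable] = distr_C1_diffeo(1,2)[OF d]
  have [measurable]: "V' \<in> sets borel" using d by (auto simp: C1_diffeo_def)
  have "(\<integral>\<^sup>+y. indicator V' y * k y \<partial>lborel) = (\<integral>\<^sup>+y. k y \<partial>density lborel (indicator V'))"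
    by (subst nn_integral_density) auto
  also have "\<dots> = (\<integral>\<^sup>+x. ennreal (indicator V x * \<bar>det (jacobian f x)\<bar>) * k (if x \<in> V then f x else 0) \<partial>lborel)"
    by (subst distr_C1_diffeo(3)[OF d, symmetric], subst nn_integral_distr)
      (auto simp: nn_integral_density)
  also have "\<dots> = (\<integral>\<^sup>+x. ennreal (indicator V x * \<bar>det (jacobian f x)\<bar>) * k (f x) \<partial>lborel)"
    by (intro nn_integral_cong) (auto simp: indicator_def)
  finally show ?thesis .
qed

lemma integral_C1_diffeo:
  fixes k :: "_ \<Rightarrow> 'b::euclidean_space"
  assumes d: "C1_diffeo V V' f h" and k[measurable]: "k \<in> borel_measurable borel"
  shows "(LINT y|lborel. indicator V' y *\<^sub>R k y) =
     (LINT x|lborel. (indicator V x * \<bar>det (jacobian f x)\<bar>) *\<^sub>R k (f x))"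
proof -
  note [measurable] = distr_C1_diffeo(1,2)[OF d]
  have [measurable]: "V' \<in> sets borel" using d by (auto simp: C1_diffeo_def)
  have "(LINT y|lborel. indicator V' y *\<^sub>R k y) = (LINT y|density lborel (\<lambda>y. ennreal (indicator V' y)). k y)"
    by (subst integral_density) auto
  also have "(\<lambda>y. ennreal (indicator V' y)) = indicator V'" by (auto simp: indicator_def)
  also have "(LINT y|density lborel (indicator V'). k y) =
      (LINT x|lborel. (indicator V x * \<bar>det (jacobian f x)\<bar>) *\<^sub>R k (if x \<in> V then f x else 0))"
    by (subst distr_C1_diffeo(3)[OF d, symmetric], subst integral_distr)
      (auto simp: integral_density)
  also have "\<dots> = (LINT x|lborel. (indicator V x * \<bar>det (jacobian f x)\<bar>) *\<^sub>R k (f x))"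
    by (intro Bochner_Integration.integral_cong) (auto simp: indicator_def)
  finally show ?thesis .
qed

section \<open>The Riemannian volume\<close>

lemma suminf_swap_ennreal: "(\<Sum>i. \<Sum>n. f i n) = (\<Sum>n. \<Sum>i. f i n :: ennreal)" for f :: "nat \<Rightarrow> nat \<Rightarrow> ennreal"
proof -
  have "(\<Sum>i. \<Sum>n. f i n) = (\<Sum>i. \<integral>\<^sup>+n. f i n \<partial>count_space UNIV)"
    by (simp add: nn_integral_count_space_nat)
  also have "\<dots> = (\<integral>\<^sup>+n. (\<Sum>i. f i n) \<partial>count_space UNIV)"
    by (subst nn_integral_suminf) auto
  finally show ?thesis by (simp add: nn_integral_count_space_nat)
qed

text \<open>The Lindelof property, with the countable subcover presented as a sequence so that it
  can be made disjoint.\<close>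
lemma countable_subcover_sequence:
  fixes W :: "'i \<Rightarrow> 'a::second_countable_topology set"
  assumes "\<And>i. i \<in> I \<Longrightarrow> open (W i)" "T \<subseteq> (\<Union>i\<in>I. W i)" "I \<noteq> {}"
  shows "\<exists>c :: nat \<Rightarrow> 'i. (\<forall>n. c n \<in> I) \<and> T \<subseteq> (\<Union>n. W (c n))"
proof -
  obtain F where F: "F \<subseteq> W ` I" "countable F" "\<Union>F = \<Union>(W ` I)"
    using Lindelof[of "W ` I"] assms(1) by blast
  show ?thesis
  proof (cases "F = {}")
    case True
    then have "T = {}" using F assms(2) by auto
    moreover obtain i where "i \<in> I" using assms(3) by auto
    ultimately show ?thesis by (intro exI[of _ "\<lambda>_. i"]) auto
  next
    case False
    have "\<exists>i\<in>I. W i = from_nat_into F n" for n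
      using from_nat_into[OF False, of n] F(1) by (metis imageE subsetD)
    then obtain c where c: "\<And>n. c n \<in> I" "\<And>n. W (c n) = from_nat_into F n" by metis
    have "(\<Union>n. W (c n)) = \<Union>F" using c(2) range_from_nat_into[OF False F(2)] by auto
    then show ?thesis using c(1) F(3) assms(2) by (intro exI[of _ c]) simp
  qed
qed

lemma borel_image_homeomorphism:
  assumes "homeomorphism U V f h" "V \<in> sets borel" "E \<in> sets borel" "E \<subseteq> U"
  shows "f ` E \<in> sets borel"
proof -
  have eq: "f ` E = h -` E \<inter> V"
    using assms(1,4) by (force simp: homeomorphism_def)
  have "h \<in> borel_measurable (restrict_space borel V)"
    using assms(1) by (intro borel_measurable_continuous_on_restrict) (auto simp: homeomorphism_def)
  from measurable_sets[OF this assms(3)] show ?thesis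
    unfolding eq using assms(2) by (simp add: space_restrict_space sets_restrict_space_iff)
qed

text \<open>Only meaningful when \<open>E\<close> lies in the domain of the chart
  \<open>c\<close>.\<close>
definition chart_volume ::
  "(('m, 'n::finite) chart \<Rightarrow> real^'n \<Rightarrow> real^'n^'n) \<Rightarrow> ('m, 'n) chart \<Rightarrow> 'm set \<Rightarrow> ennreal" where
  "chart_volume g c E = (\<integral>\<^sup>+x\<in>snd c ` E. ennreal (sqrt (det (g c x))) \<partial>lborel)"

abbreviation chart_inv :: "('m, 'n) chart \<Rightarrow> real^'n \<Rightarrow> 'm" where
  "chart_inv c \<equiv> inv_into (fst c) (snd c)"

lemma manifold_chartD:
  assumes "riemannian_manifold A g" "c \<in> A"
  shows "open (fst c)" "open (snd c ` fst c)"
    "homeomorphism (fst c) (snd c ` fst c) (snd c) (chart_inv c)"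
    "smooth_on (snd c ` fst c) (g c)"
    "\<And>x v. x \<in> snd c ` fst c \<Longrightarrow> v \<noteq> 0 \<Longrightarrow> v \<bullet> (g c x *v v) > 0"
  using assms by (auto simp: riemannian_manifold_def smooth_atlas_def split: prod.splits)

lemma manifold_cover: "riemannian_manifold A g \<Longrightarrow> (\<Union>c\<in>A. fst c) = UNIV"
  by (simp add: riemannian_manifold_def smooth_atlas_def)

lemma manifold_transition:
  assumes "riemannian_manifold A g" "c \<in> A" "c' \<in> A"
  shows "smooth_on (snd c ` (fst c \<inter> fst c')) (snd c' \<circ> chart_inv c)"
    and "\<And>p. p \<in> fst c \<Longrightarrow> p \<in> fst c' \<Longrightarrow> g c (snd c p) =
          transpose (jacobian (snd c' \<circ> chart_inv c) (snd c p)) ** g c' (snd c' p)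
            ** jacobian (snd c' \<circ> chart_inv c) (snd c p)"
proof -
  have "\<forall>c\<in>A. \<forall>c'\<in>A. smooth_on (snd c ` (fst c \<inter> fst c')) (snd c' \<circ> chart_inv c)"
    using assms(1) unfolding riemannian_manifold_def smooth_atlas_def case_prod_unfold by (elim conjE)
  then show "smooth_on (snd c ` (fst c \<inter> fst c')) (snd c' \<circ> chart_inv c)"
    using assms(2,3) by blast
  have "\<forall>c\<in>A. \<forall>c'\<in>A. \<forall>p\<in>fst c \<inter> fst c'. g c (snd c p) =
          transpose (jacobian (snd c' \<circ> chart_inv c) (snd c p)) ** g c' (snd c' p)
            ** jacobian (snd c' \<circ> chart_inv c) (snd c p)"
    using assms(1) unfolding riemannian_manifold_def case_prod_unfold prod.collapse by (elim conjE)
  then show "g c (snd c p) =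
          transpose (jacobian (snd c' \<circ> chart_inv c) (snd c p)) ** g c' (snd c' p)
            ** jacobian (snd c' \<circ> chart_inv c) (snd c p)" if "p \<in> fst c" "p \<in> fst c'" for p
    using assms(2,3) that by blast
qed

lemma Ck_on_metric:
  assumes "riemannian_manifold A g" "c \<in> A"
  shows "Ck_on k (snd c ` fst c) (\<lambda>x. g c x $ i $ j)"
  using manifold_chartD(4)[OF assms]
  by (intro Ck_on_bounded_linear_compose[OF bounded_linear_vec_nth, of _ _ "\<lambda>x. g c x $ i"]
      Ck_on_bounded_linear_compose[OF bounded_linear_vec_nth]) (simp add: smooth_on_def)

lemma metric_det_pos:
  assumes "riemannian_manifold A g" "c \<in> A" "x \<in> snd c ` fst c"
  shows "det (g c x) > 0"
  using manifold_chartD(5)[OF assms] by (rule det_pos_if_pos_def)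

lemma metric_sqrt_det_C1:
  assumes "riemannian_manifold A g" "c \<in> A"
  shows "Ck_on 1 (snd c ` fst c) (\<lambda>x. sqrt (det (g c x)))"
proof (rule Ck_on_compose[OF C1_on_sqrt])
  show "Ck_on 1 (snd c ` fst c) (\<lambda>x. det (g c x))" by (intro Ck_on_det Ck_on_metric[OF assms])
  show "(\<lambda>x. det (g c x)) ` (snd c ` fst c) \<subseteq> {0<..}" using metric_det_pos[OF assms] by auto
qed

lemma metric_density_measurable:
  assumes "riemannian_manifold A g" "c \<in> A"
  shows "(\<lambda>x. if x \<in> snd c ` fst c then sqrt (det (g c x)) else 0) \<in> borel_measurable borel"
  using Ck_on_imp_continuous_on[OF metric_sqrt_det_C1[OF assms]] manifold_chartD(2)[OF assms]
  by (intro borel_measurable_continuous_on_if) auto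

lemma chart_image_borel:
  assumes "riemannian_manifold A g" "c \<in> A" "E \<in> sets borel" "E \<subseteq> fst c"
  shows "snd c ` E \<in> sets borel"
  using borel_image_homeomorphism[OF manifold_chartD(3)[OF assms(1,2)]] manifold_chartD(2)[OF assms(1,2)] assms(3,4)
  by auto

text \<open>If a diffeomorphism multiplies the Riemannian density by \<open>G\<close>, it carries
  \<open>G\<close> times Lebesgue measure to the Riemannian volume in the chart. This is used with
  the transition maps, where \<open>G\<close> is the density in the other chart, and with the flat
  tube, where \<open>G = 1\<close>.\<close>
lemma nn_integral_isometric_diffeo:
  assumes m: "riemannian_manifold A g" and c: "c \<in> A"
    and d: "C1_diffeo V V' f h" and V': "V' \<subseteq> snd c ` fst c"
    and B: "B \<in> sets borel" "B \<subseteq> V'"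
    and G: "\<And>x. x \<in> V \<Longrightarrow> \<bar>det (jacobian f x)\<bar> * sqrt (det (g c (f x))) = G x"
  shows "(\<integral>\<^sup>+y\<in>B. ennreal (sqrt (det (g c y))) \<partial>lborel) = (\<integral>\<^sup>+x\<in>V \<inter> f -` B. ennreal (G x) \<partial>lborel)"
proof -
  let ?w = "\<lambda>y. if y \<in> snd c ` fst c then sqrt (det (g c y)) else 0"
  let ?k = "\<lambda>y. ennreal (?w y) * indicator B y"
  have [measurable]: "?w \<in> borel_measurable borel" using metric_density_measurable[OF m c] .
  have k: "?k \<in> borel_measurable borel" using B by measurable
  have "(\<integral>\<^sup>+y\<in>B. ennreal (sqrt (det (g c y))) \<partial>lborel) = (\<integral>\<^sup>+y. indicator V' y * ?k y \<partial>lborel)"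
    using B V' by (intro nn_integral_cong) (auto simp: indicator_def)
  also have "\<dots> = (\<integral>\<^sup>+x. ennreal (indicator V x * \<bar>det (jacobian f x)\<bar>) * ?k (f x) \<partial>lborel)"
    by (rule nn_integral_C1_diffeo[OF d k])
  also have "\<dots> = (\<integral>\<^sup>+x\<in>V \<inter> f -` B. ennreal (G x) \<partial>lborel)"
  proof (rule nn_integral_cong)
    fix x
    show "ennreal (indicator V x * \<bar>det (jacobian f x)\<bar>) * ?k (f x) = ennreal (G x) * indicator (V \<inter> f -` B) x"
    proof (cases "x \<in> V \<and> f x \<in> B")
      case True
      then have "f x \<in> snd c ` fst c" using B V' by auto
      then show ?thesis using True G[of x] by (simp add: ennreal_mult'[symmetric])
    qed (auto simp: indicator_def)
  qed
  finally show ?thesis .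
qed

text \<open>Taking determinants in the transformation law of the metric gives \<open>det g = (det
  D)\<^sup>2 det g'\<close>, which cancels the Jacobian of the change of variables.\<close>
lemma chart_volume_change:
  assumes m: "riemannian_manifold A g" and c: "c \<in> A" "c' \<in> A"
    and E: "E \<in> sets borel" "E \<subseteq> fst c" "E \<subseteq> fst c'"
  shows "chart_volume g c E = chart_volume g c' E"
proof -
  let ?V = "snd c ` (fst c \<inter> fst c')" and ?V' = "snd c' ` (fst c \<inter> fst c')"
  let ?f = "snd c' \<circ> chart_inv c" and ?h = "snd c \<circ> chart_inv c'"
  note hom = manifold_chartD(3)[OF m c(1)] manifold_chartD(3)[OF m c(2)]
  have inv: "chart_inv c (snd c p) = p" if "p \<in> fst c" for p
    using hom(1) that by (auto simp: homeomorphism_def)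
  have h1: "homeomorphism (fst c \<inter> fst c') ?V (snd c) (chart_inv c)"
    by (rule homeomorphism_of_subsets[OF hom(1)]) (use hom(1) in \<open>auto simp: homeomorphism_def\<close>)
  have h2: "homeomorphism (fst c \<inter> fst c') ?V' (snd c') (chart_inv c')"
    by (rule homeomorphism_of_subsets[OF hom(2)]) (use hom(2) in \<open>auto simp: homeomorphism_def\<close>)
  have op: "open ?V" "open ?V'"
    using homeomorphism_imp_open_map[OF hom(1), of "fst c \<inter> fst c'"] homeomorphism_imp_open_map[OF hom(2), of "fst c \<inter> fst c'"]
      manifold_chartD(1,2)[OF m c(1)] manifold_chartD(1,2)[OF m c(2)]
    by (metis inf_le1 inf_le2 open_Int openin_open_eq)+
  have "homeomorphism ?V ?V' ?f ?h"
    using homeomorphism_compose[OF homeomorphism_sym[THEN iffD1, OF h1] h2] .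
  moreover have "Ck_on 1 ?V ?f" using manifold_transition(1)[OF m c] by (simp add: smooth_on_def)
  ultimately have d: "C1_diffeo ?V ?V' ?f ?h"
    using op by (simp add: C1_diffeo_def)
  have "chart_volume g c' E = (\<integral>\<^sup>+y\<in>snd c' ` E. ennreal (sqrt (det (g c' y))) \<partial>lborel)"
    by (simp add: chart_volume_def)
  also have "\<dots> = (\<integral>\<^sup>+x\<in>?V \<inter> ?f -` (snd c' ` E). ennreal (sqrt (det (g c x))) \<partial>lborel)"
  proof (rule nn_integral_isometric_diffeo[OF m c(2) d])
    show "snd c' ` E \<in> sets borel" by (rule chart_image_borel[OF m c(2) E(1,3)])
    show "\<bar>det (jacobian ?f x)\<bar> * sqrt (det (g c' (?f x))) = sqrt (det (g c x))"
      if xV: "x \<in> ?V" for x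
    proof -
      obtain p where p: "p \<in> fst c" "p \<in> fst c'" "x = snd c p" using xV by blast
      have "det (g c x) = (det (jacobian ?f x))\<^sup>2 * det (g c' (?f x))"
        using manifold_transition(2)[OF m c p(1,2)] inv[OF p(1)] p(3)
        by (simp add: det_mul det_transpose power2_eq_square)
      then show ?thesis by (simp add: real_sqrt_mult)
    qed
  qed (use E in auto)
  also have "?V \<inter> ?f -` (snd c' ` E) = snd c ` E"
  proof -
    have inv': "chart_inv c' (snd c' p) = p" if "p \<in> fst c'" for p
      using hom(2) that by (auto simp: homeomorphism_def)
    show ?thesis
    proof (intro equalityI subsetI)
      fix x assume "x \<in> ?V \<inter> ?f -` (snd c' ` E)"
      then obtain p q where p: "p \<in> fst c" "p \<in> fst c'" "x = snd c p" "q \<in> E" "?f x = snd c' q" by blast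
      then have "snd c' p = snd c' q" using inv by simp
      then have "p = q" using inv'[of p] inv'[of q] p E(3) by auto
      then show "x \<in> snd c ` E" using p by simp
    next
      fix x assume "x \<in> snd c ` E"
      then obtain p where p: "p \<in> E" "x = snd c p" by blast
      then have "p \<in> fst c \<inter> fst c'" "?f x = snd c' p" using inv E by auto
      then show "x \<in> ?V \<inter> ?f -` (snd c' ` E)" using p by auto
    qed
  qed
  finally show ?thesis by (simp add: chart_volume_def)
qed

lemma chart_volume_sums:
  assumes m: "riemannian_manifold A g" and c: "c \<in> A"
    and B: "\<And>i. B i \<in> sets borel" "\<And>i::nat. B i \<subseteq> fst c" "disjoint_family B"
  shows "(\<Sum>i. chart_volume g c (B i)) = chart_volume g c (\<Union>i. B i)"
proof -
  let ?w = "\<lambda>y. if y \<in> snd c ` fst c then sqrt (det (g c y)) else 0"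
  have wm[measurable]: "?w \<in> borel_measurable borel" using metric_density_measurable[OF m c] .
  let ?M = "density lborel (\<lambda>y. ennreal (?w y))"
  have eq: "chart_volume g c E = emeasure ?M (snd c ` E)" if "E \<in> sets borel" "E \<subseteq> fst c" for E
    using chart_image_borel[OF m c that] that
    unfolding chart_volume_def by (subst emeasure_density) (auto intro!: nn_integral_cong simp: indicator_def subset_iff)
  have inj: "inj_on (snd c) (fst c)" using manifold_chartD(3)[OF m c] by (auto simp: homeomorphism_def inj_on_def) metis
  have "(\<Sum>i. chart_volume g c (B i)) = (\<Sum>i. emeasure ?M (snd c ` B i))"
    using eq B by simp
  also have "\<dots> = emeasure ?M (\<Union>i. snd c ` B i)"
  proof (rule suminf_emeasure)
    show "range (\<lambda>i. snd c ` B i) \<subseteq> sets ?M" using chart_image_borel[OF m c B(1,2)] by auto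
    show "disjoint_family (\<lambda>i. snd c ` B i)"
      using B(3) inj_on_image_Int[OF inj B(2) B(2)] unfolding disjoint_family_on_def by (metis image_is_empty)
  qed
  also have "\<dots> = emeasure ?M (snd c ` (\<Union>i. B i))" by (simp add: image_UN)
  also have "\<dots> = chart_volume g c (\<Union>i. B i)"
    using B by (subst eq) auto
  finally show ?thesis .
qed

lemma disjointed_chart_domains:
  fixes A :: "('m::{t2_space,second_countable_topology}, 'n::finite) chart set"
  assumes m: "riemannian_manifold A g"
  obtains c :: "nat \<Rightarrow> ('m, 'n) chart" and D :: "nat \<Rightarrow> 'm set"
  where "\<And>n. c n \<in> A" "\<And>n. D n \<in> sets borel" "\<And>n. D n \<subseteq> fst (c n)" "disjoint_family D" "(\<Union>n. D n) = UNIV"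
proof -
  have ne: "A \<noteq> {}" using manifold_cover[OF m] by auto
  have cov: "UNIV \<subseteq> (\<Union>c\<in>A. fst c)" using manifold_cover[OF m] by simp
  obtain c :: "nat \<Rightarrow> ('m, 'n) chart" where c: "\<And>n. c n \<in> A" "UNIV \<subseteq> (\<Union>n. fst (c n))"
    using countable_subcover_sequence[OF manifold_chartD(1)[OF m] cov ne] by auto
  show ?thesis
  proof
    have "range (\<lambda>n. fst (c n)) \<subseteq> sets borel" using manifold_chartD(1)[OF m c(1)] by (auto intro: borel_open)
    from sets.range_disjointed_sets[OF this]
    show "disjointed (\<lambda>n. fst (c n)) n \<in> sets borel" for n by (rule subsetD) simp
    show "disjointed (\<lambda>n. fst (c n)) n \<subseteq> fst (c n)" for n by (rule disjointed_subset)
    show "disjoint_family (disjointed (\<lambda>n. fst (c n)))" by (rule disjoint_family_disjointed)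
    show "(\<Union>n. disjointed (\<lambda>n. fst (c n)) n) = UNIV" using c(2) by (auto simp: UN_disjointed_eq)
  qed (rule c)
qed

text \<open>The property in the definite description that defines
  \<open>riemannian_volume\<close>.\<close>
definition is_volume where
  "is_volume A g \<mu> \<longleftrightarrow> sets \<mu> = sets borel \<and>
     (\<forall>c\<in>A. \<forall>E\<in>sets borel. E \<subseteq> fst c \<longrightarrow> emeasure \<mu> E = chart_volume g c E)"

lemma volume_unique:
  assumes m: "riemannian_manifold A g" and "is_volume A g \<mu>" "is_volume A g \<nu>"
  shows "\<mu> = \<nu>"
proof (rule measure_eqI)
  show "sets \<mu> = sets \<nu>" using assms by (simp add: is_volume_def)
  fix E assume "E \<in> sets \<mu>"
  then have E: "E \<in> sets borel" using assms by (simp add: is_volume_def)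
  obtain c D where D: "\<And>n. c n \<in> A" "\<And>n. D n \<in> sets borel" "\<And>n. D n \<subseteq> fst (c n)" "disjoint_family D" "(\<Union>n::nat. D n) = UNIV"
    using disjointed_chart_domains[OF m] by metis
  have s: "emeasure M E = (\<Sum>n. chart_volume g (c n) (E \<inter> D n))" if M: "is_volume A g M" for M
  proof -
    have "emeasure M E = emeasure M (\<Union>n. E \<inter> D n)" using D(5) by (metis Int_UN_distrib Int_UNIV_right)
    also have "\<dots> = (\<Sum>n. emeasure M (E \<inter> D n))"
      by (rule suminf_emeasure[symmetric]) (use D(1-3) E M disjoint_family_on_bisimulation[OF D(4), of "\<lambda>n. E \<inter> D n"] in \<open>auto simp: is_volume_def\<close>)
    also have "\<dots> = (\<Sum>n. chart_volume g (c n) (E \<inter> D n))"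
    proof (rule suminf_cong)
      fix n
      have "E \<inter> D n \<in> sets borel" "E \<inter> D n \<subseteq> fst (c n)" using D(2,3) E by auto
      then show "emeasure M (E \<inter> D n) = chart_volume g (c n) (E \<inter> D n)"
        using M D(1) by (auto simp: is_volume_def)
    qed
    finally show ?thesis .
  qed
  show "emeasure \<mu> E = emeasure \<nu> E" using s assms by metis
qed

text \<open>On each piece of a countable disjoint cover by subsets of chart domains the volume is
  the one of that chart, and the sum of these is a measure. A set inside any other chart is cut
  into the same pieces, and on each of them the two charts agree.\<close>
lemma volume_exists:
  fixes A :: "('m::{t2_space,second_countable_topology}, 'n::finite) chart set"
  assumes m: "riemannian_manifold A g"
  shows "\<exists>\<mu>. is_volume A g \<mu>"
proof -
  obtain c D where D: "\<And>n. c n \<in> A" "\<And>n. D n \<in> sets borel" "\<And>n. D n \<subseteq> fst (c n)" "disjoint_family D" "(\<Union>n::nat. D n) = UNIV"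
    using disjointed_chart_domains[OF m] by metis
  define \<nu> where "\<nu> = (\<lambda>E. \<Sum>n. chart_volume g (c n) (E \<inter> D n))"
  define \<mu> where "\<mu> = measure_of UNIV (sets (borel :: 'm measure)) \<nu>"
  have sub: "E \<inter> D n \<subseteq> fst (c n)" for E n using D(3) by blast
  have ca: "countably_additive (sets borel) \<nu>"
    unfolding countably_additive_def
  proof (intro allI impI)
    fix B :: "nat \<Rightarrow> 'm set" assume B: "range B \<subseteq> sets borel" "disjoint_family B" "(\<Union>i. B i) \<in> sets borel"
    have "(\<Sum>i. \<nu> (B i)) = (\<Sum>n. \<Sum>i. chart_volume g (c n) (B i \<inter> D n))"
      unfolding \<nu>_def by (rule suminf_swap_ennreal)
    also have "\<dots> = (\<Sum>n. chart_volume g (c n) (\<Union>i. B i \<inter> D n))"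
      using B D sub by (intro suminf_cong chart_volume_sums[OF m D(1)] sub disjoint_family_on_bisimulation[OF B(2)]) auto
    also have "\<dots> = \<nu> (\<Union>i. B i)" unfolding \<nu>_def by simp
    finally show "(\<Sum>i. \<nu> (B i)) = \<nu> (\<Union>i. B i)" .
  qed
  have sm: "sets \<mu> = sets borel" unfolding \<mu>_def
    using sets.sigma_sets_eq[of "borel :: 'm measure"] by (simp add: sets.space_closed[of borel, simplified])
  have em: "emeasure \<mu> E = \<nu> E" if "E \<in> sets borel" for E
    unfolding \<mu>_def
  proof (rule emeasure_measure_of_sigma[OF _ _ ca that])
    show "sigma_algebra UNIV (sets (borel :: 'm measure))"
      using sets.sigma_algebra_axioms[of "borel :: 'm measure"] by simp
    show "positive (sets borel) \<nu>" by (simp add: positive_def \<nu>_def chart_volume_def)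
  qed
  have "emeasure \<mu> E = chart_volume g b E" if b: "b \<in> A" and E: "E \<in> sets borel" "E \<subseteq> fst b" for b E
  proof -
    have "emeasure \<mu> E = (\<Sum>n. chart_volume g (c n) (E \<inter> D n))" using em[OF E(1)] by (simp add: \<nu>_def)
    also have "\<dots> = (\<Sum>n. chart_volume g b (E \<inter> D n))"
      using E D sub by (intro suminf_cong chart_volume_change[OF m D(1) b]) auto
    also have "\<dots> = chart_volume g b (\<Union>n. E \<inter> D n)"
      using E D by (intro chart_volume_sums[OF m b] disjoint_family_on_bisimulation[OF D(4)]) auto
    also have "(\<Union>n. E \<inter> D n) = E" using D(5) by (metis Int_UN_distrib Int_UNIV_right)
    finally show ?thesis .
  qed
  then show ?thesis using sm by (auto simp: is_volume_def intro!: exI[of _ \<mu>])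
qed

lemma riemannian_volume_is_volume:
  assumes m: "riemannian_manifold A g"
  shows "is_volume A g (riemannian_volume A g)"
proof -
  have "riemannian_volume A g = (THE \<mu>. is_volume A g \<mu>)"
    unfolding riemannian_volume_def is_volume_def chart_volume_def by (auto simp: case_prod_unfold)
  then show ?thesis
    using theI'[of "is_volume A g"] volume_exists[OF m] volume_unique[OF m] by metis
qed

section \<open>The flat tube inside the manifold\<close>

text \<open>A fundamental domain of the tube for the translations by periods.\<close>
definition torus_cell :: "'n::finite set \<Rightarrow> real \<Rightarrow> (real^'n) set" where
  "torus_cell J \<epsilon> = {x \<in> flat_tube J \<epsilon>. \<forall>i\<in>J. 0 \<le> x $ i \<and> x $ i < 2 * pi}"

lemma continuous_on_norm': "continuous_on S (norm' J)"
  unfolding norm'_def[abs_def] by (intro continuous_intros)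

lemma open_flat_tube: "open (flat_tube J \<epsilon>)"
  unfolding flat_tube_def by (intro open_Collect_less continuous_on_norm' continuous_intros)

lemma torus_cell_borel: "torus_cell J \<epsilon> \<in> sets borel"
proof -
  have [measurable]: "flat_tube J \<epsilon> \<in> sets borel" by (intro borel_open open_flat_tube)
  show ?thesis unfolding torus_cell_def by measurable
qed

lemma torus_cell_subset: "torus_cell J \<epsilon> \<subseteq> flat_tube J \<epsilon>"
  by (auto simp: torus_cell_def)

lemma torus_cell_representative:
  assumes "x \<in> flat_tube J \<epsilon>"
  obtains y where "y \<in> torus_cell J \<epsilon>" "torus_cong J y x"
proof -
  let ?m = "\<lambda>i. of_int \<lfloor>x $ i / (2 * pi)\<rfloor> :: real"
  let ?y = "\<chi> i. if i \<in> J then x $ i - 2 * pi * ?m i else x $ i"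
  have "norm' J ?y = norm' J x" by (simp add: norm'_def)
  then have "?y \<in> flat_tube J \<epsilon>" using assms by (simp add: flat_tube_def)
  moreover have "0 \<le> x $ i - 2 * pi * ?m i \<and> x $ i - 2 * pi * ?m i < 2 * pi" for i
  proof -
    have "?m i \<le> x $ i / (2 * pi)" "x $ i / (2 * pi) < ?m i + 1" by linarith+
    then have "?m i * (2 * pi) \<le> x $ i" "x $ i < (?m i + 1) * (2 * pi)"
      using pos_le_divide_eq[of "2 * pi" "?m i" "x $ i"] pos_divide_less_eq[of "2 * pi" "x $ i" "?m i + 1"] by simp_all
    then show ?thesis by (simp add: algebra_simps)
  qed
  ultimately have "?y \<in> torus_cell J \<epsilon>" by (simp add: torus_cell_def)
  moreover have "torus_cong J ?y x"
    by (auto simp: torus_cong_def intro!: exI[of _ "- \<lfloor>x $ i / (2 * pi)\<rfloor>" for i])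
  ultimately show ?thesis using that by blast
qed

lemma torus_cong_cell_eq:
  assumes "x \<in> torus_cell J \<epsilon>" "y \<in> torus_cell J \<epsilon>" "torus_cong J x y"
  shows "x = y"
proof -
  have "x $ i = y $ i" for i
  proof (cases "i \<in> J")
    case True
    then obtain m :: int where m: "x $ i - y $ i = 2 * pi * of_int m" using assms(3) by (auto simp: torus_cong_def)
    have "0 \<le> x $ i \<and> x $ i < 2 * pi" "0 \<le> y $ i \<and> y $ i < 2 * pi"
      using assms(1,2) True by (simp_all add: torus_cell_def)
    then have "\<bar>x $ i - y $ i\<bar> < 2 * pi" by linarith
    then have "2 * pi * \<bar>of_int m :: real\<bar> < 2 * pi * 1" unfolding m by (simp add: abs_mult)
    then have "\<bar>of_int m :: real\<bar> < 1" using mult_less_cancel_left_pos[of "2 * pi" "\<bar>of_int m\<bar>" 1] by simp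
    then have "m = 0" by linarith
    then show ?thesis using m by simp
  next
    case False
    then show ?thesis using assms(3) by (simp add: torus_cong_def)
  qed
  then show ?thesis by (simp add: vec_eq_iff)
qed

lemma embeddingD:
  assumes "flat_product_embedding A g J \<epsilon> F"
  shows "\<And>x y. x \<in> flat_tube J \<epsilon> \<Longrightarrow> y \<in> flat_tube J \<epsilon> \<Longrightarrow> F x = F y \<longleftrightarrow> torus_cong J x y"
    and "\<And>c x. c \<in> A \<Longrightarrow> x \<in> flat_tube J \<epsilon> \<Longrightarrow> F x \<in> fst c \<Longrightarrow>
      \<exists>W. x \<in> W \<and> W \<subseteq> flat_tube J \<epsilon> \<and> F ` W \<subseteq> fst c \<and> diffeo_between W ((snd c \<circ> F) ` W) (snd c \<circ> F)"
    and "\<And>c x. c \<in> A \<Longrightarrow> x \<in> flat_tube J \<epsilon> \<Longrightarrow> F x \<in> fst c \<Longrightarrow>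
      transpose (jacobian (snd c \<circ> F) x) ** g c (snd c (F x)) ** jacobian (snd c \<circ> F) x = mat 1"
proof -
  note * = assms[unfolded flat_product_embedding_def case_prod_unfold prod.collapse]
  show "\<And>x y. x \<in> flat_tube J \<epsilon> \<Longrightarrow> y \<in> flat_tube J \<epsilon> \<Longrightarrow> F x = F y \<longleftrightarrow> torus_cong J x y"
    using conjunct1[OF *] by blast
  note ** = conjunct2[OF *]
  fix c x assume c: "c \<in> A" "x \<in> flat_tube J \<epsilon>" "F x \<in> fst c"
  note *** = **[THEN bspec, OF c(1), THEN bspec, OF c(2), THEN mp, OF c(3)]
  show "\<exists>W. x \<in> W \<and> W \<subseteq> flat_tube J \<epsilon> \<and> F ` W \<subseteq> fst c \<and> diffeo_between W ((snd c \<circ> F) ` W) (snd c \<circ> F)"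
    using conjunct1[OF ***] .
  show "transpose (jacobian (snd c \<circ> F) x) ** g c (snd c (F x)) ** jacobian (snd c \<circ> F) x = mat 1"
    using conjunct2[OF ***] .
qed

lemma homeomorphism_inv_into:
  assumes "inj_on f W" "continuous_on W f" "continuous_on (f ` W) (inv_into W f)"
  shows "homeomorphism W (f ` W) f (inv_into W f)"
proof -
  have i: "inv_into W f (f x) = x" if "x \<in> W" for x using assms(1) that by (rule inv_into_f_f)
  have "inv_into W f ` f ` W = W" by (simp add: image_image i)
  then show ?thesis using assms(2,3) i unfolding homeomorphism_def by auto
qed

text \<open>Read in a chart, the embedding is locally a diffeomorphism, and the determinant of
  \<open>D\<^sup>T g D = 1\<close> says that it preserves volume.\<close>
lemma embedding_local_chart:
  assumes m: "riemannian_manifold A g" and e: "flat_product_embedding A g J \<epsilon> F"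
    and c: "c \<in> A" and x: "x \<in> flat_tube J \<epsilon>" "F x \<in> fst c"
  obtains W where "open W" "x \<in> W" "W \<subseteq> flat_tube J \<epsilon>" "F ` W \<subseteq> fst c"
    "C1_diffeo W ((snd c \<circ> F) ` W) (snd c \<circ> F) (inv_into W (snd c \<circ> F))"
    "smooth_on ((snd c \<circ> F) ` W) (inv_into W (snd c \<circ> F))"
    "\<And>z. z \<in> W \<Longrightarrow> \<bar>det (jacobian (snd c \<circ> F) z)\<bar> * sqrt (det (g c ((snd c \<circ> F) z))) = 1"
proof -
  let ?f = "snd c \<circ> F"
  obtain W where W: "x \<in> W" "W \<subseteq> flat_tube J \<epsilon>" "F ` W \<subseteq> fst c" "diffeo_between W (?f ` W) ?f"
    using embeddingD(2)[OF e c x] by blast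
  then have d: "open W" "open (?f ` W)" "bij_betw ?f W (?f ` W)" "smooth_on W ?f" "smooth_on (?f ` W) (inv_into W ?f)"
    by (auto simp: diffeo_between_def)
  have inj: "inj_on ?f W" using d(3) by (simp add: bij_betw_def)
  have "continuous_on W ?f" "continuous_on (?f ` W) (inv_into W ?f)"
    using d(4,5) unfolding smooth_on_def by (metis Ck_on.simps(1))+
  then have "homeomorphism W (?f ` W) ?f (inv_into W ?f)"
    by (rule homeomorphism_inv_into[OF inj])
  moreover have "Ck_on 1 W ?f" using d(4) by (simp add: smooth_on_def)
  ultimately have "C1_diffeo W (?f ` W) ?f (inv_into W ?f)"
    using d(1,2) by (simp add: C1_diffeo_def)
  moreover have "\<bar>det (jacobian ?f z)\<bar> * sqrt (det (g c (?f z))) = 1" if "z \<in> W" for z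
  proof -
    have z: "z \<in> flat_tube J \<epsilon>" "F z \<in> fst c" using that W by auto
    have "det (transpose (jacobian ?f z) ** g c (snd c (F z)) ** jacobian ?f z) = 1"
      using embeddingD(3)[OF e c z] by (simp add: det_I)
    then have "(det (jacobian ?f z))\<^sup>2 * det (g c (?f z)) = 1"
      by (simp add: det_mul det_transpose power2_eq_square mult_ac)
    then have "sqrt ((det (jacobian ?f z))\<^sup>2 * det (g c (?f z))) = 1" by simp
    then show ?thesis by (simp add: real_sqrt_mult)
  qed
  ultimately show ?thesis using that[OF d(1) W(1-3) _ d(5)] by blast
qed

lemma manifold_chart_at:
  assumes "riemannian_manifold A g"
  obtains c where "c \<in> A" "p \<in> fst c"
  using manifold_cover[OF assms] by blast

lemma chart_inverse:
  assumes "riemannian_manifold A g" "c \<in> A" "p \<in> fst c"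
  shows "chart_inv c (snd c p) = p"
  using manifold_chartD(3)[OF assms(1,2)] assms(3) by (auto simp: homeomorphism_def)

lemma embedding_continuous_open:
  assumes m: "riemannian_manifold A g" and e: "flat_product_embedding A g J \<epsilon> F"
  shows "continuous_on (flat_tube J \<epsilon>) F" and "open (F ` flat_tube J \<epsilon>)"
proof -
  have local: "\<exists>W. open W \<and> x \<in> W \<and> W \<subseteq> flat_tube J \<epsilon> \<and> continuous_on W F \<and> open (F ` W)" if x: "x \<in> flat_tube J \<epsilon>" for x
  proof -
    obtain c where c: "c \<in> A" "F x \<in> fst c" using manifold_chart_at[OF m] by blast
    obtain W where W: "open W" "x \<in> W" "W \<subseteq> flat_tube J \<epsilon>" "F ` W \<subseteq> fst c"
      "C1_diffeo W ((snd c \<circ> F) ` W) (snd c \<circ> F) (inv_into W (snd c \<circ> F))"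
      using embedding_local_chart[OF m e c(1) x c(2)] by metis
    note hom = manifold_chartD(3)[OF m c(1)]
    let ?i = "chart_inv c"
    have ci: "continuous_on (snd c ` fst c) ?i" using hom by (auto simp: homeomorphism_def)
    have cf: "continuous_on W (snd c \<circ> F)" using W(5) by (auto simp: C1_diffeo_def homeomorphism_def)
    have im: "(snd c \<circ> F) ` W \<subseteq> snd c ` fst c" using W(4) by auto
    have eq: "?i ((snd c \<circ> F) z) = F z" if "z \<in> W" for z
      using chart_inverse[OF m c(1)] W(4) that by auto
    have "continuous_on W F"
      using continuous_on_compose2[OF ci cf im] eq by (simp cong: continuous_on_cong)
    moreover have "open (F ` W)"
    proof -
      have "open ((snd c \<circ> F) ` W)" using W(5) by (simp add: C1_diffeo_def)
      then have "openin (top_of_set (snd c ` fst c)) ((snd c \<circ> F) ` W)"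
        using im manifold_chartD(2)[OF m c(1)] by (simp add: openin_open_eq)
      from homeomorphism_imp_open_map[OF homeomorphism_sym[THEN iffD1, OF hom] this]
      have "open (?i ` ((snd c \<circ> F) ` W))"
        using manifold_chartD(1)[OF m c(1)] by (simp add: openin_open_eq)
      also have "?i ` ((snd c \<circ> F) ` W) = F ` W" using eq by (simp add: image_image) 
      finally show ?thesis .
    qed
    ultimately show ?thesis using W by blast
  qed
  show "continuous_on (flat_tube J \<epsilon>) F"
  proof (rule continuous_at_imp_continuous_on, rule ballI)
    fix x assume "x \<in> flat_tube J \<epsilon>"
    then obtain W where "open W" "x \<in> W" "continuous_on W F" using local by blast
    then show "isCont F x" using continuous_on_eq_continuous_at by blast
  qed
  show "open (F ` flat_tube J \<epsilon>)"
  proof (subst open_subopen, rule ballI)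
    fix p assume "p \<in> F ` flat_tube J \<epsilon>"
    then obtain x where "x \<in> flat_tube J \<epsilon>" "p = F x" by blast
    then obtain W where "x \<in> W" "W \<subseteq> flat_tube J \<epsilon>" "open (F ` W)" using local by blast
    then show "\<exists>T. open T \<and> p \<in> T \<and> T \<subseteq> F ` flat_tube J \<epsilon>"
      using \<open>p = F x\<close> by (intro exI[of _ "F ` W"]) auto
  qed
qed

lemma embedding_inj_on_cell:
  assumes e: "flat_product_embedding A g J \<epsilon> F"
  shows "inj_on F (torus_cell J \<epsilon>)" "F ` torus_cell J \<epsilon> = F ` flat_tube J \<epsilon>"
proof -
  show "inj_on F (torus_cell J \<epsilon>)"
    using embeddingD(1)[OF e] torus_cong_cell_eq torus_cell_subset unfolding inj_on_def by blast
  show "F ` torus_cell J \<epsilon> = F ` flat_tube J \<epsilon>"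
  proof
    show "F ` flat_tube J \<epsilon> \<subseteq> F ` torus_cell J \<epsilon>"
    proof
      fix p assume "p \<in> F ` flat_tube J \<epsilon>"
      then obtain x where x: "x \<in> flat_tube J \<epsilon>" "p = F x" by blast
      then obtain y where y: "y \<in> torus_cell J \<epsilon>" "torus_cong J y x" using torus_cell_representative by blast
      then have "F y = F x" using embeddingD(1)[OF e] x torus_cell_subset by blast
      then show "p \<in> F ` torus_cell J \<epsilon>" using x y by (metis imageI)
    qed
  qed (use torus_cell_subset in blast)
qed

text \<open>The set is cut into countably many pieces on each of which the embedding is a volume
  preserving diffeomorphism into a chart. Injectivity on the cell keeps the images of the pieces
  disjoint.\<close>
lemma embedding_emeasure:
  assumes m: "riemannian_manifold A g" and e: "flat_product_embedding A g J \<epsilon> F"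
    and Q: "Q \<in> sets borel" "Q \<subseteq> torus_cell J \<epsilon>"
  shows "F ` Q \<in> sets borel \<and> emeasure (riemannian_volume A g) (F ` Q) = emeasure lborel Q"
proof -
  note vol = riemannian_volume_is_volume[OF m]
  \<comment> \<open>The open sets on which the embedding is a volume preserving diffeomorphism into one chart.\<close>
  define good where "good = (\<lambda>W. open W \<and> (\<exists>c\<in>A. F ` W \<subseteq> fst c \<and>
    C1_diffeo W ((snd c \<circ> F) ` W) (snd c \<circ> F) (inv_into W (snd c \<circ> F)) \<and>
    (\<forall>z\<in>W. \<bar>det (jacobian (snd c \<circ> F) z)\<bar> * sqrt (det (g c ((snd c \<circ> F) z))) = 1)))"
  have cover: "flat_tube J \<epsilon> \<subseteq> (\<Union>W\<in>{W. good W}. W)"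
  proof
    fix x assume x: "x \<in> flat_tube J \<epsilon>"
    obtain c where c: "c \<in> A" "F x \<in> fst c" using manifold_chart_at[OF m] by blast
    obtain W where "x \<in> W" "good W"
      using embedding_local_chart[OF m e c(1) x c(2)] c(1) unfolding good_def by metis
    then show "x \<in> (\<Union>W\<in>{W. good W}. W)" by blast
  qed
  \<comment> \<open>The empty set keeps the cover nonempty when the tube is empty.\<close>
  have "good {}"
  proof -
    obtain c where c: "c \<in> A" using manifold_cover[OF m] by blast
    show ?thesis unfolding good_def by (intro conjI bexI[OF _ c]) (auto simp: C1_diffeo_def homeomorphism_def intro: Ck_on_local)
  qed
  then have "{W. good W} \<noteq> {}" by blast
  with cover obtain W :: "nat \<Rightarrow> (real^'b) set" where W: "\<And>n. good (W n)" "flat_tube J \<epsilon> \<subseteq> (\<Union>n. W n)"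
    using countable_subcover_sequence[of "{W. good W}" "\<lambda>W. W" "flat_tube J \<epsilon>"] unfolding good_def by auto
  have piece: "F ` B \<in> sets borel \<and> emeasure (riemannian_volume A g) (F ` B) = emeasure lborel B"
    if B: "B \<in> sets borel" "B \<subseteq> V" and V: "good V" for B V
  proof -
    obtain c where c: "c \<in> A" "F ` V \<subseteq> fst c"
      "C1_diffeo V ((snd c \<circ> F) ` V) (snd c \<circ> F) (inv_into V (snd c \<circ> F))"
      "\<And>z. z \<in> V \<Longrightarrow> \<bar>det (jacobian (snd c \<circ> F) z)\<bar> * sqrt (det (g c ((snd c \<circ> F) z))) = 1"
      using V unfolding good_def by blast
    let ?f = "snd c \<circ> F"
    have hom: "homeomorphism V (?f ` V) ?f (inv_into V ?f)" "open (?f ` V)" using c(3) by (auto simp: C1_diffeo_def)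
    have fB: "?f ` B \<in> sets borel" using borel_image_homeomorphism[OF hom(1) _ B] hom(2) by auto
    have inj: "inj_on ?f V" using hom(1) by (auto simp: homeomorphism_def inj_on_def) metis
    have im: "?f ` V \<subseteq> snd c ` fst c" using c(2) by auto
    have FB: "F ` B = chart_inv c ` (?f ` B)"
      using chart_inverse[OF m c(1)] c(2) B(2) by (force simp: image_image)
    have FBs: "F ` B \<in> sets borel" unfolding FB
      by (rule borel_image_homeomorphism[OF homeomorphism_sym[THEN iffD1, OF manifold_chartD(3)[OF m c(1)]]])
        (use fB im B manifold_chartD(1)[OF m c(1)] in auto)
    have sub: "F ` B \<subseteq> fst c" using c(2) B(2) by auto
    have "emeasure (riemannian_volume A g) (F ` B) = chart_volume g c (F ` B)"
      using vol c(1) FBs sub by (auto simp: is_volume_def)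
    also have "\<dots> = (\<integral>\<^sup>+y\<in>?f ` B. ennreal (sqrt (det (g c y))) \<partial>lborel)"
      by (simp add: chart_volume_def image_image)
    also have "\<dots> = (\<integral>\<^sup>+x\<in>V \<inter> ?f -` (?f ` B). ennreal 1 \<partial>lborel)"
      using B(2) c(4) by (intro nn_integral_isometric_diffeo[OF m c(1,3) im fB]) (blast, simp)
    also have "V \<inter> ?f -` (?f ` B) = B" using inj B(2) unfolding inj_on_def by blast
    also have "(\<integral>\<^sup>+x\<in>B. ennreal 1 \<partial>lborel) = emeasure lborel B" using B(1) by simp
    finally show ?thesis using FBs by simp
  qed
  define D where "D = (\<lambda>n. Q \<inter> disjointed W n)"
  have Db: "D n \<in> sets borel" for n
  proof -
    have "open (W n)" for n using W(1)[of n, unfolded good_def, THEN conjunct1] .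
    then have "range W \<subseteq> sets borel" by (auto intro: borel_open)
    from sets.range_disjointed_sets[OF this] have "disjointed W n \<in> sets borel" by blast
    then show ?thesis using Q(1) unfolding D_def by (rule sets.Int[rotated])
  qed
  have DW: "D n \<subseteq> W n" for n using disjointed_subset[of W n] by (auto simp: D_def)
  have Dd: "disjoint_family D"
    unfolding D_def by (rule disjoint_family_on_bisimulation[OF disjoint_family_disjointed[of W]]) auto
  have DQ: "(\<Union>n. D n) = Q"
  proof -
    have "(\<Union>n. D n) = Q \<inter> (\<Union>n. disjointed W n)" unfolding D_def by (rule Int_UN_distrib[symmetric])
    also have "(\<Union>n. disjointed W n) = (\<Union>n. W n)" by (rule UN_disjointed_eq)
    also have "Q \<inter> (\<Union>n. W n) = Q"
      by (rule Int_absorb2) (rule order_trans[OF Q(2) order_trans[OF torus_cell_subset W(2)]])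
    finally show ?thesis .
  qed
  have inj: "inj_on F Q" using inj_on_subset[OF embedding_inj_on_cell(1)[OF e] Q(2)] .
  have FQ: "F ` Q = (\<Union>n. F ` D n)" unfolding DQ[symmetric] by (rule image_UN)
  have FD: "disjoint_family (\<lambda>n. F ` D n)"
    unfolding disjoint_family_on_def
  proof (intro ballI impI)
    fix i k :: nat assume "i \<noteq> k"
    then have "D i \<inter> D k = {}" using Dd by (auto simp: disjoint_family_on_def)
    moreover have "F ` (D i \<inter> D k) = F ` D i \<inter> F ` D k"
      by (rule inj_on_image_Int[OF inj]) (auto simp: D_def)
    ultimately show "F ` D i \<inter> F ` D k = {}" by simp
  qed
  have ps: "F ` D n \<in> sets borel" "emeasure (riemannian_volume A g) (F ` D n) = emeasure lborel (D n)" for n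
    using piece[OF Db DW W(1)] by auto
  have "emeasure (riemannian_volume A g) (F ` Q) = (\<Sum>n. emeasure (riemannian_volume A g) (F ` D n))"
    unfolding FQ by (rule suminf_emeasure[symmetric, OF _ FD]) (use ps vol in \<open>auto simp: is_volume_def\<close>)
  also have "\<dots> = (\<Sum>n. emeasure lborel (D n))" using ps by simp
  also have "\<dots> = emeasure lborel Q" unfolding DQ[symmetric] by (rule suminf_emeasure) (use Db Dd in auto)
  finally show ?thesis using ps(1) unfolding FQ by auto
qed

text \<open>All norms on the manifold are computed through this formula. It also turns statements
  almost everywhere on the tube into statements about integrals on the manifold, without taking
  images of null sets.\<close>
lemma embedding_nn_integral:
  fixes k :: "'m::{t2_space,second_countable_topology} \<Rightarrow> ennreal"
  assumes m: "riemannian_manifold A g" and e: "flat_product_embedding A g J \<epsilon> F"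
    and k[measurable]: "k \<in> borel_measurable borel" and k0: "\<And>p. p \<notin> F ` flat_tube J \<epsilon> \<Longrightarrow> k p = 0"
  shows "(\<integral>\<^sup>+p. k p \<partial>riemannian_volume A g) = (\<integral>\<^sup>+x\<in>torus_cell J \<epsilon>. k (F x) \<partial>lborel)"
proof -
  let ?\<mu> = "riemannian_volume A g" and ?Q = "torus_cell J \<epsilon>" and ?T = "F ` flat_tube J \<epsilon>"
  let ?F = "\<lambda>x. if x \<in> flat_tube J \<epsilon> then F x else F 0"
  have [measurable_cong]: "sets ?\<mu> = sets borel" using riemannian_volume_is_volume[OF m] by (simp add: is_volume_def)
  have [measurable]: "?Q \<in> sets borel" by (rule torus_cell_borel)
  have F[measurable]: "?F \<in> borel_measurable borel"
    by (intro borel_measurable_continuous_on_if embedding_continuous_open[OF m e] borel_open open_flat_tube continuous_on_const)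
  have [measurable]: "?T \<in> sets borel" by (intro borel_open embedding_continuous_open(2)[OF m e])
  have FT: "F ` ?Q = ?T" using embedding_inj_on_cell(2)[OF e] .
  have eq: "distr (density lborel (indicator ?Q)) borel ?F = density ?\<mu> (indicator ?T)"
  proof (rule measure_eqI)
    fix B assume "B \<in> sets (distr (density lborel (indicator ?Q)) borel ?F)"
    then have B[measurable]: "B \<in> sets borel" by simp
    let ?E = "?Q \<inter> ?F -` B"
    have E: "?E \<in> sets borel" using measurable_sets_borel[OF F B] by auto
    have "emeasure (distr (density lborel (indicator ?Q)) borel ?F) B = emeasure lborel ?E"
    proof -
      have FB: "?F -` B \<in> sets borel" using measurable_sets_borel[OF F B] .
      have "emeasure (distr (density lborel (indicator ?Q)) borel ?F) B = emeasure (density lborel (indicator ?Q)) (?F -` B)"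
        by (subst emeasure_distr) auto
      also have "\<dots> = (\<integral>\<^sup>+x. indicator ?Q x * indicator (?F -` B) x \<partial>lborel)"
        using FB by (subst emeasure_density) auto
      also have "\<dots> = (\<integral>\<^sup>+x. indicator ?E x \<partial>lborel)"
        by (intro nn_integral_cong) (auto simp: indicator_def)
      also have "\<dots> = emeasure lborel ?E" by (rule nn_integral_indicator) (simp add: E)
      finally show ?thesis .
    qed
    also have "\<dots> = emeasure ?\<mu> (F ` ?E)" using embedding_emeasure[OF m e E] by simp
    also have "F ` ?E = ?T \<inter> B"
    proof -
      have "F ` ?E = F ` ?Q \<inter> B" using torus_cell_subset[of J \<epsilon>] by auto
      then show ?thesis by (simp add: FT)
    qed
    also have "emeasure ?\<mu> (?T \<inter> B) = emeasure (density ?\<mu> (indicator ?T)) B"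
      by (subst emeasure_density) (auto simp: indicator_inter_arith[symmetric])
    finally show "emeasure (distr (density lborel (indicator ?Q)) borel ?F) B = emeasure (density ?\<mu> (indicator ?T)) B" .
  qed (simp add: riemannian_volume_is_volume[OF m, unfolded is_volume_def])
  have "(\<integral>\<^sup>+p. k p \<partial>?\<mu>) = (\<integral>\<^sup>+p. indicator ?T p * k p \<partial>?\<mu>)"
    using k0 by (intro nn_integral_cong) (auto simp: indicator_def)
  also have "\<dots> = (\<integral>\<^sup>+p. k p \<partial>density ?\<mu> (indicator ?T))"
    by (subst nn_integral_density) auto
  also have "\<dots> = (\<integral>\<^sup>+x. indicator ?Q x * k (?F x) \<partial>lborel)"
    by (subst eq[symmetric], subst nn_integral_distr) (auto simp: nn_integral_density)
  also have "\<dots> = (\<integral>\<^sup>+x\<in>?Q. k (F x) \<partial>lborel)"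
    using torus_cell_subset[of J \<epsilon>] by (intro nn_integral_cong) (auto simp: indicator_def)
  finally show ?thesis .
qed

section \<open>The Laplace-Beltrami operator in flat coordinates\<close>

lemma vec_axis_expansion: "(w :: real^'n::finite) = (\<Sum>i\<in>UNIV. (w $ i) *\<^sub>R axis i 1)"
  by (simp add: vec_eq_iff axis_def if_distrib[of "\<lambda>a. _ * a"] sum.delta' cong: if_cong)

lemma partial_deriv_compose:
  fixes f :: "real^'n::finite \<Rightarrow> 'b::real_normed_vector"
  assumes f: "(f has_derivative frechet_derivative f (at (\<psi> x))) (at (\<psi> x))"
    and \<psi>: "(\<psi> has_derivative frechet_derivative \<psi> (at x)) (at x)"
    and k: "(k has_derivative k') (at x)" "\<And>z. z \<in> W \<Longrightarrow> k z = f (\<psi> z)" "open W" "x \<in> W"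
  shows "partial_deriv l k x = (\<Sum>i\<in>UNIV. (jacobian \<psi> x $ i $ l) *\<^sub>R partial_deriv i f (\<psi> x))"
proof -
  have "((\<lambda>x. f (\<psi> x)) has_derivative (\<lambda>h. frechet_derivative f (at (\<psi> x)) (frechet_derivative \<psi> (at x) h))) (at x)"
    using has_derivative_compose[OF \<psi> f] .
  then have "(k has_derivative (\<lambda>h. frechet_derivative f (at (\<psi> x)) (frechet_derivative \<psi> (at x) h))) (at x)"
    by (rule has_derivative_transform_within_open[OF _ k(3,4)]) (simp add: k(2))
  from frechet_derivative_at[OF this, symmetric]
  have "partial_deriv l k x = frechet_derivative f (at (\<psi> x)) (frechet_derivative \<psi> (at x) (axis l 1))"
    by (simp add: partial_deriv_def)
  also have "frechet_derivative \<psi> (at x) (axis l 1) = (\<Sum>i\<in>UNIV. (jacobian \<psi> x $ i $ l) *\<^sub>R axis i 1)"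
    by (subst vec_axis_expansion) (simp add: jacobian_def matrix_def)
  also have "frechet_derivative f (at (\<psi> x)) \<dots> = (\<Sum>i\<in>UNIV. (jacobian \<psi> x $ i $ l) *\<^sub>R partial_deriv i f (\<psi> x))"
    using has_derivative_linear[OF f] by (simp add: linear_sum linear_scale partial_deriv_def)
  finally show ?thesis .
qed

lemma matrix_inv_unique:
  fixes M :: "real^'n::finite^'n"
  assumes "M ** B = mat 1"
  shows "matrix_inv M = B"
proof -
  have BM: "B ** M = mat 1" using assms matrix_left_right_inverse by blast
  have "M ** matrix_inv M = mat 1 \<and> matrix_inv M ** M = mat 1"
    unfolding matrix_inv_def by (rule someI[of _ B]) (use assms BM in simp)
  then have "matrix_inv M = (B ** M) ** matrix_inv M" by (simp add: BM)
  also have "\<dots> = B ** (M ** matrix_inv M)" by (simp add: matrix_mul_assoc)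
  finally show ?thesis using \<open>M ** matrix_inv M = mat 1 \<and> _\<close> by simp
qed

text \<open>From \<open>D\<^sup>T G D = 1\<close> one gets \<open>G\<^sup>-\<^sup>1 = D
  D\<^sup>T\<close>: this is what turns the gradient pairing of the metric into the Euclidean
  one.\<close>
lemma inverse_of_flattened_metric:
  fixes G D :: "real^'n::finite^'n"
  assumes "transpose D ** G ** D = mat 1"
  shows "matrix_inv G $ i $ j = (\<Sum>l\<in>UNIV. D $ i $ l * D $ j $ l)"
proof -
  have "transpose D ** (G ** D) = mat 1" using assms by (simp add: matrix_mul_assoc)
  then have "(G ** D) ** transpose D = mat 1" using matrix_left_right_inverse by blast
  then have "G ** (D ** transpose D) = mat 1" by (simp add: matrix_mul_assoc)
  then have "matrix_inv G = D ** transpose D" by (rule matrix_inv_unique)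
  then show ?thesis by (simp add: matrix_matrix_mult_def transpose_def)
qed

lemma C1_partial_continuous:
  "open V \<Longrightarrow> Ck_on 1 V f \<Longrightarrow> continuous_on V (partial_deriv i f)"
  using Ck_on_partial_deriv[of V 0 f i] by simp

text \<open>Test functions may be pulled back along \<open>\<psi>\<close>, since the support of
  the pullback is the compact set \<open>\<theta> ` K\<close> inside \<open>W\<close>.\<close>
lemma test_function_pullback:
  fixes \<eta> :: "real^'n::finite \<Rightarrow> real"
  assumes d: "C1_diffeo W N \<psi> \<theta>"
    and \<eta>: "Ck_on 1 UNIV \<eta>" and K: "compact K" "K \<subseteq> N" "\<And>y. y \<notin> K \<Longrightarrow> \<eta> y = 0"
  shows "Ck_on 1 UNIV (\<lambda>x. if x \<in> W then \<eta> (\<psi> x) else 0)" "compact (\<theta> ` K)" "\<theta> ` K \<subseteq> W"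
    "\<And>x. x \<notin> \<theta> ` K \<Longrightarrow> (if x \<in> W then \<eta> (\<psi> x) else 0) = 0"
proof -
  let ?p = "\<lambda>x. if x \<in> W then \<eta> (\<psi> x) else 0"
  have W: "open W" and hom: "homeomorphism W N \<psi> \<theta>" and \<psi>: "Ck_on 1 W \<psi>"
    using d by (auto simp: C1_diffeo_def)
  show c: "compact (\<theta> ` K)"
    using hom K(1,2) by (intro compact_continuous_image) (auto simp: homeomorphism_def intro: continuous_on_subset)
  show s: "\<theta> ` K \<subseteq> W" using hom K(2) by (auto simp: homeomorphism_def)
  show z: "?p x = 0" if "x \<notin> \<theta> ` K" for x
  proof (cases "x \<in> W")
    case True
    then have "\<psi> x \<notin> K" using that hom by (auto simp: homeomorphism_def image_iff) 
    then show ?thesis using K(3) by simp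
  qed simp
  show "Ck_on 1 UNIV ?p"
  proof (rule Ck_on_local)
    fix x
    show "\<exists>T. open T \<and> x \<in> T \<and> Ck_on 1 T ?p"
    proof (cases "x \<in> W")
      case True
      have "Ck_on 1 W (\<lambda>x. \<eta> (\<psi> x))" by (rule Ck_on_compose[OF \<eta> \<psi>]) simp
      then have "Ck_on 1 W ?p" by (rule Ck_on_cong[OF W, rotated]) simp
      then show ?thesis using True W by blast
    next
      case False
      have "open (- \<theta> ` K)" using c compact_imp_closed by blast
      moreover have "Ck_on 1 (- \<theta> ` K) ?p"
        by (rule Ck_on_cong[OF calculation _ Ck_on_const[of _ _ 0]]) (use z in auto)
      ultimately show ?thesis using False s by (intro exI[of _ "- \<theta> ` K"]) auto
    qed
  qed
qed

lemma integrable_test_product: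
  fixes k :: "'a::euclidean_space \<Rightarrow> 'b::euclidean_space"
  assumes "compact K" "K \<subseteq> V" "continuous_on V k" "continuous_on V e" "\<And>x. x \<notin> K \<Longrightarrow> e x = 0"
  shows "integrable lborel (\<lambda>x. indicator V x *\<^sub>R (e x *\<^sub>R k x))"
proof -
  have "continuous_on K (\<lambda>x. e x *\<^sub>R k x)"
    using assms by (intro continuous_intros) (auto intro: continuous_on_subset)
  from borel_integrable_compact[OF assms(1) this]
  have "integrable lborel (\<lambda>x. indicator K x *\<^sub>R (e x *\<^sub>R k x))" by simp
  also have "(\<lambda>x. indicator K x *\<^sub>R (e x *\<^sub>R k x)) = (\<lambda>x. indicator V x *\<^sub>R (e x *\<^sub>R k x))"
    using assms(2,5) by (auto simp: indicator_def fun_eq_iff)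
  finally show ?thesis .
qed

text \<open>Here \<open>y = \<psi> x\<close> are the coordinates of a chart and \<open>x\<close>
  flat ones. Tested against \<open>\<eta>\<close>, the divergence of the flux becomes minus the
  integral of \<open>\<nabla>\<eta> \<bullet> flux\<close>. By the chain rule and
  \<open>G\<^sup>-\<^sup>1 = D D\<^sup>T\<close> this integrand, multiplied by the Jacobian, is
  \<open>\<nabla>(\<eta> \<circ> \<psi>) \<bullet> \<nabla>v\<close> in flat coordinates. A second
  integration by parts moves the derivative back to \<open>v\<close>. No second derivative of
  \<open>\<psi>\<close> and no derivative of a determinant occurs.\<close>
lemma laplace_beltrami_in_flat_coordinates:
  fixes u v :: "real^'n::finite \<Rightarrow> 'b::euclidean_space" and G :: "real^'n \<Rightarrow> real^'n^'n"
  assumes d: "C1_diffeo W N \<psi> \<theta>"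
    and iso: "\<And>x. x \<in> W \<Longrightarrow> transpose (jacobian \<psi> x) ** G (\<psi> x) ** jacobian \<psi> x = mat 1"
    and vol: "\<And>x. x \<in> W \<Longrightarrow> \<bar>det (jacobian \<psi> x)\<bar> * sqrt (det (G (\<psi> x))) = 1"
    and s: "continuous_on N (\<lambda>y. sqrt (det (G y)))"
    and u: "Ck_on 1 N u" and v: "Ck_on 2 W v" and uv: "\<And>x. x \<in> W \<Longrightarrow> v x = u (\<psi> x)"
    and flux: "\<And>i. Ck_on 1 N (flux i)"
      "\<And>i y. y \<in> N \<Longrightarrow> flux i y = (\<Sum>j\<in>UNIV. (sqrt (det (G y)) * matrix_inv (G y) $ i $ j) *\<^sub>R partial_deriv j u y)"
    and y: "y \<in> N"
  shows "(\<Sum>i\<in>UNIV. partial_deriv i (flux i) y) =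
    sqrt (det (G y)) *\<^sub>R (\<Sum>l\<in>UNIV. partial_deriv l (partial_deriv l v) (\<theta> y))"
proof -
  let ?vv = "\<lambda>l. partial_deriv l (partial_deriv l v)"
  let ?div = "\<lambda>y. \<Sum>i\<in>UNIV. partial_deriv i (flux i) y"
  have W: "open W" "open N" and hom: "homeomorphism W N \<psi> \<theta>" and \<psi>: "Ck_on 1 W \<psi>"
    using d by (auto simp: C1_diffeo_def)
  have \<psi>W: "\<psi> x \<in> N" "\<theta> (\<psi> x) = x" if "x \<in> W" for x using hom that by (auto simp: homeomorphism_def)
  have v1: "Ck_on 1 W v" using Ck_on_mono[OF v, of 1] by simp
  have pv: "Ck_on 1 W (partial_deriv l v)" for l
    using Ck_on_partial_deriv[OF W(1), of 1 v l] v by (simp add: numeral_2_eq_2)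
  have cpp: "continuous_on W (?vv l)" for l
    by (rule C1_partial_continuous[OF W(1) pv])
  let ?L = "\<lambda>x. \<Sum>l\<in>UNIV. ?vv l x"
  let ?S = "\<lambda>y. sqrt (det (G y))"
  have cL: "continuous_on W ?L" by (intro continuous_intros cpp)
  have cth: "continuous_on N \<theta>" "\<theta> ` N = W" using hom by (auto simp: homeomorphism_def)
  have cLt: "continuous_on N (\<lambda>y. ?L (\<theta> y))"
    by (rule continuous_on_compose2[OF cL cth(1)]) (simp add: cth(2))
  have cdiv: "continuous_on N (\<lambda>y. \<Sum>i\<in>UNIV. partial_deriv i (flux i) y)"
    by (intro continuous_intros C1_partial_continuous W flux)
  have "?div y - ?S y *\<^sub>R ?L (\<theta> y) = 0"
  proof (rule fundamental_lemma_calculus_of_variations[OF W(2) _ _ y])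
    show "continuous_on N (\<lambda>y. ?div y - ?S y *\<^sub>R ?L (\<theta> y))"
      by (intro continuous_on_diff continuous_on_scaleR cdiv s cLt)
    fix \<eta> :: "real^'n \<Rightarrow> real" and K
    assume \<eta>: "Ck_on 1 UNIV \<eta>" and K: "compact K" "K \<subseteq> N" "\<And>x. x \<notin> K \<Longrightarrow> \<eta> x = 0"
    let ?p = "\<lambda>x. if x \<in> W then \<eta> (\<psi> x) else 0"
    have tp: "Ck_on 1 UNIV ?p" "compact (\<theta> ` K)" "\<theta> ` K \<subseteq> W"
      by (rule test_function_pullback[OF d \<eta> K(1,2)]; rule K(3), assumption)+
    have tp4: "?p x = 0" if "x \<notin> \<theta> ` K" for x
      by (rule test_function_pullback(4)[OF d \<eta> K(1,2) _ that]) (rule K(3))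
    have c\<eta>: "continuous_on N \<eta>" using Ck_on_imp_continuous_on[OF \<eta>] by (rule continuous_on_subset) (rule subset_UNIV)
    have cp: "continuous_on W ?p" using Ck_on_imp_continuous_on[OF tp(1)] by (rule continuous_on_subset) (rule subset_UNIV)
    have cd\<eta>: "continuous_on N (partial_deriv i \<eta>)" for i
      using C1_partial_continuous[OF open_UNIV \<eta>] by (rule continuous_on_subset) (rule subset_UNIV)
    have cdp: "continuous_on W (partial_deriv i ?p)" for i
      using C1_partial_continuous[OF open_UNIV tp(1)] by (rule continuous_on_subset) (rule subset_UNIV)
    have d\<eta>0: "partial_deriv i \<eta> x = 0" if "x \<notin> K" for i x
      unfolding partial_deriv_def
      by (rule frechet_derivative_eq_0_outside[OF compact_imp_closed[OF K(1)] K(3) that])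
    have dp0: "partial_deriv i ?p x = 0" if "x \<notin> \<theta> ` K" for i x
      unfolding partial_deriv_def
      by (rule frechet_derivative_eq_0_outside[OF compact_imp_closed[OF tp(2)] tp4 that])
    have int1: "integrable lborel (\<lambda>y. indicator N y *\<^sub>R (\<eta> y *\<^sub>R partial_deriv i (flux i) y))" for i
      by (rule integrable_test_product[OF K(1,2) C1_partial_continuous[OF W(2) flux(1)] c\<eta> K(3)])
    have int2: "integrable lborel (\<lambda>y. indicator N y *\<^sub>R (partial_deriv i \<eta> y *\<^sub>R flux i y))" for i
      by (rule integrable_test_product[OF K(1,2) Ck_on_imp_continuous_on[OF flux(1)] cd\<eta> d\<eta>0])
    have int3: "integrable lborel (\<lambda>x. indicator W x *\<^sub>R (partial_deriv l ?p x *\<^sub>R partial_deriv l v x))" for l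
      by (rule integrable_test_product[OF tp(2,3) Ck_on_imp_continuous_on[OF pv] cdp dp0])
    have int4: "integrable lborel (\<lambda>x. indicator W x *\<^sub>R (?p x *\<^sub>R ?vv l x))" for l
      by (rule integrable_test_product[OF tp(2,3) cpp cp tp4])
    let ?B = "\<lambda>y. \<Sum>i\<in>UNIV. partial_deriv i \<eta> y *\<^sub>R flux i y"
    let ?C = "\<lambda>x. \<Sum>l\<in>UNIV. partial_deriv l ?p x *\<^sub>R partial_deriv l v x"
    \<comment> \<open>The pointwise identity of the two gradient pairings, including the Jacobian.\<close>
    have point: "\<bar>det (jacobian \<psi> x)\<bar> *\<^sub>R ?B (\<psi> x) = ?C x" if x: "x \<in> W" for x
    proof -
      let ?D = "jacobian \<psi> x" and ?a = "\<lambda>i. partial_deriv i \<eta> (\<psi> x)" and ?z = "\<lambda>j. partial_deriv j u (\<psi> x)"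
      note psid = C1_on_has_derivative[OF W(1) \<psi> x]
      have dp: "partial_deriv l ?p x = (\<Sum>i\<in>UNIV. (?D $ i $ l) * ?a i)" for l
        using partial_deriv_compose[OF C1_on_has_derivative[OF open_UNIV \<eta> UNIV_I] psid
          C1_on_has_derivative[OF open_UNIV tp(1) UNIV_I] _ W(1) x] by simp
      have dv: "partial_deriv l v x = (\<Sum>j\<in>UNIV. (?D $ j $ l) *\<^sub>R ?z j)" for l
        by (rule partial_deriv_compose[OF C1_on_has_derivative[OF W(2) u \<psi>W(1)[OF x]] psid
          C1_on_has_derivative[OF W(1) v1 x] uv W(1) x])
      have "\<bar>det ?D\<bar> *\<^sub>R ?B (\<psi> x) = (\<Sum>i\<in>UNIV. \<Sum>j\<in>UNIV. \<Sum>l\<in>UNIV. (?a i * ?D $ i $ l * ?D $ j $ l) *\<^sub>R ?z j)"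
      proof -
        have "\<bar>det ?D\<bar> *\<^sub>R ?B (\<psi> x) = (\<Sum>i\<in>UNIV. \<Sum>j\<in>UNIV.
            ((\<bar>det ?D\<bar> * ?S (\<psi> x)) * (?a i * matrix_inv (G (\<psi> x)) $ i $ j)) *\<^sub>R ?z j)"
          by (simp add: flux(2)[OF \<psi>W(1)[OF x]] scaleR_sum_right mult_ac)
        also have "\<dots> = (\<Sum>i\<in>UNIV. \<Sum>j\<in>UNIV. \<Sum>l\<in>UNIV. (?a i * ?D $ i $ l * ?D $ j $ l) *\<^sub>R ?z j)"
          unfolding vol[OF x] inverse_of_flattened_metric[OF iso[OF x]]
          by (simp add: sum_distrib_left scaleR_sum_left mult_ac)
        finally show ?thesis .
      qed
      also have "\<dots> = (\<Sum>l\<in>UNIV. \<Sum>i\<in>UNIV. \<Sum>j\<in>UNIV. (?a i * ?D $ i $ l * ?D $ j $ l) *\<^sub>R ?z j)"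
      proof -
        have "(\<Sum>i\<in>UNIV. \<Sum>j\<in>UNIV. \<Sum>l\<in>UNIV. (?a i * ?D $ i $ l * ?D $ j $ l) *\<^sub>R ?z j) =
           (\<Sum>i\<in>UNIV. \<Sum>l\<in>UNIV. \<Sum>j\<in>UNIV. (?a i * ?D $ i $ l * ?D $ j $ l) *\<^sub>R ?z j)"
          by (rule sum.cong[OF refl], rule sum.swap)
        also have "\<dots> = (\<Sum>l\<in>UNIV. \<Sum>i\<in>UNIV. \<Sum>j\<in>UNIV. (?a i * ?D $ i $ l * ?D $ j $ l) *\<^sub>R ?z j)"
          by (rule sum.swap)
        finally show ?thesis .
      qed
      also have "\<dots> = ?C x"
        unfolding dp dv scaleR_sum_left by (simp add: scaleR_sum_right mult_ac)
      finally show ?thesis .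
    qed
    have Lint: "(LINT y:N|lborel. \<eta> y *\<^sub>R (?S y *\<^sub>R ?L (\<theta> y))) = (\<Sum>l\<in>UNIV. LINT x:W|lborel. ?p x *\<^sub>R ?vv l x)"
    proof -
      let ?k = "\<lambda>y. indicator N y *\<^sub>R (\<eta> y *\<^sub>R (?S y *\<^sub>R ?L (\<theta> y)))"
      have km: "?k \<in> borel_measurable borel"
        using W(2) by (intro borel_measurable_continuous_on_indicator continuous_on_scaleR c\<eta> s cLt) auto
      have "(LINT y:N|lborel. \<eta> y *\<^sub>R (?S y *\<^sub>R ?L (\<theta> y))) = (LINT y|lborel. indicator N y *\<^sub>R ?k y)"
        unfolding set_lebesgue_integral_def by (intro Bochner_Integration.integral_cong) (auto simp: indicator_def)
      also have "\<dots> = (LINT x|lborel. (indicator W x * \<bar>det (jacobian \<psi> x)\<bar>) *\<^sub>R ?k (\<psi> x))"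
        by (rule integral_C1_diffeo[OF d km])
      also have "\<dots> = (LINT x|lborel. (\<Sum>l\<in>UNIV. indicator W x *\<^sub>R (?p x *\<^sub>R ?vv l x)))"
      proof (rule Bochner_Integration.integral_cong[OF refl])
        fix x
        show "(indicator W x * \<bar>det (jacobian \<psi> x)\<bar>) *\<^sub>R ?k (\<psi> x) =
          (\<Sum>l\<in>UNIV. indicator W x *\<^sub>R (?p x *\<^sub>R ?vv l x))"
        proof (cases "x \<in> W")
          case True
          have "\<bar>det (jacobian \<psi> x)\<bar> *\<^sub>R (\<eta> (\<psi> x) *\<^sub>R (?S (\<psi> x) *\<^sub>R ?L x)) = (\<bar>det (jacobian \<psi> x)\<bar> * ?S (\<psi> x)) *\<^sub>R (\<eta> (\<psi> x) *\<^sub>R ?L x)"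
            by (simp add: mult_ac)
          also have "\<dots> = \<eta> (\<psi> x) *\<^sub>R ?L x" using vol[OF True] by simp
          finally show ?thesis using True \<psi>W[OF True] by (simp add: scaleR_sum_right)
        qed simp
      qed
      also have "\<dots> = (\<Sum>l\<in>UNIV. LINT x:W|lborel. ?p x *\<^sub>R ?vv l x)"
        unfolding set_lebesgue_integral_def by (rule Bochner_Integration.integral_sum) (rule int4)
      finally show ?thesis .
    qed
    have div: "(LINT y:N|lborel. \<eta> y *\<^sub>R ?div y) = - (LINT y:N|lborel. ?B y)"
    proof -
      have "(LINT y:N|lborel. \<eta> y *\<^sub>R ?div y) =
        (\<Sum>i\<in>UNIV. LINT y:N|lborel. \<eta> y *\<^sub>R partial_deriv i (flux i) y)"
        unfolding set_lebesgue_integral_def scaleR_sum_right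
        by (rule Bochner_Integration.integral_sum) (rule int1)
      also have "\<dots> = (\<Sum>i\<in>UNIV. - (LINT y:N|lborel. partial_deriv i \<eta> y *\<^sub>R flux i y))"
        using integration_by_parts_C1[OF W(2) flux(1) \<eta> K] by (simp add: partial_deriv_def)
      also have "\<dots> = - (LINT y:N|lborel. ?B y)"
        unfolding set_lebesgue_integral_def scaleR_sum_right
        by (subst Bochner_Integration.integral_sum) (use int2 in \<open>auto simp: sum_negf\<close>)
      finally show ?thesis .
    qed
    have mid: "(LINT y:N|lborel. ?B y) = - (\<Sum>l\<in>UNIV. LINT x:W|lborel. ?p x *\<^sub>R ?vv l x)"
    proof -
      let ?k = "\<lambda>y. indicator N y *\<^sub>R ?B y"
      have km: "?k \<in> borel_measurable borel"
        using W(2) by (intro borel_measurable_continuous_on_indicator continuous_on_sum continuous_on_scaleR cd\<eta> Ck_on_imp_continuous_on[OF flux(1)]) auto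
      have "(LINT y:N|lborel. ?B y) = (LINT y|lborel. indicator N y *\<^sub>R ?k y)"
        unfolding set_lebesgue_integral_def by (intro Bochner_Integration.integral_cong) (auto simp: indicator_def)
      also have "\<dots> = (LINT x|lborel. (indicator W x * \<bar>det (jacobian \<psi> x)\<bar>) *\<^sub>R ?k (\<psi> x))"
        by (rule integral_C1_diffeo[OF d km])
      also have "\<dots> = (LINT x|lborel. (\<Sum>l\<in>UNIV. indicator W x *\<^sub>R (partial_deriv l ?p x *\<^sub>R partial_deriv l v x)))"
      proof (rule Bochner_Integration.integral_cong[OF refl])
        fix x
        show "(indicator W x * \<bar>det (jacobian \<psi> x)\<bar>) *\<^sub>R ?k (\<psi> x) =
          (\<Sum>l\<in>UNIV. indicator W x *\<^sub>R (partial_deriv l ?p x *\<^sub>R partial_deriv l v x))"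
          using point[of x] \<psi>W[of x] by (cases "x \<in> W") simp_all
      qed
      also have "\<dots> = (\<Sum>l\<in>UNIV. LINT x:W|lborel. partial_deriv l ?p x *\<^sub>R partial_deriv l v x)"
        unfolding set_lebesgue_integral_def by (rule Bochner_Integration.integral_sum) (rule int3)
      also have "\<dots> = - (\<Sum>l\<in>UNIV. LINT x:W|lborel. ?p x *\<^sub>R ?vv l x)"
        using integration_by_parts_C1[OF W(1) pv tp(1,2,3) tp4] by (simp add: partial_deriv_def sum_negf)
      finally show ?thesis .
    qed
    have "integrable lborel (\<lambda>y. indicator N y *\<^sub>R (\<eta> y *\<^sub>R ?div y))"
      "integrable lborel (\<lambda>y. indicator N y *\<^sub>R (\<eta> y *\<^sub>R (?S y *\<^sub>R ?L (\<theta> y))))"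
      by (rule integrable_test_product[OF K(1,2) _ c\<eta> K(3)], intro cdiv continuous_on_scaleR s cLt, assumption)+
    then show "(LINT y:N|lborel. \<eta> y *\<^sub>R (?div y - ?S y *\<^sub>R ?L (\<theta> y))) = 0"
      using div mid Lint by (simp add: set_lebesgue_integral_def scaleR_diff_right)
  qed
  then show ?thesis by simp
qed

section \<open>Transplanting functions from the tube to the manifold\<close>

definition torus_periodic :: "'n::finite set \<Rightarrow> (real^'n \<Rightarrow> 'b) \<Rightarrow> bool" where
  "torus_periodic J w \<longleftrightarrow> (\<forall>x y. torus_cong J x y \<longrightarrow> w x = w y)"

definition slab :: "'n::finite set \<Rightarrow> real \<Rightarrow> (real^'n) set" where
  "slab J h = {x. \<forall>i\<in>- J. \<bar>x $ i\<bar> \<le> h}"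

text \<open>The part of the slab over one closed period; it is compact, and its image is the image
  of the whole slab.\<close>
definition slab_box :: "'n::finite set \<Rightarrow> real \<Rightarrow> (real^'n) set" where
  "slab_box J h = cbox (\<chi> i. if i \<in> J then 0 else - h) (\<chi> i. if i \<in> J then 2 * pi else h)"

text \<open>The extension by zero, to the manifold, of a function on the tube. The chosen preimage
  of \<open>p\<close> is determined up to periods, so it only makes sense for periodic
  \<open>w\<close>.\<close>
definition push :: "'n::finite set \<Rightarrow> real \<Rightarrow> (real^'n \<Rightarrow> 'm) \<Rightarrow> (real^'n \<Rightarrow> 'b::zero) \<Rightarrow> 'm \<Rightarrow> 'b" where
  "push J \<epsilon> F w p = (if p \<in> F ` flat_tube J \<epsilon> then w (inv_into (flat_tube J \<epsilon>) F p) else 0)"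

lemma push_apply:
  assumes e: "flat_product_embedding A g J \<epsilon> F" and w: "torus_periodic J w" and x: "x \<in> flat_tube J \<epsilon>"
  shows "push J \<epsilon> F w (F x) = w x"
proof -
  have i: "F x \<in> F ` flat_tube J \<epsilon>" using x by simp
  have "F (inv_into (flat_tube J \<epsilon>) F (F x)) = F x" by (rule f_inv_into_f[OF i])
  then have "torus_cong J (inv_into (flat_tube J \<epsilon>) F (F x)) x"
    using embeddingD(1)[OF e inv_into_into[OF i] x] by simp
  then show ?thesis using w i by (simp add: push_def torus_periodic_def)
qed

lemma slab_box_iff: "x \<in> slab_box J h \<longleftrightarrow> x \<in> slab J h \<and> (\<forall>i\<in>J. 0 \<le> x $ i \<and> x $ i \<le> 2 * pi)"
proof -
  have "x \<in> slab_box J h \<longleftrightarrow> (\<forall>i. (if i \<in> J then 0 else - h) \<le> x $ i \<and> x $ i \<le> (if i \<in> J then 2 * pi else h))"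
    unfolding slab_box_def by (simp add: mem_box_cart)
  also have "\<dots> \<longleftrightarrow> x \<in> slab J h \<and> (\<forall>i\<in>J. 0 \<le> x $ i \<and> x $ i \<le> 2 * pi)"
    by (auto simp: slab_def abs_le_iff minus_le_iff split: if_splits)
  finally show ?thesis .
qed

lemma push_support:
  assumes e: "flat_product_embedding A g J \<epsilon> F" and w: "torus_periodic J w"
    and supp: "\<And>x. x \<notin> slab J h \<Longrightarrow> w x = 0"
    and p: "p \<notin> F ` slab_box J h"
  shows "push J \<epsilon> F w p = 0"
proof (rule ccontr)
  assume nz: "push J \<epsilon> F w p \<noteq> 0"
  then have "p \<in> F ` flat_tube J \<epsilon>" unfolding push_def by (metis (full_types))
  then obtain y where y: "y \<in> torus_cell J \<epsilon>" "p = F y"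
    using embedding_inj_on_cell(2)[OF e] by blast
  then have "w y \<noteq> 0" using push_apply[OF e w] nz torus_cell_subset[of J \<epsilon>] by (metis subsetD)
  then have "y \<in> slab J h" using supp by blast
  then have "y \<in> slab_box J h" using y(1) by (auto simp: slab_box_iff torus_cell_def less_imp_le)
  then show False using p y(2) by blast
qed

text \<open>The image is compact, hence closed as the manifold is Hausdorff. Near every point
  outside it an extension by zero vanishes.\<close>
lemma embedding_slab_closed:
  assumes m: "riemannian_manifold A g" and e: "flat_product_embedding A g J \<epsilon> F"
    and sub: "slab J h \<subseteq> flat_tube J \<epsilon>"
  shows "closed (F ` slab_box J h)"
proof -
  have s: "slab_box J h \<subseteq> flat_tube J \<epsilon>" using sub slab_box_iff by blast
  have "compact (slab_box J h)" unfolding slab_box_def by (rule compact_cbox)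
  then have "compact (F ` slab_box J h)"
    by (rule compact_continuous_image[OF continuous_on_subset[OF embedding_continuous_open(1)[OF m e] s]])
  then show ?thesis by (rule compact_imp_closed)
qed

lemma chart_open_image:
  assumes m: "riemannian_manifold A g" and c: "c \<in> A" and V: "open V" "V \<subseteq> fst c"
  shows "open (snd c ` V)"
  using homeomorphism_imp_open_map[OF manifold_chartD(3)[OF m c], of V] V
    manifold_chartD(1,2)[OF m c] by (simp add: openin_open_eq)

lemma push_in_chart:
  assumes m: "riemannian_manifold A g" and e: "flat_product_embedding A g J \<epsilon> F"
    and sub: "slab J h \<subseteq> flat_tube J \<epsilon>"
    and w: "torus_periodic J w" and supp: "\<And>x. x \<notin> slab J h \<Longrightarrow> w x = (0::'b::real_normed_vector)"
    and c: "c \<in> A"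
  shows "\<And>W z. W \<subseteq> flat_tube J \<epsilon> \<Longrightarrow> F ` W \<subseteq> fst c \<Longrightarrow> z \<in> W \<Longrightarrow>
      push J \<epsilon> F w (chart_inv c ((snd c \<circ> F) z)) = w z"
    and "\<And>y. y \<in> snd c ` (fst c - F ` slab_box J h) \<Longrightarrow> push J \<epsilon> F w (chart_inv c y) = 0"
    and "open (snd c ` (fst c - F ` slab_box J h))"
proof -
  fix W z assume z: "W \<subseteq> flat_tube J \<epsilon>" "F ` W \<subseteq> fst c" "z \<in> W"
  then have "chart_inv c ((snd c \<circ> F) z) = F z" using chart_inverse[OF m c] by auto
  then show "push J \<epsilon> F w (chart_inv c ((snd c \<circ> F) z)) = w z"
    using push_apply[OF e w] z by auto
next
  fix y assume "y \<in> snd c ` (fst c - F ` slab_box J h)"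
  then obtain p where p: "p \<in> fst c" "p \<notin> F ` slab_box J h" "y = snd c p" by blast
  then show "push J \<epsilon> F w (chart_inv c y) = 0"
    using push_support[OF e w supp p(2)] chart_inverse[OF m c p(1)] by simp
next
  show "open (snd c ` (fst c - F ` slab_box J h))"
    using manifold_chartD(1)[OF m c] embedding_slab_closed[OF m e sub]
    by (intro chart_open_image[OF m c] open_Diff) auto
qed

text \<open>At points of the image of the slab the embedding has a smooth local inverse in the
  chart, and the extension is \<open>w\<close> composed with it; at all other points it vanishes
  nearby.\<close>
lemma push_Ck:
  fixes w :: "real^'n::finite \<Rightarrow> 'b::real_normed_vector"
  assumes m: "riemannian_manifold A g" and e: "flat_product_embedding A g J \<epsilon> F"
    and sub: "slab J h \<subseteq> flat_tube J \<epsilon>"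
    and w: "torus_periodic J w" and supp: "\<And>x. x \<notin> slab J h \<Longrightarrow> w x = 0"
    and wk: "Ck_on k UNIV w" and c: "c \<in> A"
  shows "Ck_on k (snd c ` fst c) (push J \<epsilon> F w \<circ> chart_inv c)"
proof (rule Ck_on_local)
  have pic2: "push J \<epsilon> F w (chart_inv c y) = 0" if "y \<in> snd c ` (fst c - F ` slab_box J h)" for y
    by (rule push_in_chart(2)[OF m e sub w _ c that]) (rule supp)
  have pic3: "open (snd c ` (fst c - F ` slab_box J h))"
    by (rule push_in_chart(3)[OF m e sub w _ c]) (rule supp)
  fix y assume "y \<in> snd c ` fst c"
  then obtain p where p: "p \<in> fst c" "y = snd c p" by blast
  show "\<exists>T. open T \<and> y \<in> T \<and> Ck_on k T (push J \<epsilon> F w \<circ> chart_inv c)"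
  proof (cases "p \<in> F ` slab_box J h")
    case False
    let ?T = "snd c ` (fst c - F ` slab_box J h)"
    have "Ck_on k ?T (push J \<epsilon> F w \<circ> chart_inv c)"
      by (rule Ck_on_cong[OF pic3 _ Ck_on_const[of _ _ 0]]) (simp add: pic2)
    then show ?thesis using pic3 p False by blast
  next
    case True
    then obtain x where x: "x \<in> flat_tube J \<epsilon>" "p = F x" using sub slab_box_iff by blast
    have xc: "F x \<in> fst c" using x p by simp
    obtain W where W: "open W" "x \<in> W" "W \<subseteq> flat_tube J \<epsilon>" "F ` W \<subseteq> fst c"
      "C1_diffeo W ((snd c \<circ> F) ` W) (snd c \<circ> F) (inv_into W (snd c \<circ> F))"
      "smooth_on ((snd c \<circ> F) ` W) (inv_into W (snd c \<circ> F))"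
      using embedding_local_chart[OF m e c x(1) xc] by metis
    let ?N = "(snd c \<circ> F) ` W" and ?\<theta> = "inv_into W (snd c \<circ> F)"
    have N: "open ?N" using W(5) by (simp add: C1_diffeo_def)
    have "Ck_on k ?N (\<lambda>y. w (?\<theta> y))"
      by (rule Ck_on_compose[OF wk]) (use W(6) in \<open>simp_all add: smooth_on_def\<close>)
    moreover have "w (?\<theta> y) = (push J \<epsilon> F w \<circ> chart_inv c) y" if y: "y \<in> ?N" for y
    proof -
      have "?\<theta> y \<in> W" "(snd c \<circ> F) (?\<theta> y) = y" using inv_into_into[OF y] f_inv_into_f[OF y] by auto
      then show ?thesis using push_in_chart(1)[OF m e sub w supp c W(3,4), of "?\<theta> y"] by simp
    qed
    ultimately have "Ck_on k ?N (push J \<epsilon> F w \<circ> chart_inv c)"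
      by (rule Ck_on_cong[OF N, rotated]) 
    then show ?thesis using N W(2) p(2) x(2) by (intro exI[of _ ?N]) auto
  qed
qed

lemma push_borel:
  fixes w :: "real^'n::finite \<Rightarrow> 'b::real_normed_vector"
  assumes m: "riemannian_manifold A g" and e: "flat_product_embedding A g J \<epsilon> F"
    and sub: "slab J h \<subseteq> flat_tube J \<epsilon>"
    and w: "torus_periodic J w" and supp: "\<And>x. x \<notin> slab J h \<Longrightarrow> w x = 0"
    and wk: "continuous_on UNIV w"
  shows "push J \<epsilon> F w \<in> borel_measurable borel"
proof (rule borel_measurable_continuous_onI, rule continuous_at_imp_continuous_on, rule ballI)
  fix p
  obtain c where c: "c \<in> A" "p \<in> fst c" using manifold_chart_at[OF m] by blast
  note hom = manifold_chartD(3)[OF m c(1)]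
  have "Ck_on 0 UNIV w" using wk by simp
  from push_Ck[OF m e sub w supp this c(1)]
  have c1: "continuous_on (snd c ` fst c) (push J \<epsilon> F w \<circ> chart_inv c)" by simp
  have c2: "continuous_on (fst c) (snd c)" using hom by (auto simp: homeomorphism_def)
  have "continuous_on (fst c) (\<lambda>q. (push J \<epsilon> F w \<circ> chart_inv c) (snd c q))"
    by (rule continuous_on_compose2[OF c1 c2]) simp
  then have "continuous_on (fst c) (push J \<epsilon> F w)"
    by (rule continuous_on_cong[THEN iffD1, OF refl, rotated]) (simp add: chart_inverse[OF m c(1)])
  then show "isCont (push J \<epsilon> F w) p"
    using continuous_on_eq_continuous_at[OF manifold_chartD(1)[OF m c(1)]] c(2) by blast
qed

lemma partial_deriv_cong_open:
  assumes "open N" "y \<in> N" "\<And>z. z \<in> N \<Longrightarrow> f z = k z"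
  shows "partial_deriv i f y = partial_deriv i k y"
proof -
  have "(f has_derivative d) (at y) \<longleftrightarrow> (k has_derivative d) (at y)" for d
    using has_derivative_transform_within_open[of f d y UNIV N k] has_derivative_transform_within_open[of k d y UNIV N f] assms
    by auto
  then show ?thesis by (simp add: partial_deriv_def frechet_derivative_def)
qed

lemma partial_deriv_zero [simp]: "partial_deriv i (\<lambda>_. 0) x = 0"
  by (simp add: partial_deriv_def)

text \<open>Near points of the tube this is the computation in flat coordinates; away from the
  image of the slab both sides vanish identically near the point. As the functions are
  \<open>C\<^sup>2\<close>, the classical derivatives serve as the weak ones.\<close>
lemma push_has_laplacian:
  fixes v Lv :: "real^'n::finite \<Rightarrow> complex"
  assumes m: "riemannian_manifold A g" and e: "flat_product_embedding A g J \<epsilon> F"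
    and sub: "slab J h \<subseteq> flat_tube J \<epsilon>"
    and v: "torus_periodic J v" "\<And>x. x \<notin> slab J h \<Longrightarrow> v x = 0" "Ck_on 2 UNIV v"
    and Lv: "torus_periodic J Lv" "\<And>x. x \<notin> slab J h \<Longrightarrow> Lv x = 0" "continuous_on UNIV Lv"
      "\<And>x. Lv x = (\<Sum>i\<in>UNIV. partial_deriv i (partial_deriv i v) x)"
  shows "has_laplacian A g (push J \<epsilon> F v) (push J \<epsilon> F Lv)"
  unfolding has_laplacian_def case_prod_unfold prod.collapse
proof (intro conjI ballI)
  show "push J \<epsilon> F Lv \<in> borel_measurable borel" using push_borel[OF m e sub Lv(1-3)] .
  fix c assume c: "c \<in> A"
  let ?U = "snd c ` fst c" and ?i = "chart_inv c"
  let ?u = "push J \<epsilon> F v \<circ> ?i"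
  let ?G = "g c"
  define flux where "flux = (\<lambda>i x. \<Sum>j\<in>UNIV. (sqrt (det (?G x)) * matrix_inv (?G x) $ i $ j) *\<^sub>R partial_deriv j ?u x)"
  have U: "open ?U" using manifold_chartD(2)[OF m c] .
  have u2: "Ck_on 2 ?U ?u" by (rule push_Ck[OF m e sub v c])
  have u1: "Ck_on 1 ?U ?u" using Ck_on_mono[OF u2, of 1] by simp
  have pu: "Ck_on 1 ?U (partial_deriv j ?u)" for j
    using Ck_on_partial_deriv[OF U, of 1 ?u j] u2 by (simp add: numeral_2_eq_2)
  have S: "Ck_on 1 ?U (\<lambda>x. sqrt (det (?G x)))" by (rule metric_sqrt_det_C1[OF m c])
  have I: "Ck_on 1 ?U (\<lambda>x. matrix_inv (?G x) $ i $ j)" for i j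
    using metric_det_pos[OF m c] by (intro C1_on_matrix_inv[OF U] Ck_on_metric[OF m c]) force
  have flux1: "Ck_on 1 ?U (flux i)" for i
    unfolding flux_def by (intro Ck_on_sum Ck_on_scaleR Ck_on_mult S I pu)
  have eq: "sqrt (det (?G y)) *\<^sub>R push J \<epsilon> F Lv (?i y) = (\<Sum>i\<in>UNIV. partial_deriv i (flux i) y)"
    if yU: "y \<in> ?U" for y
  proof -
    obtain p where p: "p \<in> fst c" "y = snd c p" using yU by blast
    show ?thesis
    proof (cases "p \<in> F ` slab_box J h")
      case False
      let ?N = "snd c ` (fst c - F ` slab_box J h)"
      note N = push_in_chart(3)[OF m e sub v(1,2) c]
      have yN: "y \<in> ?N" using p False by blast
      have u0: "partial_deriv j ?u z = 0" if "z \<in> ?N" for j z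
        using partial_deriv_cong_open[OF N that, of ?u "\<lambda>_. 0"] push_in_chart(2)[OF m e sub v(1,2) c] by simp
      have "partial_deriv i (flux i) y = 0" for i
        using partial_deriv_cong_open[OF N yN, of "flux i" "\<lambda>_. 0"] by (simp add: flux_def u0)
      then show ?thesis using push_in_chart(2)[OF m e sub Lv(1,2) c yN] by simp
    next
      case True
      then obtain x where x: "x \<in> flat_tube J \<epsilon>" "p = F x" using sub slab_box_iff by blast
      have xc: "F x \<in> fst c" using x p by simp
      obtain W where W: "open W" "x \<in> W" "W \<subseteq> flat_tube J \<epsilon>" "F ` W \<subseteq> fst c"
        "C1_diffeo W ((snd c \<circ> F) ` W) (snd c \<circ> F) (inv_into W (snd c \<circ> F))"
        "\<And>z. z \<in> W \<Longrightarrow> \<bar>det (jacobian (snd c \<circ> F) z)\<bar> * sqrt (det (g c ((snd c \<circ> F) z))) = 1"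
        using embedding_local_chart[OF m e c x(1) xc] by metis
      let ?\<psi> = "snd c \<circ> F"
      let ?N = "?\<psi> ` W" and ?\<theta> = "inv_into W ?\<psi>"
      have N: "open ?N" using W(5) by (simp add: C1_diffeo_def)
      have NU: "?N \<subseteq> ?U" using W(4) by auto
      have yN: "y \<in> ?N" using W(2) p(2) x(2) by auto
      have thx: "?\<theta> y = x"
        using W(2,5) p(2) x(2) by (auto simp: C1_diffeo_def homeomorphism_def)
      have "(\<Sum>i\<in>UNIV. partial_deriv i (flux i) y) =
        sqrt (det (?G y)) *\<^sub>R (\<Sum>l\<in>UNIV. partial_deriv l (partial_deriv l v) (?\<theta> y))"
      proof (rule laplace_beltrami_in_flat_coordinates[OF W(5)])
        show "transpose (jacobian ?\<psi> z) ** ?G (?\<psi> z) ** jacobian ?\<psi> z = mat 1" if "z \<in> W" for z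
        proof -
          have "z \<in> flat_tube J \<epsilon>" "F z \<in> fst c" using that W(3,4) by auto
          then show ?thesis using embeddingD(3)[OF e c] by simp
        qed
        show "\<bar>det (jacobian ?\<psi> z)\<bar> * sqrt (det (?G (?\<psi> z))) = 1" if "z \<in> W" for z using W(6)[OF that] .
        show "continuous_on ?N (\<lambda>y. sqrt (det (?G y)))"
          using Ck_on_imp_continuous_on[OF S] NU by (rule continuous_on_subset)
        show "Ck_on 1 ?N ?u" using u1 NU by (rule Ck_on_subset)
        show "Ck_on 2 W v" using v(3) by (rule Ck_on_subset) simp
        show "v z = ?u (?\<psi> z)" if "z \<in> W" for z
          using push_in_chart(1)[OF m e sub v(1,2) c W(3,4) that] by simp
        show "Ck_on 1 ?N (flux i)" for i using flux1 NU by (rule Ck_on_subset)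
      qed (use yN in \<open>simp_all add: flux_def\<close>)
      also have "\<dots> = sqrt (det (?G y)) *\<^sub>R Lv x" by (simp add: thx Lv(4))
      also have "Lv x = push J \<epsilon> F Lv (?i y)"
        using push_in_chart(1)[OF m e sub Lv(1,2) c W(3,4,2)] p(2) x(2) by simp
      finally show ?thesis by simp
    qed
  qed
  show "\<exists>Du w. (\<forall>j. weak_partial ?U j ?u (Du j)) \<and>
      (\<forall>i. weak_partial ?U i (\<lambda>x. \<Sum>j\<in>UNIV. (sqrt (det (?G x)) * matrix_inv (?G x) $ i $ j) *\<^sub>R Du j x) (w i)) \<and>
      (AE x in lborel. x \<in> ?U \<longrightarrow> sqrt (det (?G x)) *\<^sub>R push J \<epsilon> F Lv (?i x) = (\<Sum>i\<in>UNIV. w i x))"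
  proof (intro exI conjI allI)
    show "weak_partial ?U j ?u (partial_deriv j ?u)" for j by (rule weak_partial_C1[OF U u1])
    show "weak_partial ?U i (\<lambda>x. \<Sum>j\<in>UNIV. (sqrt (det (?G x)) * matrix_inv (?G x) $ i $ j) *\<^sub>R partial_deriv j ?u x)
       (partial_deriv i (flux i))" for i
      using weak_partial_C1[OF U flux1[of i], of i] by (simp add: flux_def)
    show "AE x in lborel. x \<in> ?U \<longrightarrow> sqrt (det (?G x)) *\<^sub>R push J \<epsilon> F Lv (?i x) = (\<Sum>i\<in>UNIV. partial_deriv i (flux i) x)"
      using eq by (intro AE_I2) simp
  qed
qed

section \<open>The oscillating profile\<close>

text \<open>Products of functions of the single coordinates are closed under partial derivatives:
  one factor is replaced by its derivative.\<close>
definition prod_fun :: "('n::finite \<Rightarrow> real \<Rightarrow> complex) \<Rightarrow> real^'n \<Rightarrow> complex" where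
  "prod_fun p x = (\<Prod>i\<in>UNIV. p i (x $ i))"

lemma prod_fun_upd: "prod_fun (p(l := q)) x = q (x $ l) * (\<Prod>i\<in>UNIV - {l}. p i (x $ i))"
proof -
  have "prod_fun (p(l := q)) x = q (x $ l) * (\<Prod>i\<in>UNIV - {l}. (p(l := q)) i (x $ i))"
    unfolding prod_fun_def by (subst prod.remove[of UNIV l]) simp_all
  also have "(\<Prod>i\<in>UNIV - {l}. (p(l := q)) i (x $ i)) = (\<Prod>i\<in>UNIV - {l}. p i (x $ i))"
    by (rule prod.cong) auto
  finally show ?thesis .
qed

lemma partial_deriv_prod_fun:
  assumes "\<And>i t. (p i has_vector_derivative p' i t) (at t)"
  shows "partial_deriv l (prod_fun p) x = prod_fun (p(l := p' l)) x"
proof -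
  have "((\<lambda>x. p i (x $ i)) has_derivative (\<lambda>y. (y $ i) *\<^sub>R p' i (x $ i))) (at x)" for i
  proof -
    have "((\<lambda>x. x $ i) has_derivative (\<lambda>y. y $ i)) (at x)"
      by (rule bounded_linear_imp_has_derivative) (rule bounded_linear_vec_nth)
    moreover have "(p i has_derivative (\<lambda>s. s *\<^sub>R p' i (x $ i))) (at (x $ i))"
      using assms by (simp add: has_vector_derivative_def)
    ultimately show ?thesis by (rule has_derivative_compose)
  qed
  from has_derivative_prod[of UNIV, OF this]
  have "(prod_fun p has_derivative (\<lambda>y. \<Sum>i\<in>UNIV. ((y $ i) *\<^sub>R p' i (x $ i)) * (\<Prod>j\<in>UNIV - {i}. p j (x $ j)))) (at x)"
    unfolding prod_fun_def[abs_def] by simp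
  from frechet_derivative_at[OF this, symmetric]
  have "partial_deriv l (prod_fun p) x = (\<Sum>i\<in>UNIV. (axis l 1 $ i) *\<^sub>R (p' i (x $ i) * (\<Prod>j\<in>UNIV - {i}. p j (x $ j))))"
    by (simp add: partial_deriv_def)
  also have "\<dots> = (\<Sum>i\<in>UNIV. if i = l then p' i (x $ i) * (\<Prod>j\<in>UNIV - {i}. p j (x $ j)) else 0)"
    by (rule sum.cong) (auto simp: axis_def)
  finally show ?thesis by (simp add: prod_fun_upd)
qed

lemma Ck_on_prod_fun:
  assumes "\<And>i. Ck_on k UNIV (p i)"
  shows "Ck_on k UNIV (prod_fun p)"
  unfolding prod_fun_def[abs_def]
  by (intro Ck_on_prod Ck_on_compose[OF assms Ck_on_bounded_linear[OF bounded_linear_vec_nth]]) simp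

lemma torus_periodic_prod_fun:
  assumes "\<And>i t m. i \<in> J \<Longrightarrow> p i (t + 2 * pi * of_int m) = p i t"
  shows "torus_periodic J (prod_fun p)"
  unfolding torus_periodic_def prod_fun_def
proof (intro allI impI prod.cong refl)
  fix x y and i assume c: "torus_cong J x y"
  show "p i (x $ i) = p i (y $ i)"
  proof (cases "i \<in> J")
    case True
    then obtain m :: int where "x $ i - y $ i = 2 * pi * of_int m" using c by (auto simp: torus_cong_def)
    then have "x $ i = y $ i + 2 * pi * of_int m" by simp
    then show ?thesis using assms[OF True] by simp
  next
    case False
    then show ?thesis using c by (simp add: torus_cong_def)
  qed
qed

definition bump :: "real \<Rightarrow> real" where "bump t = (max 0 (1 - t\<^sup>2)) ^ 3"
definition bump' :: "real \<Rightarrow> real" where "bump' t = - 6 * t * (max 0 (1 - t\<^sup>2))\<^sup>2"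
definition bump'' :: "real \<Rightarrow> real" where
  "bump'' t = 24 * t\<^sup>2 * max 0 (1 - t\<^sup>2) - 6 * (max 0 (1 - t\<^sup>2))\<^sup>2"

lemma DERIV_bump: "(bump has_real_derivative bump' t) (at t)"
proof -
  have "((\<lambda>t::real. 1 - t\<^sup>2) has_real_derivative - 2 * t) (at t)"
    by (auto intro!: derivative_eq_intros)
  from DERIV_chain2[OF DERIV_pos_part_power[of 1 "1 - t\<^sup>2"] this]
  show ?thesis unfolding bump_def[abs_def] bump'_def by (simp add: numeral_3_eq_3 numeral_2_eq_2 mult_ac)
qed

lemma DERIV_bump': "(bump' has_real_derivative bump'' t) (at t)"
proof -
  have "((\<lambda>t::real. 1 - t\<^sup>2) has_real_derivative - 2 * t) (at t)"
    by (auto intro!: derivative_eq_intros)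
  from DERIV_chain2[OF DERIV_pos_part_power[of 0 "1 - t\<^sup>2"] this]
  have "((\<lambda>t. (max 0 (1 - t\<^sup>2))\<^sup>2) has_real_derivative 2 * max 0 (1 - t\<^sup>2) * (- 2 * t)) (at t)"
    by (simp add: numeral_2_eq_2)
  from DERIV_mult[OF DERIV_cmult_Id[of "- 6"] this]
  show ?thesis unfolding bump'_def[abs_def] bump''_def by (simp add: algebra_simps power2_eq_square)
qed

lemma Ck_on_bump: "Ck_on 2 UNIV bump"
proof -
  have "Ck_on 2 UNIV (\<lambda>t::real. 1 + (- 1) * (t * t))"
    by (intro Ck_on_add Ck_on_mult Ck_on_const Ck_on_ident)
  from Ck_on_compose[OF Ck_on_pos_part_power[of 2] this]
  show ?thesis unfolding bump_def[abs_def] by (simp add: numeral_3_eq_3 numeral_2_eq_2)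
qed

text \<open>The bound on the second derivative uses that both \<open>t\<^sup>2 (1 -
  t\<^sup>2)\<^sub>+\<close> and \<open>(1 - t\<^sup>2)\<^sub>+\<close> are at most
  \<open>1\<close>.\<close>
lemma bump_bounds: "0 \<le> bump t" "bump t \<le> 1" "\<bar>bump'' t\<bar> \<le> 30"
proof -
  let ?m = "max 0 (1 - t\<^sup>2)"
  have m: "0 \<le> ?m" "?m \<le> 1" by auto
  show "0 \<le> bump t" using m by (simp add: bump_def)
  show "bump t \<le> 1" using m by (simp add: bump_def power_le_one)
  have t: "0 \<le> t\<^sup>2 * ?m" "t\<^sup>2 * ?m \<le> 1"
  proof -
    show "t\<^sup>2 * ?m \<le> 1"
    proof (cases "t\<^sup>2 \<le> 1")
      case True
      then show ?thesis using m mult_le_one[of "t\<^sup>2" ?m] by simp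
    qed (simp add: max_def)
  qed simp
  have "0 \<le> ?m\<^sup>2" "?m\<^sup>2 \<le> 1" using m by (auto simp: power_le_one)
  then show "\<bar>bump'' t\<bar> \<le> 30" using t unfolding bump''_def by (simp only: mult.assoc)
qed

lemma bump_zero: "1 \<le> \<bar>t\<bar> \<Longrightarrow> bump t = 0" "1 \<le> \<bar>t\<bar> \<Longrightarrow> bump'' t = 0"
proof -
  assume "1 \<le> \<bar>t\<bar>"
  then have "1 \<le> t\<^sup>2" using power_mono[of 1 "\<bar>t\<bar>" 2] by simp
  then show "bump t = 0" "bump'' t = 0" by (simp_all add: bump_def bump''_def)
qed

lemma bump_lower: "\<bar>t\<bar> \<le> 1 / 2 \<Longrightarrow> 1 / 4 \<le> bump t"
proof -
  assume "\<bar>t\<bar> \<le> 1 / 2"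
  then have "t\<^sup>2 \<le> 1 / 4" using power_mono[of "\<bar>t\<bar>" "1 / 2" 2] by (simp add: power2_eq_square)
  then have "(3 / 4) ^ 3 \<le> (max 0 (1 - t\<^sup>2)) ^ 3" by (intro power_mono) auto
  then show ?thesis by (simp add: bump_def power3_eq_cube)
qed

text \<open>The constant \<open>a\<close> sits in the oscillating factor so that normalizing a
  mode gives again a mode.\<close>
definition mode_factor :: "real \<Rightarrow> nat \<Rightarrow> real \<Rightarrow> 'n \<Rightarrow> 'n set \<Rightarrow> 'n \<Rightarrow> real \<Rightarrow> complex" where
  "mode_factor a k r i0 J i t = (if i = i0 then of_real a * cis (real k * t) else
     if i \<in> J then 1 else of_real (bump (t / r)))"

definition mode :: "real \<Rightarrow> nat \<Rightarrow> real \<Rightarrow> 'n::finite \<Rightarrow> 'n set \<Rightarrow> real^'n \<Rightarrow> complex" where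
  "mode a k r i0 J = prod_fun (mode_factor a k r i0 J)"

abbreviation mode_factor_bump'' ::
    "real \<Rightarrow> nat \<Rightarrow> real \<Rightarrow> 'n \<Rightarrow> 'n set \<Rightarrow> 'n \<Rightarrow> 'n \<Rightarrow> real \<Rightarrow> complex" where
  "mode_factor_bump'' a k r i0 J l \<equiv> (mode_factor a k r i0 J)(l := \<lambda>t. of_real (bump'' (t / r) / r\<^sup>2))"

text \<open>The Laplacian of the cut-off in the transverse directions, times the plane
  wave.\<close>
definition mode_remainder :: "real \<Rightarrow> nat \<Rightarrow> real \<Rightarrow> 'n::finite \<Rightarrow> 'n set \<Rightarrow> real^'n \<Rightarrow> complex" where
  "mode_remainder a k r i0 J x = (\<Sum>l\<in>- J. prod_fun (mode_factor_bump'' a k r i0 J l) x)"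

lemma cis_of_nat_periodic: "cis (real k * (t + 2 * pi * of_int m)) = cis (real k * t)"
proof -
  have "cis (real k * (t + 2 * pi * of_int m)) = cis (real k * t) * cis (2 * pi * of_int (int k * m))"
    by (simp add: cis_mult algebra_simps)
  also have "cis (2 * pi * of_int (int k * m)) = 1" by (rule cis_multiple_2pi) simp
  finally show ?thesis by simp
qed

context
  fixes a r :: real and k :: nat and i0 :: "'n::finite" and J :: "'n set"
  assumes r: "r > 0" and i0: "i0 \<in> J"
begin

lemma mode_C2: "Ck_on 2 UNIV (mode a k r i0 J)"
  unfolding mode_def
proof (rule Ck_on_prod_fun)
  fix i
  have "Ck_on j UNIV (\<lambda>t. cis (real k * t))" for j
  proof (induction j)
    case 0 show ?case by (auto intro!: continuous_intros)
  next
    case (Suc j)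
    have "((\<lambda>t. cis (real k * t)) has_vector_derivative (\<i> * of_real (real k)) * cis (real k * t)) (at t)" for t
      by (auto intro!: derivative_eq_intros simp: has_vector_derivative_def scaleR_conv_of_real mult_ac)
    then show ?case by (rule Ck_on_Suc_real_I[OF _ Ck_on_mult[OF Ck_on_const Suc]])
  qed
  moreover have "Ck_on 2 UNIV (\<lambda>t. complex_of_real (bump (t / r)))"
  proof -
    have "Ck_on 2 UNIV (\<lambda>t. bump (t * (1 / r)))"
      by (rule Ck_on_compose[OF Ck_on_bump Ck_on_mult[OF Ck_on_ident Ck_on_const]]) simp
    from Ck_on_bounded_linear_compose[OF bounded_linear_of_real this] show ?thesis by simp
  qed
  moreover from calculation(1) have "Ck_on 2 UNIV (\<lambda>t. of_real a * cis (real k * t))"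
    by (rule Ck_on_mult[OF Ck_on_const])
  ultimately show "Ck_on 2 UNIV (mode_factor a k r i0 J i)"
    unfolding mode_factor_def[abs_def] by (cases "i = i0"; cases "i \<in> J") simp_all
qed

text \<open>The second derivative in the direction \<open>i0\<close> gives
  \<open>-k\<^sup>2\<close>, and the mode is constant in the other torus directions, so that only
  the derivatives of the bumps remain.\<close>
lemma mode_laplacian:
  "(\<Sum>l\<in>UNIV. partial_deriv l (partial_deriv l (mode a k r i0 J)) x) =
     - (of_nat k)\<^sup>2 * mode a k r i0 J x + mode_remainder a k r i0 J x"
proof -
  let ?p = "mode_factor a k r i0 J"
  define q where "q = (\<lambda>i t. if i = i0 then \<i> * of_nat k * ?p i t else
     if i \<in> J then 0 else complex_of_real (bump' (t / r) / r))"
  define q2 where "q2 = (\<lambda>i t. if i = i0 then - (of_nat k)\<^sup>2 * ?p i t else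
     if i \<in> J then 0 else complex_of_real (bump'' (t / r) / r\<^sup>2))"
  have sc: "((\<lambda>t. complex_of_real (f (t / r))) has_vector_derivative complex_of_real (f' (t / r) / r)) (at t)"
    if f: "\<And>t. (f has_real_derivative f' t) (at t)" for f f' t
  proof -
    have "((\<lambda>t. t / r) has_real_derivative 1 / r) (at t)" using DERIV_cdivide[OF DERIV_ident] .
    from DERIV_chain2[OF f this] have "((\<lambda>t. f (t / r)) has_real_derivative f' (t / r) / r) (at t)" by simp
    then show ?thesis
      unfolding has_real_derivative_iff_has_vector_derivative
      by (rule bounded_linear.has_vector_derivative[OF bounded_linear_of_real])
  qed
  have e: "((\<lambda>t. of_real a * cis (real k * t)) has_vector_derivative (\<i> * of_nat k) * (of_real a * cis (real k * t))) (at t)" for t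
    by (auto intro!: derivative_eq_intros simp: has_vector_derivative_def scaleR_conv_of_real mult_ac)
  have d1: "(?p i has_vector_derivative q i t) (at t)" for i t
    using e sc[OF DERIV_bump] unfolding q_def mode_factor_def[abs_def] by auto
  have d2: "(q i has_vector_derivative q2 i t) (at t)" for i t
  proof -
    have "((\<lambda>t. (\<i> * of_nat k) * (of_real a * cis (real k * t))) has_vector_derivative
       (\<i> * of_nat k) * ((\<i> * of_nat k) * (of_real a * cis (real k * t)))) (at t)"
      by (rule bounded_linear.has_vector_derivative[OF bounded_linear_mult_right e])
    moreover have "((\<lambda>t. complex_of_real (bump' (t / r) / r)) has_vector_derivative complex_of_real (bump'' (t / r) / r\<^sup>2)) (at t)"
    proof -
      have "((\<lambda>t. bump' t / r) has_real_derivative bump'' t / r) (at t)" for t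
        using DERIV_cdivide[OF DERIV_bump'] .
      from sc[OF this] show ?thesis by (simp add: power2_eq_square)
    qed
    ultimately show ?thesis
      unfolding q_def q2_def mode_factor_def[abs_def] by (auto simp: power2_eq_square algebra_simps)
  qed
  have pd: "partial_deriv l (partial_deriv l (mode a k r i0 J)) x = prod_fun (?p(l := q2 l)) x" for l
  proof -
    have "partial_deriv l (mode a k r i0 J) = prod_fun (?p(l := q l))"
      unfolding mode_def using partial_deriv_prod_fun[of ?p q, OF d1] by (rule ext)
    moreover have "partial_deriv l (prod_fun (?p(l := q l))) x = prod_fun ((?p(l := q l))(l := (q(l := q2 l)) l)) x"
      by (rule partial_deriv_prod_fun) (use d1 d2 in auto)
    ultimately show ?thesis by simp
  qed
  have A: "prod_fun (?p(i0 := q2 i0)) x = - (of_nat k)\<^sup>2 * mode a k r i0 J x"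
  proof -
    have "prod_fun (?p(i0 := q2 i0)) x = - (of_nat k)\<^sup>2 * prod_fun (?p(i0 := ?p i0)) x"
      unfolding prod_fun_upd by (simp add: q2_def)
    then show ?thesis by (simp add: mode_def)
  qed
  have B: "prod_fun (?p(l := q2 l)) x = 0" if "l \<in> J - {i0}" for l
    using that by (simp add: prod_fun_upd q2_def)
  have C: "prod_fun (?p(l := q2 l)) x = prod_fun (?p(l := \<lambda>t. of_real (bump'' (t / r) / r\<^sup>2))) x" if "l \<in> - J" for l
    using that i0 by (auto simp: prod_fun_upd q2_def)
  have "(\<Sum>l\<in>UNIV. prod_fun (?p(l := q2 l)) x) = (\<Sum>l\<in>J. prod_fun (?p(l := q2 l)) x) + (\<Sum>l\<in>- J. prod_fun (?p(l := q2 l)) x)"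
    by (subst sum.union_disjoint[symmetric]) auto
  also have "(\<Sum>l\<in>J. prod_fun (?p(l := q2 l)) x) = - (of_nat k)\<^sup>2 * mode a k r i0 J x"
    using i0 A B by (simp add: sum.remove[of J i0])
  also have "(\<Sum>l\<in>- J. prod_fun (?p(l := q2 l)) x) = mode_remainder a k r i0 J x"
    unfolding mode_remainder_def using C by (intro sum.cong) auto
  finally show ?thesis unfolding pd .
qed

lemma mode_factor_periodic: "i \<in> J \<Longrightarrow> mode_factor a k r i0 J i (t + 2 * pi * of_int m) = mode_factor a k r i0 J i t"
  using cis_of_nat_periodic by (simp add: mode_factor_def)

lemma mode_periodic: "torus_periodic J (mode a k r i0 J)"
  unfolding mode_def by (rule torus_periodic_prod_fun) (rule mode_factor_periodic)

lemma mode_remainder_periodic: "torus_periodic J (mode_remainder a k r i0 J)"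
proof -
  have "torus_periodic J (prod_fun (mode_factor_bump'' a k r i0 J l))"
    if "l \<in> - J" for l
    by (rule torus_periodic_prod_fun) (use that mode_factor_periodic in auto)
  then show ?thesis unfolding torus_periodic_def mode_remainder_def by (auto intro!: sum.cong)
qed

lemma mode_support: "x \<notin> slab J r \<Longrightarrow> mode a k r i0 J x = 0" "x \<notin> slab J r \<Longrightarrow> mode_remainder a k r i0 J x = 0"
proof -
  assume "x \<notin> slab J r"
  then obtain i where i: "i \<notin> J" "r < \<bar>x $ i\<bar>" by (auto simp: slab_def)
  then have t: "1 \<le> \<bar>x $ i / r\<bar>" using r by simp
  have z: "mode_factor a k r i0 J i (x $ i) = 0" using i i0 bump_zero(1)[OF t] by (auto simp: mode_factor_def)
  then show "mode a k r i0 J x = 0" by (auto simp: mode_def prod_fun_def)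
  have "prod_fun (mode_factor_bump'' a k r i0 J l) x = 0" for l
  proof -
    have "(mode_factor_bump'' a k r i0 J l) i (x $ i) = 0"
      using z bump_zero(2)[OF t] by auto
    then show ?thesis unfolding prod_fun_def by (intro prod_zero finite bexI[of _ i] UNIV_I)
  qed
  then show "mode_remainder a k r i0 J x = 0" by (simp add: mode_remainder_def)
qed

lemma mode_remainder_continuous: "continuous_on UNIV (mode_remainder a k r i0 J)"
proof -
  have "continuous_on UNIV (prod_fun (mode_factor_bump'' a k r i0 J l))" for l
  proof -
    have "Ck_on 0 UNIV (prod_fun (mode_factor_bump'' a k r i0 J l))"
    proof (rule Ck_on_prod_fun)
      fix i
      have "continuous_on UNIV (\<lambda>t. complex_of_real (bump'' (t / r) / r\<^sup>2))"
        unfolding bump''_def using r by (intro continuous_intros) auto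
      moreover have "continuous_on UNIV (\<lambda>t. complex_of_real (bump (t / r)))"
        unfolding bump_def using r by (intro continuous_intros) auto
      moreover have "continuous_on UNIV (\<lambda>t. of_real a * cis (real k * t))"
        by (intro continuous_intros)
      ultimately show "Ck_on 0 UNIV ((mode_factor_bump'' a k r i0 J l) i)"
        unfolding mode_factor_def[abs_def] Ck_on.simps(1)
        by (cases "i = l"; cases "i = i0"; cases "i \<in> J") simp_all
    qed
    then show ?thesis by simp
  qed
  then show ?thesis unfolding mode_remainder_def[abs_def] by (intro continuous_on_sum) auto
qed

lemma norm_mode_factor: "norm (mode_factor a k r i0 J i t) = (if i = i0 then \<bar>a\<bar> else if i \<in> J then 1 else bump (t / r))"
  using bump_bounds(1) by (simp add: mode_factor_def norm_mult)

lemma norm_mode: "norm (mode a k r i0 J x) = \<bar>a\<bar> * (\<Prod>i\<in>UNIV - {i0}. if i \<in> J then 1 else bump (x $ i / r))"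
  unfolding mode_def prod_fun_def prod_norm[symmetric]
  by (subst prod.remove[of UNIV i0]) (auto simp: norm_mode_factor intro!: prod.cong)

lemma norm_mode_le: "norm (mode a k r i0 J x) \<le> \<bar>a\<bar>"
proof -
  have "(\<Prod>i\<in>UNIV - {i0}. if i \<in> J then 1 else bump (x $ i / r)) \<le> 1"
    by (rule prod_le_1) (auto simp: bump_bounds)
  then show ?thesis unfolding norm_mode by (simp add: mult_left_le)
qed

lemma norm_mode_ge:
  assumes "\<And>i. i \<notin> J \<Longrightarrow> \<bar>x $ i\<bar> \<le> r / 2"
  shows "\<bar>a\<bar> * (1 / 4) ^ CARD('n) \<le> norm (mode a k r i0 J x)"
proof -
  have "(1 / 4 :: real) ^ CARD('n) \<le> (1 / 4) ^ card (UNIV - {i0})"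
    by (rule power_decreasing) (auto intro!: card_mono)
  also have "\<dots> = (\<Prod>i\<in>UNIV - {i0}. 1 / 4)" by simp
  also have "\<dots> \<le> (\<Prod>i\<in>UNIV - {i0}. if i \<in> J then 1 else bump (x $ i / r))"
  proof (rule prod_mono)
    fix i
    show "(0::real) \<le> 1 / 4 \<and> 1 / 4 \<le> (if i \<in> J then 1 else bump (x $ i / r))"
      using bump_lower[of "x $ i / r"] assms[of i] r by (auto simp: field_simps)
  qed
  finally show ?thesis unfolding norm_mode by (intro mult_left_mono) auto
qed

lemma norm_mode_remainder_le: "norm (mode_remainder a k r i0 J x) \<le> \<bar>a\<bar> * (30 * real CARD('n) / r\<^sup>2)"
proof -
  have "norm (prod_fun (mode_factor_bump'' a k r i0 J l) x) \<le> \<bar>a\<bar> * (30 / r\<^sup>2)"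
    if l: "l \<in> - J" for l
  proof -
    have li: "l \<noteq> i0" using l i0 by auto
    have "norm (\<Prod>i\<in>UNIV - {l}. mode_factor a k r i0 J i (x $ i)) = (\<Prod>i\<in>UNIV - {l}. if i = i0 then \<bar>a\<bar> else if i \<in> J then 1 else bump (x $ i / r))"
      by (simp add: prod_norm[symmetric] norm_mode_factor)
    also have "\<dots> = \<bar>a\<bar> * (\<Prod>i\<in>UNIV - {l} - {i0}. if i = i0 then \<bar>a\<bar> else if i \<in> J then 1 else bump (x $ i / r))"
      using li by (subst prod.remove[of _ i0]) auto
    also have "\<dots> \<le> \<bar>a\<bar> * 1"
      by (intro mult_left_mono prod_le_1) (auto simp: bump_bounds)
    finally have 1: "norm (\<Prod>i\<in>UNIV - {l}. mode_factor a k r i0 J i (x $ i)) \<le> \<bar>a\<bar>" by simp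
    have 2: "norm (complex_of_real (bump'' (x $ l / r) / r\<^sup>2)) \<le> 30 / r\<^sup>2"
      using bump_bounds(3)[of "x $ l / r"] r unfolding norm_of_real by (simp add: divide_right_mono)
    show ?thesis unfolding prod_fun_upd norm_mult using mult_mono[OF 2 1] r by (simp add: mult.commute)
  qed
  then have "norm (mode_remainder a k r i0 J x) \<le> (\<Sum>l\<in>- J. \<bar>a\<bar> * (30 / r\<^sup>2))"
    unfolding mode_remainder_def by (intro sum_norm_le)
  also have "\<dots> = real (card (- J)) * (\<bar>a\<bar> * (30 / r\<^sup>2))" by simp
  also have "\<dots> \<le> real CARD('n) * (\<bar>a\<bar> * (30 / r\<^sup>2))"
    by (intro mult_right_mono) (auto intro!: card_mono)
  finally show ?thesis by (simp add: mult_ac)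
qed

end

section \<open>Norm estimates and quasimodes\<close>

definition slab_content :: "'n::finite set \<Rightarrow> real \<Rightarrow> real" where
  "slab_content J r = (\<Prod>i\<in>UNIV. if i \<in> J then 2 * pi else 2 * r)"

lemma slab_content_pos: "r > 0 \<Longrightarrow> slab_content J r > 0"
  unfolding slab_content_def by (intro prod_pos) auto

text \<open>The mode is bounded below on the slab of half the width; this comparison is what makes
  the constant in the final estimate independent of the width.\<close>
lemma slab_content_double:
  assumes "r > 0"
  shows "slab_content (J :: 'n::finite set) r \<le> 2 ^ CARD('n) * slab_content J (r / 2)"
proof -
  have "slab_content J r \<le> (\<Prod>i::'n\<in>UNIV. 2 * (if i \<in> J then 2 * pi else 2 * (r / 2)))"
    unfolding slab_content_def using assms by (intro prod_mono) auto
  then show ?thesis unfolding slab_content_def by (simp add: prod.distrib)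
qed

lemma emeasure_slab_box:
  fixes J :: "'n::finite set"
  assumes "r > 0"
  shows "emeasure lborel (slab_box J r) = ennreal (slab_content J r)"
    "emeasure lborel (interior (slab_box J r)) = ennreal (slab_content J r)"
proof -
  let ?l = "(\<chi> i. if i \<in> J then 0 else - r) :: real^'n" and ?u = "(\<chi> i. if i \<in> J then 2 * pi else r) :: real^'n"
  have le: "?l \<bullet> b \<le> ?u \<bullet> b" if "b \<in> Basis" for b
    using that assms by (auto simp: Basis_vec_def inner_axis)
  have p: "(\<Prod>b\<in>Basis. (?u - ?l) \<bullet> b) = slab_content J r"
    unfolding prod_Basis_vec slab_content_def by (rule prod.cong) auto
  show "emeasure lborel (slab_box J r) = ennreal (slab_content J r)"
    unfolding slab_box_def p[symmetric] by (rule emeasure_lborel_cbox) (rule le)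
  show "emeasure lborel (interior (slab_box J r)) = ennreal (slab_content J r)"
    unfolding slab_box_def p[symmetric] interior_cbox by (rule emeasure_lborel_box) (rule le)
qed

lemma interior_slab_box_subset:
  assumes "slab J r \<subseteq> flat_tube J \<epsilon>"
  shows "interior (slab_box J r) \<subseteq> torus_cell J \<epsilon>"
proof
  fix x assume x: "x \<in> interior (slab_box J r)"
  then have "x \<in> slab_box J r" using interior_subset by blast
  then have "x \<in> flat_tube J \<epsilon>" using assms slab_box_iff by blast
  moreover have "0 \<le> x $ i \<and> x $ i < 2 * pi" if "i \<in> J" for i
  proof -
    have "(if i \<in> J then 0 else - r) < x $ i \<and> x $ i < (if i \<in> J then 2 * pi else r)"
      using x unfolding slab_box_def interior_cbox by (simp add: mem_box_cart)
    then show ?thesis using that by simp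
  qed
  ultimately show "x \<in> torus_cell J \<epsilon>" by (simp add: torus_cell_def)
qed

lemma norm'_le_on_slab:
  fixes J :: "'n::finite set"
  assumes "x \<in> slab J r" "r > 0"
  shows "norm' J x \<le> real CARD('n) * r"
proof -
  have "norm' J x = L2_set (\<lambda>i. x $ i) (- J)" by (simp add: norm'_def L2_set_def)
  also have "\<dots> \<le> (\<Sum>i\<in>- J. \<bar>x $ i\<bar>)" by (rule L2_set_le_sum_abs)
  also have "\<dots> \<le> (\<Sum>i\<in>- J. r)" using assms(1) by (intro sum_mono) (auto simp: slab_def)
  also have "\<dots> \<le> real CARD('n) * r" using assms(2) by (simp add: card_mono mult_right_mono)
  finally show ?thesis .
qed

lemma embedding_nn_norm_square:
  fixes f :: "'m::{t2_space,second_countable_topology} \<Rightarrow> complex"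
  assumes m: "riemannian_manifold A g" and e: "flat_product_embedding A g J \<epsilon> F"
    and sub: "slab J r \<subseteq> flat_tube J \<epsilon>"
    and f[measurable]: "f \<in> borel_measurable borel" and f0: "\<And>p. p \<notin> F ` slab_box J r \<Longrightarrow> f p = 0"
  shows "(\<integral>\<^sup>+p. ennreal ((norm (f p))\<^sup>2) \<partial>riemannian_volume A g) =
    (\<integral>\<^sup>+x\<in>torus_cell J \<epsilon>. ennreal ((norm (f (F x)))\<^sup>2) \<partial>lborel)"
proof (rule embedding_nn_integral[OF m e])
  show "ennreal ((norm (f p))\<^sup>2) = 0" if "p \<notin> F ` flat_tube J \<epsilon>" for p
  proof -
    have "slab_box J r \<subseteq> flat_tube J \<epsilon>" using sub slab_box_iff by blast
    then show ?thesis using that f0[of p] by auto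
  qed
qed simp

text \<open>The bound is only asked almost everywhere in flat coordinates, which is the form in
  which the assumption on the damping is given.\<close>
lemma L2_bound_on_slab:
  fixes f :: "'m::{t2_space,second_countable_topology} \<Rightarrow> complex"
  assumes m: "riemannian_manifold A g" and e: "flat_product_embedding A g J \<epsilon> F"
    and sub: "slab J r \<subseteq> flat_tube J \<epsilon>" and r: "r > 0"
    and f: "f \<in> borel_measurable borel" "\<And>p. p \<notin> F ` slab_box J r \<Longrightarrow> f p = 0"
    and B: "B \<ge> 0" "AE x in lborel. x \<in> slab J r \<longrightarrow> norm (f (F x)) \<le> B"
  shows "f \<in> L2_space (riemannian_volume A g)"
    and "L2_norm (riemannian_volume A g) f \<le> B * sqrt (slab_content J r)"
proof -
  let ?\<mu> = "riemannian_volume A g"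
  have s: "sets ?\<mu> = sets borel" using riemannian_volume_is_volume[OF m] by (simp add: is_volume_def)
  have fm: "(\<lambda>p. (norm (f p))\<^sup>2) \<in> borel_measurable ?\<mu>"
    using f(1) by (simp add: measurable_cong_sets[OF s refl])
  \<comment> \<open>A point of the cell outside the closed box is equivalent to no point of the box.\<close>
  have out: "f (F x) = 0" if x: "x \<in> torus_cell J \<epsilon>" "x \<notin> slab_box J r" for x
  proof (rule f(2), rule notI)
    assume "F x \<in> F ` slab_box J r"
    then obtain y where y: "y \<in> slab_box J r" "F x = F y" by blast
    have yT: "y \<in> flat_tube J \<epsilon>" using y(1) sub slab_box_iff by blast
    have "torus_cong J x y" using embeddingD(1)[OF e _ yT] y(2) x(1) torus_cell_subset[of J \<epsilon>] by blast
    then have "x \<in> slab J r" using y(1) by (auto simp: slab_box_iff slab_def torus_cong_def)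
    then have "x \<in> slab_box J r" using x(1) by (auto simp: slab_box_iff torus_cell_def less_imp_le)
    then show False using x(2) by blast
  qed
  have "(\<integral>\<^sup>+p. ennreal ((norm (f p))\<^sup>2) \<partial>?\<mu>) = (\<integral>\<^sup>+x\<in>torus_cell J \<epsilon>. ennreal ((norm (f (F x)))\<^sup>2) \<partial>lborel)"
    by (rule embedding_nn_norm_square[OF m e sub f(1)]) (rule f(2))
  also have "\<dots> \<le> (\<integral>\<^sup>+x. ennreal (B\<^sup>2) * indicator (slab_box J r) x \<partial>lborel)"
  proof (rule nn_integral_mono_AE)
    show "AE x in lborel. ennreal ((norm (f (F x)))\<^sup>2) * indicator (torus_cell J \<epsilon>) x \<le> ennreal (B\<^sup>2) * indicator (slab_box J r) x"
      using B(2)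
    proof eventually_elim
      case (elim x)
      show ?case
      proof (cases "x \<in> torus_cell J \<epsilon> \<and> x \<in> slab_box J r")
        case True
        then have "norm (f (F x)) \<le> B" using elim slab_box_iff by blast
        then have "(norm (f (F x)))\<^sup>2 \<le> B\<^sup>2" by (intro power_mono) auto
        then show ?thesis using True by (simp add: ennreal_leI)
      qed (use out in \<open>auto simp: indicator_def\<close>)
    qed
  qed
  also have "\<dots> = ennreal (B\<^sup>2) * emeasure lborel (slab_box J r)"
    by (rule nn_integral_cmult_indicator) (simp add: slab_box_def)
  also have "\<dots> = ennreal (B\<^sup>2 * slab_content J r)"
    using slab_content_pos[OF r, of J] by (simp add: emeasure_slab_box[OF r] ennreal_mult)
  finally have le: "(\<integral>\<^sup>+p. ennreal ((norm (f p))\<^sup>2) \<partial>?\<mu>) \<le> ennreal (B\<^sup>2 * slab_content J r)" .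
  have int: "integrable ?\<mu> (\<lambda>p. (norm (f p))\<^sup>2)"
    using le fm by (intro integrableI_bounded) (auto simp: top_unique less_top[symmetric] intro: le_less_trans)
  then show "f \<in> L2_space ?\<mu>" using f(1) by (simp add: L2_space_def)
  have "ennreal (LINT p|?\<mu>. (norm (f p))\<^sup>2) \<le> ennreal (B\<^sup>2 * slab_content J r)"
    using le nn_integral_eq_integral[OF int] by simp
  then have "(LINT p|?\<mu>. (norm (f p))\<^sup>2) \<le> B\<^sup>2 * slab_content J r"
    using slab_content_pos[OF r, of J] by (subst (asm) ennreal_le_iff) (auto intro!: mult_nonneg_nonneg)
  then have "L2_norm ?\<mu> f \<le> sqrt (B\<^sup>2 * slab_content J r)" unfolding L2_norm_def by (rule real_sqrt_le_mono)
  then show "L2_norm ?\<mu> f \<le> B * sqrt (slab_content J r)" using B(1) by (simp add: real_sqrt_mult)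
qed

lemma L2_lower_bound_on_slab:
  fixes f :: "'m::{t2_space,second_countable_topology} \<Rightarrow> complex"
  assumes m: "riemannian_manifold A g" and e: "flat_product_embedding A g J \<epsilon> F"
    and sub: "slab J r \<subseteq> flat_tube J \<epsilon>" and sub': "slab J s \<subseteq> flat_tube J \<epsilon>" and s: "s > 0"
    and f: "f \<in> L2_space (riemannian_volume A g)" "\<And>p. p \<notin> F ` slab_box J r \<Longrightarrow> f p = 0"
    and B: "B \<ge> 0" "\<And>x. x \<in> slab J s \<Longrightarrow> B \<le> norm (f (F x))"
  shows "B * sqrt (slab_content J s) \<le> L2_norm (riemannian_volume A g) f"
proof -
  let ?\<mu> = "riemannian_volume A g" and ?E = "interior (slab_box J s)"
  have fb: "f \<in> borel_measurable borel" and int: "integrable ?\<mu> (\<lambda>p. (norm (f p))\<^sup>2)"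
    using f(1) by (auto simp: L2_space_def)
  have "ennreal (B\<^sup>2 * slab_content J s) = ennreal (B\<^sup>2) * emeasure lborel ?E"
    using slab_content_pos[OF s, of J] by (simp add: emeasure_slab_box[OF s] ennreal_mult)
  also have "\<dots> = (\<integral>\<^sup>+x. ennreal (B\<^sup>2) * indicator ?E x \<partial>lborel)"
    by (rule nn_integral_cmult_indicator[symmetric]) simp
  also have "\<dots> \<le> (\<integral>\<^sup>+x\<in>torus_cell J \<epsilon>. ennreal ((norm (f (F x)))\<^sup>2) \<partial>lborel)"
  proof (rule nn_integral_mono)
    fix x
    show "ennreal (B\<^sup>2) * indicator ?E x \<le> ennreal ((norm (f (F x)))\<^sup>2) * indicator (torus_cell J \<epsilon>) x"
    proof (cases "x \<in> ?E")
      case True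
      then have "x \<in> torus_cell J \<epsilon>" using interior_slab_box_subset[OF sub'] by blast
      moreover have "x \<in> slab J s" using True interior_subset slab_box_iff by blast
      then have "B\<^sup>2 \<le> (norm (f (F x)))\<^sup>2" using B by (intro power_mono) auto
      ultimately show ?thesis using True by (simp add: ennreal_leI)
    qed simp
  qed
  also have "\<dots> = (\<integral>\<^sup>+p. ennreal ((norm (f p))\<^sup>2) \<partial>?\<mu>)"
    by (rule embedding_nn_norm_square[OF m e sub fb, symmetric]) (rule f(2))
  also have "\<dots> = ennreal (LINT p|?\<mu>. (norm (f p))\<^sup>2)" by (rule nn_integral_eq_integral[OF int]) simp
  finally have "ennreal (B\<^sup>2 * slab_content J s) \<le> ennreal (LINT p|?\<mu>. (norm (f p))\<^sup>2)" .
  moreover have I0: "0 \<le> (LINT p|?\<mu>. (norm (f p))\<^sup>2)" by (rule Bochner_Integration.integral_nonneg) simp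
  ultimately have "B\<^sup>2 * slab_content J s \<le> (LINT p|?\<mu>. (norm (f p))\<^sup>2)"
    by (simp only: ennreal_le_iff[OF I0])
  from real_sqrt_le_mono[OF this] have "sqrt (B\<^sup>2 * slab_content J s) \<le> L2_norm ?\<mu> f" unfolding L2_norm_def .
  moreover have "sqrt (B\<^sup>2 * slab_content J s) = B * sqrt (slab_content J s)"
    using B(1) by (simp add: real_sqrt_mult)
  ultimately show ?thesis by (simp only:)
qed

text \<open>With \<open>u\<close> normalized, the operator gives \<open>- remainder + \<i> k b
  u\<close>. Its \<open>L\<^sup>2\<close> norm is at most \<open>a\<close> times the pointwise
  bound times the root of the volume of the slab, where \<open>a\<close> is the amplitude. Since
  \<open>u\<close> is at least \<open>a / 4\<^sup>n\<close> on the slab of half the width,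
  normalization bounds \<open>a\<close> by \<open>4\<^sup>n\<close> over the root of that volume,
  and \<open>8\<^sup>n\<close> absorbs both factors.\<close>
lemma quasimode_exists:
  fixes A :: "('m::{t2_space,second_countable_topology}, 'n::finite) chart set" and J :: "'n set"
  assumes m: "riemannian_manifold A g" and e: "flat_product_embedding A g J \<epsilon> F"
    and b: "b \<in> borel_measurable borel"
    and bound: "AE x in lborel. x \<in> flat_tube J \<epsilon> \<longrightarrow> 0 \<le> b (F x) \<and> b (F x) \<le> C * norm' J x powr (2 * \<gamma>)"
    and C: "C > 0" and \<gamma>: "\<gamma> > 0" and i0: "i0 \<in> J" and r: "r > 0" and sub: "slab J r \<subseteq> flat_tube J \<epsilon>"
  shows "\<exists>u h. u \<in> sobolev_space 2 A g \<and> L2_norm (riemannian_volume A g) u = 1 \<and>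
      has_damped_op A g b (real k) u h \<and> h \<in> L2_space (riemannian_volume A g) \<and>
      L2_norm (riemannian_volume A g) h \<le>
        8 ^ CARD('n) * (30 * real CARD('n) / r\<^sup>2 + real k * (C * (real CARD('n) * r) powr (2 * \<gamma>)))"
proof -
  let ?\<mu> = "riemannian_volume A g" and ?N = "real CARD('n)"
  have sub': "slab J (r / 2) \<subseteq> flat_tube J \<epsilon>"
  proof
    fix x assume x: "x \<in> slab J (r / 2)"
    have "\<bar>x $ i\<bar> \<le> r" if "i \<in> - J" for i
    proof -
      have "\<bar>x $ i\<bar> \<le> r / 2" using x that by (simp add: slab_def)
      then show ?thesis using r by linarith
    qed
    then show "x \<in> flat_tube J \<epsilon>" using sub by (auto simp: slab_def)
  qed
  define v where "v = (\<lambda>a. mode a k r i0 J)"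
  define R where "R = (\<lambda>a. mode_remainder a k r i0 J)"
  define L where "L = (\<lambda>a x. - (of_nat k)\<^sup>2 * v a x + R a x)"
  have vp: "torus_periodic J (v a)" and vs: "x \<notin> slab J r \<Longrightarrow> v a x = 0" and v2: "Ck_on 2 UNIV (v a)" for a x
    unfolding v_def using mode_periodic[OF r i0] mode_support(1)[OF r i0] mode_C2[OF r i0] by auto
  have Rp: "torus_periodic J (R a)" and Rs: "x \<notin> slab J r \<Longrightarrow> R a x = 0" and Rc: "continuous_on UNIV (R a)" for a x
    unfolding R_def using mode_remainder_periodic[OF r i0] mode_support(2)[OF r i0] mode_remainder_continuous[OF r i0] by auto
  have vc: "continuous_on UNIV (v a)" for a using Ck_on_imp_continuous_on[OF v2] .
  have Lp: "torus_periodic J (L a)" for a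
    using vp[of a] Rp[of a] unfolding L_def torus_periodic_def by metis
  have Ls: "x \<notin> slab J r \<Longrightarrow> L a x = 0" for a x using vs Rs by (simp add: L_def)
  have Lc: "continuous_on UNIV (L a)" for a unfolding L_def by (intro continuous_intros vc Rc)
  have Leq: "L a x = (\<Sum>i\<in>UNIV. partial_deriv i (partial_deriv i (v a)) x)" for a x
    unfolding L_def v_def R_def using mode_laplacian[OF r i0] by simp
  define U where "U = (\<lambda>a. push J \<epsilon> F (v a))"
  have Ub: "U a \<in> borel_measurable borel" for a
    unfolding U_def by (rule push_borel[OF m e sub vp _ vc]) (rule vs)
  have U0: "U a p = 0" if "p \<notin> F ` slab_box J r" for a p
    unfolding U_def by (rule push_support[OF e vp _ that]) (rule vs)
  have UF: "U a (F x) = v a x" if "x \<in> flat_tube J \<epsilon>" for a x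
    unfolding U_def by (rule push_apply[OF e vp that])
  have UL2: "U a \<in> L2_space ?\<mu>" for a
  proof (rule L2_bound_on_slab(1)[OF m e sub r Ub])
    show "AE x in lborel. x \<in> slab J r \<longrightarrow> norm (U a (F x)) \<le> \<bar>a\<bar>"
      using UF sub norm_mode_le[OF r i0] by (intro AE_I2) (auto simp: v_def)
  qed (use U0 in auto)
  let ?q = "(1 / 4 :: real) ^ CARD('n)"
  \<comment> \<open>A lower bound for the amplitude 1; in particular the function can be normalized.\<close>
  have low: "?q * sqrt (slab_content J (r / 2)) \<le> L2_norm ?\<mu> (U 1)"
  proof (rule L2_lower_bound_on_slab[OF m e sub sub' _ UL2])
    fix x assume x: "x \<in> slab J (r / 2)"
    then have "\<bar>1\<bar> * ?q \<le> norm (mode 1 k r i0 J x)"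
      by (intro norm_mode_ge[OF r i0]) (auto simp: slab_def)
    then show "?q \<le> norm (U 1 (F x))" using UF[of x 1] x sub' by (auto simp: v_def)
  qed (use U0 r in auto)
  let ?I = "L2_norm ?\<mu> (U 1)"
  have "0 < ?q * sqrt (slab_content J (r / 2))" using slab_content_pos[of "r / 2" J] r by simp
  with low have Ipos: "?I > 0" by linarith
  define a where "a = 1 / ?I"
  have a: "a > 0" using Ipos by (simp add: a_def)
  have Ua: "U a p = of_real a * U 1 p" for p
    unfolding U_def push_def v_def mode_def prod_fun_def using i0
    by (subst (1 2) prod.remove[of UNIV i0]) (auto simp: mode_factor_def intro!: prod.cong)
  have norm1: "L2_norm ?\<mu> (U a) = 1"
  proof -
    have "L2_norm ?\<mu> (U a) = sqrt (LINT p|?\<mu>. a\<^sup>2 * (norm (U 1 p))\<^sup>2)"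
      unfolding L2_norm_def Ua norm_mult power_mult_distrib by simp
    also have "\<dots> = a * ?I" using a by (simp add: L2_norm_def real_sqrt_mult)
    finally show ?thesis using Ipos by (simp add: a_def)
  qed
  have sob: "U a \<in> sobolev_space 2 A g"
    unfolding sobolev_space_def case_prod_unfold
  proof (intro CollectI conjI ballI)
    show "U a \<in> L2_space ?\<mu>" by (rule UL2)
    fix c assume c: "c \<in> A"
    show "sobolev_loc 2 (snd c ` fst c) (U a \<circ> chart_inv c)"
      unfolding U_def
      by (rule sobolev_loc_Ck[OF manifold_chartD(2)[OF m c] push_Ck[OF m e sub vp _ v2 c]]) (rule vs)
  qed
  define h where "h = (\<lambda>p. - push J \<epsilon> F (L a) p - of_real ((real k)\<^sup>2) * U a p + \<i> * of_real (real k) * of_real (b p) * U a p)"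
  have lap: "has_laplacian A g (U a) (push J \<epsilon> F (L a))"
    unfolding U_def using push_has_laplacian[OF m e sub vp vs v2 Lp Ls Lc Leq] .
  have op: "has_damped_op A g b (real k) (U a) h"
    unfolding has_damped_op_def using sob lap h_def by blast
  have hb: "h \<in> borel_measurable borel"
  proof -
    have [measurable]: "push J \<epsilon> F (L a) \<in> borel_measurable borel"
      by (rule push_borel[OF m e sub Lp _ Lc]) (rule Ls)
    note [measurable] = Ub b
    show ?thesis unfolding h_def by measurable
  qed
  have h0: "h p = 0" if "p \<notin> F ` slab_box J r" for p
  proof -
    have "push J \<epsilon> F (L a) p = 0" by (rule push_support[OF e Lp _ that]) (rule Ls)
    then show ?thesis using U0[OF that] by (simp add: h_def)
  qed
  have hF: "h (F x) = - R a x + \<i> * of_nat k * of_real (b (F x)) * v a x" if "x \<in> flat_tube J \<epsilon>" for x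
    using push_apply[OF e Lp that, of a] UF[OF that] by (simp add: h_def L_def)
  let ?B = "30 * ?N / r\<^sup>2 + real k * (C * (?N * r) powr (2 * \<gamma>))"
  have B0: "0 \<le> ?B" using r C by (intro add_nonneg_nonneg mult_nonneg_nonneg) auto
  have hbd: "AE x in lborel. x \<in> slab J r \<longrightarrow> norm (h (F x)) \<le> a * ?B"
    using bound
  proof eventually_elim
    case (elim x)
    show ?case
    proof
      assume x: "x \<in> slab J r"
      then have xT: "x \<in> flat_tube J \<epsilon>" using sub by blast
      then have bx: "0 \<le> b (F x)" "b (F x) \<le> C * norm' J x powr (2 * \<gamma>)" using elim by auto
      have "norm' J x powr (2 * \<gamma>) \<le> (?N * r) powr (2 * \<gamma>)"
        using norm'_le_on_slab[OF x r] \<gamma> by (intro powr_mono2) (auto simp: norm'_def intro!: sum_nonneg)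
      then have bx2: "b (F x) \<le> C * (?N * r) powr (2 * \<gamma>)" using bx(2) C by (meson less_imp_le mult_left_mono order_trans)
      have "norm (h (F x)) \<le> norm (R a x) + norm (\<i> * of_nat k * of_real (b (F x)) * v a x)"
        unfolding hF[OF xT] by (metis norm_minus_cancel norm_triangle_ineq)
      also have "norm (R a x) \<le> a * (30 * ?N / r\<^sup>2)"
        using norm_mode_remainder_le[OF r i0, of a k x] a by (simp add: R_def)
      also have "norm (\<i> * of_nat k * of_real (b (F x)) * v a x) = real k * b (F x) * norm (v a x)"
        using bx(1) by (simp add: norm_mult)
      also have "\<dots> \<le> real k * (C * (?N * r) powr (2 * \<gamma>)) * a"
        using norm_mode_le[OF r i0, of a k x] a bx bx2 C by (intro mult_mono) (auto simp: v_def)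
      finally show "norm (h (F x)) \<le> a * ?B" by (simp add: algebra_simps)
    qed
  qed
  have aB: "0 \<le> a * ?B" using a B0 by simp
  have hL2: "h \<in> L2_space ?\<mu>" by (rule L2_bound_on_slab(1)[OF m e sub r hb _ aB hbd]) (rule h0)
  have "L2_norm ?\<mu> h \<le> a * ?B * sqrt (slab_content J r)"
    by (rule L2_bound_on_slab(2)[OF m e sub r hb _ aB hbd]) (rule h0)
  also have "\<dots> \<le> 8 ^ CARD('n) * ?B"
  proof -
    have "sqrt (slab_content J r) \<le> sqrt (2 ^ CARD('n) * slab_content J (r / 2))"
      using slab_content_double[OF r] by (rule real_sqrt_le_mono)
    also have "\<dots> = sqrt (2 ^ CARD('n)) * sqrt (slab_content J (r / 2))" by (rule real_sqrt_mult)
    also have "\<dots> \<le> 2 ^ CARD('n) * sqrt (slab_content J (r / 2))"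
    proof (rule mult_right_mono)
      have "(2 ^ CARD('n) :: real) * 1 \<le> 2 ^ CARD('n) * 2 ^ CARD('n)" by (intro mult_left_mono) auto
      then show "sqrt (2 ^ CARD('n)) \<le> 2 ^ CARD('n)"
        by (intro real_le_lsqrt) (auto simp: power2_eq_square)
      show "0 \<le> sqrt (slab_content J (r / 2))" using slab_content_pos[of "r / 2" J] r by simp
    qed
    also have "\<dots> \<le> 2 ^ CARD('n) * (4 ^ CARD('n) * ?I)"
      using low by (intro mult_left_mono) (auto simp: power_one_over field_simps)
    also have "\<dots> = 8 ^ CARD('n) * ?I" by (simp add: power_mult_distrib[symmetric] mult.assoc[symmetric])
    finally have "a * sqrt (slab_content J r) \<le> a * (8 ^ CARD('n) * ?I)" using a by simp
    also have "\<dots> = 8 ^ CARD('n)" using Ipos by (simp add: a_def)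
    finally have "(a * sqrt (slab_content J r)) * ?B \<le> 8 ^ CARD('n) * ?B" using B0 by (rule mult_right_mono)
    then show ?thesis by (simp only: mult_ac)
  qed
  finally show ?thesis using sob norm1 op hL2 by blast
qed

theorem theorem1p6:
  fixes A :: "('m::{t2_space,second_countable_topology}, 'n::finite) chart set"
    and g :: "('m, 'n) chart \<Rightarrow> real^'n \<Rightarrow> real^'n^'n"
    and b :: "'m \<Rightarrow> real"
    and \<gamma> \<epsilon>\<^sub>0 C\<^sub>1 :: real
    and n n'' :: nat
    and J :: "'n set"
    and F :: "real^'n \<Rightarrow> 'm"
  assumes compact: "compact (UNIV :: 'm set)"
    and manifold: "riemannian_manifold A g"
    and dim: "n = CARD('n)"
    and b_Linfty: "b \<in> Linfty_space (riemannian_volume A g)"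
    and b_nonneg: "AE p in riemannian_volume A g. 0 \<le> b p"
    and gamma: "\<gamma> > 0"
    and n'': "1 \<le> n''" "n'' \<le> n - 1" "card J = n''"
    and eps: "\<epsilon>\<^sub>0 > 0"
    and C1: "C\<^sub>1 > 0"
    and flat: "flat_product_embedding A g J \<epsilon>\<^sub>0 F"
    and grad: "\<forall>i\<in>J. weak_partial (flat_tube J \<epsilon>\<^sub>0) i (b \<circ> F) (\<lambda>_. 0)"
    and bound: "AE x in lborel. x \<in> flat_tube J \<epsilon>\<^sub>0 \<longrightarrow>
                  0 \<le> b (F x) \<and> b (F x) \<le> C\<^sub>1 * norm' J x powr (2 * \<gamma>)"
  shows "\<exists>C\<^sub>0>0. \<exists>u :: nat \<Rightarrow> 'm \<Rightarrow> complex.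
           (\<forall>k. u k \<in> sobolev_space 2 A g \<and> L2_norm (riemannian_volume A g) (u k) = 1) \<and>
           (\<forall>k\<ge>1. \<exists>h. has_damped_op A g b (real k) (u k) h \<and>
              h \<in> L2_space (riemannian_volume A g) \<and>
              L2_norm (riemannian_volume A g) h \<le> C\<^sub>0 * real k powr (1 / (\<gamma> + 1)))"
proof -
  let ?\<mu> = "riemannian_volume A g" and ?N = "real CARD('n)"
  have b: "b \<in> borel_measurable borel" using b_Linfty by (simp add: Linfty_space_def)
  obtain i0 where i0: "i0 \<in> J" using n''(1,3) by (metis card.empty ex_in_conv not_one_le_zero)
  have N: "?N \<ge> 1" by (simp add: Suc_leI)
  \<comment> \<open>On a slab of width \<open>r\<close> the norm of \<open>x'\<close> is at most \<open>N r\<close>, so \<open>r \<le> \<delta>\<close> keeps the slab inside the tube.\<close>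
  define \<delta> where "\<delta> = \<epsilon>\<^sub>0 / (2 * ?N)"
  have \<delta>: "\<delta> > 0" using eps N by (simp add: \<delta>_def)
  define C0 where "C0 = 8 ^ CARD('n) * (30 * ?N / \<delta>\<^sup>2 + C\<^sub>1 * (\<epsilon>\<^sub>0 / 2) powr (2 * \<gamma>))"
  have C0: "C0 > 0"
    unfolding C0_def using N \<delta> C1 by (intro mult_pos_pos add_pos_nonneg divide_pos_pos mult_nonneg_nonneg) auto
  have ex: "\<exists>u h. u \<in> sobolev_space 2 A g \<and> L2_norm ?\<mu> u = 1 \<and>
      has_damped_op A g b (real k) u h \<and> h \<in> L2_space ?\<mu> \<and>
      L2_norm ?\<mu> h \<le> C0 * real k powr (1 / (\<gamma> + 1))" if k: "k \<ge> 1" for k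
  proof -
    let ?s = "1 / (\<gamma> + 1)"
    \<comment> \<open>This exponent balances \<open>r\<^sup>-\<^sup>2\<close> against \<open>k r\<^bsup>2\<gamma>\<^esup>\<close>.\<close>
    define r where "r = \<delta> * real k powr (- ?s / 2)"
    have kp: "real k > 0" "real k \<ge> 1" using k by auto
    have r: "r > 0" using \<delta> kp by (simp add: r_def)
    have "real k powr (- ?s / 2) \<le> 1" using kp gamma powr_mono[of "- ?s / 2" 0 "real k"] by simp
    then have r\<delta>: "r \<le> \<delta>" using \<delta> by (simp add: r_def mult_left_le)
    have sub: "slab J r \<subseteq> flat_tube J \<epsilon>\<^sub>0"
    proof
      fix x assume "x \<in> slab J r"
      then have "norm' J x \<le> ?N * r" using norm'_le_on_slab r by blast
      also have "\<dots> \<le> ?N * \<delta>" using r\<delta> by (intro mult_left_mono) auto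
      also have "\<dots> < \<epsilon>\<^sub>0" using eps N by (simp add: \<delta>_def)
      finally show "x \<in> flat_tube J \<epsilon>\<^sub>0" by (simp add: flat_tube_def)
    qed
    have r2: "1 / r\<^sup>2 = real k powr ?s / \<delta>\<^sup>2"
    proof -
      have "(real k powr (- ?s / 2))\<^sup>2 = real k powr (- ?s)"
      proof -
        have "(real k powr (- ?s / 2))\<^sup>2 = real k powr (- ?s / 2 + - ?s / 2)"
          unfolding power2_eq_square by (rule powr_add[symmetric])
        also have "- ?s / 2 + - ?s / 2 = - ?s" by (rule field_sum_of_halves)
        finally show ?thesis .
      qed
      then have "r\<^sup>2 = \<delta>\<^sup>2 * real k powr (- ?s)" by (simp add: r_def power_mult_distrib)
      then show ?thesis by (simp add: powr_minus field_simps)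
    qed
    have kr: "real k * (?N * r) powr (2 * \<gamma>) = (\<epsilon>\<^sub>0 / 2) powr (2 * \<gamma>) * real k powr ?s"
    proof -
      have "?N * r = (\<epsilon>\<^sub>0 / 2) * real k powr (- ?s / 2)" using N by (simp add: r_def \<delta>_def)
      then have "(?N * r) powr (2 * \<gamma>) = (\<epsilon>\<^sub>0 / 2) powr (2 * \<gamma>) * real k powr (- ?s / 2 * (2 * \<gamma>))"
        using eps kp by (simp only: powr_mult[of "\<epsilon>\<^sub>0 / 2" "real k powr (- ?s / 2)" "2 * \<gamma>"] powr_powr)
      then have "real k * (?N * r) powr (2 * \<gamma>) = (\<epsilon>\<^sub>0 / 2) powr (2 * \<gamma>) * (real k powr 1 * real k powr (- ?s / 2 * (2 * \<gamma>)))"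
        using kp by simp
      also have "real k powr 1 * real k powr (- ?s / 2 * (2 * \<gamma>)) = real k powr (1 + - ?s / 2 * (2 * \<gamma>))"
        by (rule powr_add[symmetric])
      also have "1 + - ?s / 2 * (2 * \<gamma>) = ?s" using gamma by (simp add: field_simps)
      finally show ?thesis .
    qed
    have "8 ^ CARD('n) * (30 * ?N / r\<^sup>2 + real k * (C\<^sub>1 * (?N * r) powr (2 * \<gamma>))) =
        8 ^ CARD('n) * (30 * ?N * (1 / r\<^sup>2) + C\<^sub>1 * (real k * (?N * r) powr (2 * \<gamma>)))"
      by (simp add: mult_ac)
    also have "\<dots> = C0 * real k powr ?s" unfolding r2 kr C0_def by (simp add: algebra_simps)
    finally have "8 ^ CARD('n) * (30 * ?N / r\<^sup>2 + real k * (C\<^sub>1 * (?N * r) powr (2 * \<gamma>))) = C0 * real k powr ?s" .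
    then show ?thesis using quasimode_exists[OF manifold flat b bound C1 gamma i0 r sub, of k] by simp
  qed
  then obtain u h where uh: "\<And>k. k \<ge> 1 \<Longrightarrow> u k \<in> sobolev_space 2 A g \<and> L2_norm ?\<mu> (u k) = 1 \<and>
      has_damped_op A g b (real k) (u k) (h k) \<and> h k \<in> L2_space ?\<mu> \<and>
      L2_norm ?\<mu> (h k) \<le> C0 * real k powr (1 / (\<gamma> + 1))"
    by metis
  \<comment> \<open>There is no estimate at \<open>k = 0\<close>, so the first quasimode can be repeated there.\<close>
  show ?thesis
  proof (intro exI[of _ C0] conjI C0 exI[of _ "\<lambda>k. u (max 1 k)"] allI impI)
    fix k :: nat
    show "u (max 1 k) \<in> sobolev_space 2 A g" "L2_norm ?\<mu> (u (max 1 k)) = 1" using uh[of "max 1 k"] by auto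
    assume "k \<ge> 1"
    then show "\<exists>h. has_damped_op A g b (real k) (u (max 1 k)) h \<and> h \<in> L2_space ?\<mu> \<and>
      L2_norm ?\<mu> h \<le> C0 * real k powr (1 / (\<gamma> + 1))"
      using uh[of k] by (intro exI[of _ "h k"]) (simp add: max_absorb2)
  qed
qed

end
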